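(* Let $R=k[x_1,\ldots,x_n]$ be a polynomial ring over a field $k$ in $n$ variables with its standard grading, let $M$ be a finitely generated graded $R$-module, and let $0\le t\le n$ be an integer. Then (a) $\operatorname{reg}_t(M)=\operatorname{reg}(\operatorname{Syz}_{n-t}(M))-n+t$; (b) $a^*_t(M)=a^*(\operatorname{Syz}_{n-t}(M))$.
   Context: $R_+=(x_1,\ldots,x_n)$. For a finitely generated graded $R$-module $N$, $H^i_{R_+}(N)$ is the $i$-th (graded) local cohomology module of $N$ with respect to $R_+$, and $a_i(N)=\sup\{r\mid H^i_{R_+}(N)_r\ne0\}$ (with value $-\infty$ if $H^i_{R_+}(N)=0$). Set $\operatorname{reg}(N)=\max\{a_i(N)+i\mid i\ge0\}$, $a^*(N)=\max\{a_i(N)\mid i\ge0\}$, $\operatorname{reg}_t(N)=\max\{a_i(N)+i\mid 0\le i\le t\}$, $a_t^*(N)=\max\{a_i(N)\mid 0\le i\le t\}$. Given a minimal graded free resolution $0\to F_s\to\cdots\to F_1\to F_0\to M\to0$ (with $F_i=0$ for $i>s$), the $j$-th syzygy module is $\operatorname{Syz}_j(M)=\operatorname{coker}(F_{j+1}\to F_j)$, so that $\operatorname{Syz}_0(M)=M$, $\operatorname{Syz}_j(M)\cong\operatorname{im}(F_j\to F_{j-1})$ for $j\ge1$, and $\cdots\to F_{j+1}\to F_j\to\operatorname{Syz}_j(M)\to0$ is a minimal graded free resolution. *)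

theory Defs
  imports
    "HOL-Algebra.Module"
    "HOL-Algebra.AbelCoset"
    "HOL-Library.Poly_Mapping"
    "HOL-Library.Extended_Real"
begin

section \<open>The polynomial ring\<close>

type_synonym 'k mpol = "(nat \<Rightarrow>\<^sub>0 nat) \<Rightarrow>\<^sub>0 'k"

text \<open>The variables $x_1, \dots, x_n$ are indexed by $0, \dots, n-1$; an exponent vector is a
  finitely supported function on the indices.\<close>

definition polyring :: "nat \<Rightarrow> ('k::field) mpol ring" where
  "polyring n = \<lparr>carrier = {p. \<forall>m\<in>Poly_Mapping.keys p. Poly_Mapping.keys m \<subseteq> {..<n}},
     mult = (*), one = 1, zero = 0, add = (+)\<rparr>"

definition monom_of :: "(nat \<Rightarrow>\<^sub>0 nat) \<Rightarrow> ('k::field) mpol" where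
  "monom_of m = Poly_Mapping.single m 1"

definition var :: "nat \<Rightarrow> ('k::field) mpol" where
  "var i = monom_of (Poly_Mapping.single i 1)"

definition mdeg :: "(nat \<Rightarrow>\<^sub>0 nat) \<Rightarrow> nat" where
  "mdeg m = (\<Sum>i\<in>Poly_Mapping.keys m. Poly_Mapping.lookup m i)"

definition homog_poly :: "nat \<Rightarrow> nat \<Rightarrow> ('k::field) mpol set" where
  "homog_poly n e = {p \<in> carrier (polyring n). \<forall>m\<in>Poly_Mapping.keys p. mdeg m = e}"

lemma polyring_cring: "cring (polyring n :: ('k::field) mpol ring)"
proof (rule cringI)
  let ?R = "polyring n :: 'k mpol ring"
  show "abelian_group ?R"
  proof (rule abelian_groupI)
    fix p assume "p \<in> carrier ?R"
    then show "\<exists>q\<in>carrier ?R. q \<oplus>\<^bsub>?R\<^esub> p = \<zero>\<^bsub>?R\<^esub>"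
      by (intro bexI[of _ "- p"]) (auto simp: polyring_def in_keys_iff)
  qed (auto simp: polyring_def algebra_simps dest!: subsetD[OF Poly_Mapping.keys_add])
  show "comm_monoid ?R"
  proof (rule comm_monoidI)
    fix p q assume pq: "p \<in> carrier ?R" "q \<in> carrier ?R"
    show "p \<otimes>\<^bsub>?R\<^esub> q \<in> carrier ?R"
      unfolding polyring_def
    proof (simp, intro ballI subsetI)
      fix m i assume "m \<in> Poly_Mapping.keys (p * q)" and i: "i \<in> Poly_Mapping.keys m"
      then obtain a b where ab: "m = a + b" "a \<in> Poly_Mapping.keys p" "b \<in> Poly_Mapping.keys q"
        using keys_mult[of p q] by blast
      then have "i \<in> Poly_Mapping.keys a \<union> Poly_Mapping.keys b"
        using i Poly_Mapping.keys_add[of a b] by blast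
      then show "i \<in> {..<n}"
        using pq ab by (auto simp: polyring_def)
    qed
  qed (auto simp: polyring_def algebra_simps)
qed (auto simp: polyring_def algebra_simps)

section \<open>Graded modules\<close>

record ('a, 'b) gmodule = "('a, 'b) module" +
  gr :: "int \<Rightarrow> 'b set"

locale graded_module = Module.module "polyring n" M
  for n :: nat and M :: "(('k::field) mpol, 'b) gmodule" (structure) +
  assumes gr_subgroup: "\<And>r. additive_subgroup (gr M r) M"
    and gr_smult: "\<And>p e x r. p \<in> homog_poly n e \<Longrightarrow> x \<in> gr M r \<Longrightarrow> p \<odot> x \<in> gr M (r + int e)"
    and gr_direct_sum: "\<And>x. x \<in> carrier M \<Longrightarrow>
      \<exists>!c :: int \<Rightarrow> 'b. (\<forall>r. c r \<in> gr M r) \<and> finite {r. c r \<noteq> \<zero>} \<and>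
        x = (\<Oplus>r\<in>{r. c r \<noteq> \<zero>}. c r)"

definition fin_generated :: "nat \<Rightarrow> (('k::field) mpol, 'b) gmodule \<Rightarrow> bool" where
  "fin_generated n M \<longleftrightarrow> (\<exists>S. finite S \<and> S \<subseteq> carrier M \<and>
     (\<forall>x\<in>carrier M. \<exists>c\<in>S \<rightarrow> carrier (polyring n). x = (\<Oplus>\<^bsub>M\<^esub>b\<in>S. c b \<odot>\<^bsub>M\<^esub> b)))"

text \<open>Finite rank, with a homogeneous basis, i.e. a finite direct sum of shifts $R(-e)$.\<close>

definition graded_free :: "nat \<Rightarrow> (('k::field) mpol, 'b) gmodule \<Rightarrow> bool" where
  "graded_free n F \<longleftrightarrow> graded_module n F \<and>
     (\<exists>B. finite B \<and> B \<subseteq> (\<Union>r. gr F r) \<and>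
       (\<forall>x\<in>carrier F. \<exists>!c. c \<in> B \<rightarrow>\<^sub>E carrier (polyring n) \<and> x = (\<Oplus>\<^bsub>F\<^esub>b\<in>B. c b \<odot>\<^bsub>F\<^esub> b)))"

definition graded_hom ::
  "nat \<Rightarrow> (('k::field) mpol, 'b) gmodule \<Rightarrow> ('k mpol, 'c) gmodule \<Rightarrow> ('b \<Rightarrow> 'c) \<Rightarrow> bool" where
  "graded_hom n M N f \<longleftrightarrow>
     f \<in> carrier M \<rightarrow> carrier N \<and>
     (\<forall>x\<in>carrier M. \<forall>y\<in>carrier M. f (x \<oplus>\<^bsub>M\<^esub> y) = f x \<oplus>\<^bsub>N\<^esub> f y) \<and>
     (\<forall>p\<in>carrier (polyring n). \<forall>x\<in>carrier M. f (p \<odot>\<^bsub>M\<^esub> x) = p \<odot>\<^bsub>N\<^esub> f x) \<and>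
     (\<forall>r. f ` gr M r \<subseteq> gr N r)"

definition gsub :: "('a, 'b) gmodule \<Rightarrow> 'b set \<Rightarrow> ('a, 'b) gmodule" where
  "gsub M N = M\<lparr>carrier := N, gr := (\<lambda>r. gr M r \<inter> N)\<rparr>"

text \<open>The fields \<open>mult\<close> and \<open>one\<close> of a module record are irrelevant.\<close>

definition gquot :: "('a, 'b) gmodule \<Rightarrow> 'b set \<Rightarrow> ('a, 'b set) gmodule" where
  "gquot M H = \<lparr>carrier = a_rcosets\<^bsub>M\<^esub> H, mult = undefined, one = undefined,
     zero = H, add = (\<lambda>A B. A <+>\<^bsub>M\<^esub> B),
     smult = (\<lambda>p A. \<Union>x\<in>A. H +>\<^bsub>M\<^esub> (p \<odot>\<^bsub>M\<^esub> x)),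
     gr = (\<lambda>r. (\<lambda>x. H +>\<^bsub>M\<^esub> x) ` gr M r)\<rparr>"

section \<open>Minimal graded free resolutions and syzygies\<close>

text \<open>The submodule $R_+ M = x_1 M + \dots + x_n M$.\<close>

definition irrelevant_smult :: "nat \<Rightarrow> (('k::field) mpol, 'b) gmodule \<Rightarrow> 'b set" where
  "irrelevant_smult n M = {(\<Oplus>\<^bsub>M\<^esub>i\<in>{..<n}. var i \<odot>\<^bsub>M\<^esub> y i) | y. y \<in> {..<n} \<rightarrow> carrier M}"

text \<open>The differential \<open>d i\<close> maps \<open>F (Suc i)\<close> to \<open>F i\<close>, and \<open>aug\<close> is the augmentation
  \<open>F 0\<close> to \<open>M\<close>; the length is at most \<open>s\<close>.\<close>

definition minimal_free_resolution ::
  "nat \<Rightarrow> (('k::field) mpol, 'b) gmodule \<Rightarrow> nat \<Rightarrow> (nat \<Rightarrow> ('k mpol, 'f) gmodule) \<Rightarrow>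
   (nat \<Rightarrow> 'f \<Rightarrow> 'f) \<Rightarrow> ('f \<Rightarrow> 'b) \<Rightarrow> bool" where
  "minimal_free_resolution n M s F d aug \<longleftrightarrow>
     (\<forall>i. graded_free n (F i)) \<and>
     (\<forall>i>s. carrier (F i) = {\<zero>\<^bsub>F i\<^esub>}) \<and>
     (\<forall>i. graded_hom n (F (Suc i)) (F i) (d i)) \<and>
     graded_hom n (F 0) M aug \<and>
     aug ` carrier (F 0) = carrier M \<and>
     a_kernel (F 0) M aug = d 0 ` carrier (F 1) \<and>
     (\<forall>i. a_kernel (F (Suc i)) (F i) (d i) = d (Suc i) ` carrier (F (Suc (Suc i)))) \<and>
     (\<forall>i. d i ` carrier (F (Suc i)) \<subseteq> irrelevant_smult n (F i))"

definition Syz ::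
  "(nat \<Rightarrow> ('a, 'f) gmodule) \<Rightarrow> (nat \<Rightarrow> 'f \<Rightarrow> 'f) \<Rightarrow> nat \<Rightarrow> ('a, 'f set) gmodule" where
  "Syz F d j = gquot (F j) (d j ` carrier (F (Suc j)))"

section \<open>Local cohomology\<close>

text \<open>Local cohomology with respect to $R_+ = (x_1, \dots, x_n)$ is the cohomology of the graded
  \v{C}ech complex $C^p(M) = \bigoplus_{|I| = p} M_{x_I}$, where $x_I = \prod_{i \in I} x_i$.
  The localization $M_{x_I}$ is formed by inverting the multiplicative set of all monomials in the
  variables $x_i$, $i \in I$. For $I \subseteq J$ these sets are nested, so that the
  canonical map $M_{x_I} \to M_{x_J}$ sends a fraction to the same fraction.\<close>

definition monoms_on :: "nat set \<Rightarrow> ('k::field) mpol set" where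
  "monoms_on I = monom_of ` {m. Poly_Mapping.keys m \<subseteq> I}"

definition loc_rel ::
  "nat set \<Rightarrow> (('k::field) mpol, 'b) gmodule \<Rightarrow> (('b \<times> 'k mpol) \<times> ('b \<times> 'k mpol)) set" where
  "loc_rel I M = {((x, s), (y, u)). x \<in> carrier M \<and> s \<in> monoms_on I \<and>
     y \<in> carrier M \<and> u \<in> monoms_on I \<and>
     (\<exists>v\<in>monoms_on I. (v * u) \<odot>\<^bsub>M\<^esub> x = (v * s) \<odot>\<^bsub>M\<^esub> y)}"

definition frac ::
  "nat set \<Rightarrow> (('k::field) mpol, 'b) gmodule \<Rightarrow> 'b \<Rightarrow> 'k mpol \<Rightarrow> ('b \<times> 'k mpol) set" where
  "frac I M x s = loc_rel I M `` {(x, s)}"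

definition gloc ::
  "nat set \<Rightarrow> (('k::field) mpol, 'b) gmodule \<Rightarrow> ('k mpol, ('b \<times> 'k mpol) set) gmodule" where
  "gloc I M = \<lparr>carrier = (carrier M \<times> monoms_on I) // loc_rel I M,
     mult = undefined, one = undefined,
     zero = frac I M \<zero>\<^bsub>M\<^esub> 1,
     add = (\<lambda>A B. \<Union>(x, s)\<in>A. \<Union>(y, u)\<in>B. frac I M (u \<odot>\<^bsub>M\<^esub> x \<oplus>\<^bsub>M\<^esub> s \<odot>\<^bsub>M\<^esub> y) (s * u)),
     smult = (\<lambda>p A. \<Union>(x, s)\<in>A. frac I M (p \<odot>\<^bsub>M\<^esub> x) s),
     gr = (\<lambda>r. {frac I M x (monom_of m) | x m.
       Poly_Mapping.keys m \<subseteq> I \<and> x \<in> gr M (r + int (mdeg m))})\<rparr>"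

definition loc_map ::
  "nat set \<Rightarrow> (('k::field) mpol, 'b) gmodule \<Rightarrow> ('b \<times> 'k mpol) set \<Rightarrow> ('b \<times> 'k mpol) set" where
  "loc_map J M A = (\<Union>(x, s)\<in>A. frac J M x s)"

definition subs :: "nat \<Rightarrow> nat \<Rightarrow> nat set set" where
  "subs n p = {I. I \<subseteq> {..<n} \<and> card I = p}"

definition cech :: "nat \<Rightarrow> (('k::field) mpol, 'b) gmodule \<Rightarrow> nat \<Rightarrow>
    ('k mpol, nat set \<Rightarrow> ('b \<times> 'k mpol) set) gmodule" where
  "cech n M p = \<lparr>carrier = (\<Pi>\<^sub>E I\<in>subs n p. carrier (gloc I M)),
     mult = undefined, one = undefined,
     zero = (\<lambda>I\<in>subs n p. \<zero>\<^bsub>gloc I M\<^esub>),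
     add = (\<lambda>a b. \<lambda>I\<in>subs n p. a I \<oplus>\<^bsub>gloc I M\<^esub> b I),
     smult = (\<lambda>q a. \<lambda>I\<in>subs n p. q \<odot>\<^bsub>gloc I M\<^esub> a I),
     gr = (\<lambda>r. \<Pi>\<^sub>E I\<in>subs n p. gr (gloc I M) r)\<rparr>"

definition cech_diff :: "nat \<Rightarrow> (('k::field) mpol, 'b) gmodule \<Rightarrow> nat \<Rightarrow>
    (nat set \<Rightarrow> ('b \<times> 'k mpol) set) \<Rightarrow> (nat set \<Rightarrow> ('b \<times> 'k mpol) set)" where
  "cech_diff n M p a = (\<lambda>J\<in>subs n (Suc p).
     \<Oplus>\<^bsub>gloc J M\<^esub>i\<in>J. (-1) ^ card {j\<in>J. j < i} \<odot>\<^bsub>gloc J M\<^esub> loc_map J M (a (J - {i})))"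

fun cech_coboundaries :: "nat \<Rightarrow> (('k::field) mpol, 'b) gmodule \<Rightarrow> nat \<Rightarrow>
    (nat set \<Rightarrow> ('b \<times> 'k mpol) set) set" where
  "cech_coboundaries n M 0 = {\<zero>\<^bsub>cech n M 0\<^esub>}"
| "cech_coboundaries n M (Suc p) = cech_diff n M p ` carrier (cech n M p)"

definition local_cohomology :: "nat \<Rightarrow> (('k::field) mpol, 'b) gmodule \<Rightarrow> nat \<Rightarrow>
    ('k mpol, (nat set \<Rightarrow> ('b \<times> 'k mpol) set) set) gmodule" where
  "local_cohomology n M i =
     gquot (gsub (cech n M i) (a_kernel (cech n M i) (cech n M (Suc i)) (cech_diff n M i)))
       (cech_coboundaries n M i)"

section \<open>Regularities and a-invariants\<close>

text \<open>In \<open>ereal\<close> the supremum of the empty set is $-\infty$.\<close>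

definition a_inv :: "nat \<Rightarrow> (('k::field) mpol, 'b) gmodule \<Rightarrow> nat \<Rightarrow> ereal" where
  "a_inv n N i = Sup {ereal (real_of_int r) | r.
     gr (local_cohomology n N i) r \<noteq> {\<zero>\<^bsub>local_cohomology n N i\<^esub>}}"

definition reg :: "nat \<Rightarrow> (('k::field) mpol, 'b) gmodule \<Rightarrow> ereal" where
  "reg n N = (SUP i. a_inv n N i + ereal (real i))"

definition a_star :: "nat \<Rightarrow> (('k::field) mpol, 'b) gmodule \<Rightarrow> ereal" where
  "a_star n N = (SUP i. a_inv n N i)"

definition reg_upto :: "nat \<Rightarrow> nat \<Rightarrow> (('k::field) mpol, 'b) gmodule \<Rightarrow> ereal" where
  "reg_upto n t N = (SUP i\<in>{0..t}. a_inv n N i + ereal (real i))"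

definition a_star_upto :: "nat \<Rightarrow> nat \<Rightarrow> (('k::field) mpol, 'b) gmodule \<Rightarrow> ereal" where
  "a_star_upto n t N = (SUP i\<in>{0..t}. a_inv n N i)"

end

theory Submission
  imports Defs "HOL-Library.Function_Algebras"
begin

text \<open>
  Let $F_\bullet$ be the minimal resolution and $N_j$ the $j$-th syzygy module, so that
  $0 \to N_{j+1} \to F_j \to N_j \to 0$ is exact. As $H^q(F_j) = 0$ for $q < n$, the connecting maps
  $H^q(N_j) \to H^{q+1}(N_{j+1})$ are injective for $q < n$ and bijective for $q + 1 < n$. Hence
  only the top cohomology $H^n(N_{n-t})$ needs an argument. It is a quotient of $H^n(F_{n-t})$, whose
  top degree is $b - n$ with $b$ the largest degree of a generator. Let $e$ be such a generator of
  $F_j$, $j \ge 1$. By minimality the socle class $x_1^{-1} \cdots x_n^{-1} e$ dies in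
  $H^n(F_{j-1})$. If it survives in $H^n(N_j)$, it therefore comes from $H^{n-1}(N_{j-1})$.
  Otherwise it is hit by $H^n(F_{j+1})$, and minimality forces $F_{j+1}$ to have a generator of
  degree larger than $b$; one concludes by descending induction on $j$.

  Everything is computed with Laurent vectors: the localization of a free module with basis \<open>B\<close> is a
  set of functions \<open>B \<rightarrow> (exponents) \<rightarrow> k\<close>, and a quotient is handled by computing modulo the
  localized submodule of relations, so that neither quotients nor fractions occur.\<close>

section \<open>Laurent vectors and the Cech complex of a free module\<close>

text \<open>The obstacle is that H^{n-1}(N_j) -> H^n(N_{j+1}) need not be onto, so a top class of
  N_{n-t} need not come from M. It is not transported; a class of M that is at least as extreme is
  produced instead. The quantity to follow is degree plus cohomological index. A generator of
  F_{j+1} of degree at least r + n yields a nonzero class of N_j of degree r' in some H^q with q <=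
  n - 1 and r + n - 1 <= r' + q. This one inequality serves both parts: sliding down to M lowers q
  in a known way and keeps r', which gives (a), and q <= n - 1 forces r <= r', which gives (b). The
  induction closes because a socle class that does not survive raises the generator degree by at
  least one, which pays for the index lost in passing from N_{j+1} to N_j. The exponent (-1, ...,
  -1) is the right one to look at because multiplication by x_1 ... x_n moves it to exponent 0, the
  only coefficient that minimality controls.\<close>

type_synonym ('f, 'k) laurent = "'f \<Rightarrow> (nat \<Rightarrow> int) \<Rightarrow> 'k"

lemma sum_fun_apply: "(\<Sum>i\<in>S. g i) x = (\<Sum>i\<in>S. g i x)"
  for g :: "'i \<Rightarrow> 'a \<Rightarrow> 'b::comm_monoid_add"
  by (induction S rule: infinite_finite_induct) auto

text \<open>Multiplication by the Laurent monomial x^m. Entries of \<open>m\<close> may be negative,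
  so division by a monomial is a shift as well.\<close>

definition shift :: "(nat \<Rightarrow> int) \<Rightarrow> ('f, 'k) laurent \<Rightarrow> ('f, 'k) laurent" where
  "shift m f = (\<lambda>b \<alpha>. f b (\<alpha> - m))"

lemma shift_apply: "shift m f b \<alpha> = f b (\<alpha> - m)"
  by (simp add: shift_def)

lemma shift_shift [simp]: "shift m (shift m' f) = shift (m + m') f"
  by (simp add: shift_def algebra_simps)

lemma shift_zero [simp]: "shift 0 f = f"
  by (simp add: shift_def)

lemma shift_add: "shift m (f + g) = shift m f + shift m g"
  by (simp add: shift_def fun_eq_iff)

lemma shift_diff: "shift m (f - g) = shift m f - shift m g"
  for f :: "('f, 'k::ab_group_add) laurent"
  by (simp add: shift_def fun_eq_iff)

lemma shift_of_zero [simp]: "shift m 0 = 0"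
  by (simp add: shift_def fun_eq_iff)

text \<open>The exponents of the monomials that become invertible at x_I, i.e. of the admissible
  denominators.\<close>

definition expo :: "nat set \<Rightarrow> (nat \<Rightarrow> int) set" where
  "expo I = {m. (\<forall>i. 0 \<le> m i) \<and> (\<forall>i. i \<notin> I \<longrightarrow> m i = 0)}"

lemma expo_zero [simp]: "0 \<in> expo I"
  by (simp add: expo_def)

lemma expo_add: "m \<in> expo I \<Longrightarrow> m' \<in> expo I \<Longrightarrow> m + m' \<in> expo I"
  by (simp add: expo_def)

lemma expo_mono: "I \<subseteq> J \<Longrightarrow> m \<in> expo I \<Longrightarrow> m \<in> expo J"
  by (auto simp: expo_def)

lemma ex_expo_ge:
  assumes "finite S"
  shows "\<exists>m\<in>expo I. \<forall>\<alpha>\<in>S. \<forall>i\<in>I. - \<alpha> i \<le> m i"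
  using assms
proof (induction S)
  case empty
  then show ?case using expo_zero by blast
next
  case (insert \<alpha> S)
  then obtain m where m: "m \<in> expo I" "\<forall>\<alpha>\<in>S. \<forall>i\<in>I. - \<alpha> i \<le> m i" by blast
  show ?case
  proof (rule bexI)
    show "(\<lambda>i. if i \<in> I then max (m i) (- \<alpha> i) else 0) \<in> expo I"
      using m(1) by (auto simp: expo_def intro: max.coboundedI1)
  qed (use m in force)
qed

locale laurent_vectors =
  fixes n :: nat
begin

text \<open>The localization of the free module with basis \<open>B\<close> at $x_I$, as Laurent vectors.\<close>

definition Loc :: "'f set \<Rightarrow> nat set \<Rightarrow> ('f, 'k::field) laurent set" where
  "Loc B I = {f. (\<forall>b. finite {\<alpha>. f b \<alpha> \<noteq> 0}) \<and>
     (\<forall>b \<alpha>. f b \<alpha> \<noteq> 0 \<longrightarrow> b \<in> B \<and> (\<forall>i. n \<le> i \<longrightarrow> \<alpha> i = 0) \<and> (\<forall>i<n. i \<notin> I \<longrightarrow> 0 \<le> \<alpha> i))}"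

text \<open>The localization of a submodule \<open>D\<close> inside the localized free module: the
  vectors that some admissible denominator carries into \<open>D\<close>. Equality of classes modulo
  \<open>D\<close> becomes membership of a difference.\<close>

definition LocD :: "'f set \<Rightarrow> ('f, 'k::field) laurent set \<Rightarrow> nat set \<Rightarrow> ('f, 'k) laurent set" where
  "LocD B D I = {h \<in> Loc B I. \<exists>m\<in>expo I. shift m h \<in> D}"

definition tdeg :: "(nat \<Rightarrow> int) \<Rightarrow> int" where
  "tdeg \<alpha> = (\<Sum>i<n. \<alpha> i)"

definition homog :: "('f \<Rightarrow> int) \<Rightarrow> int \<Rightarrow> ('f, 'k::field) laurent \<Rightarrow> bool" where
  "homog dg r f \<longleftrightarrow> (\<forall>b \<alpha>. f b \<alpha> \<noteq> 0 \<longrightarrow> dg b + tdeg \<alpha> = r)"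

definition hcomp :: "('f \<Rightarrow> int) \<Rightarrow> int \<Rightarrow> ('f, 'k::field) laurent \<Rightarrow> ('f, 'k) laurent" where
  "hcomp dg r f = (\<lambda>b \<alpha>. if dg b + tdeg \<alpha> = r then f b \<alpha> else 0)"

text \<open>The Cech differential. The canonical maps between localizations are inclusions of sets
  of Laurent vectors and leave no trace in the formula.\<close>

definition delta :: "(nat set \<Rightarrow> ('f, 'k::field) laurent) \<Rightarrow> nat set \<Rightarrow> ('f, 'k) laurent" where
  "delta a J = (\<lambda>b \<alpha>. \<Sum>i\<in>J. (-1) ^ card {j\<in>J. j < i} * a (J - {i}) b \<alpha>)"

text \<open>A family over all index sets, not only those of one cardinality, so that one notion
  serves every cohomological degree; statements in degree \<open>q\<close> look at
  \<open>subs n q\<close> only.\<close>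

definition cochain :: "'f set \<Rightarrow> (nat set \<Rightarrow> ('f, 'k::field) laurent) \<Rightarrow> bool" where
  "cochain B a \<longleftrightarrow> (\<forall>I\<subseteq>{..<n}. a I \<in> Loc B I)"

text \<open>A cocycle modulo \<open>D\<close> of degree \<open>r\<close> that represents a nonzero class in the $q$-th local
  cohomology of the free module on \<open>B\<close> modulo \<open>D\<close>; the competing cochains \<open>b\<close> need not be
  homogeneous.\<close>

definition coh_witness :: "'f set \<Rightarrow> ('f \<Rightarrow> int) \<Rightarrow> ('f, 'k::field) laurent set \<Rightarrow> nat \<Rightarrow> int \<Rightarrow>
    (nat set \<Rightarrow> ('f, 'k) laurent) \<Rightarrow> bool" where
  "coh_witness B dg D q r a \<longleftrightarrow> cochain B a \<and> (\<forall>I\<in>subs n q. homog dg r (a I)) \<and>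
     (\<forall>J\<in>subs n (Suc q). delta a J \<in> LocD B D J) \<and>
     \<not> (\<exists>b. cochain B b \<and> (\<forall>I\<in>subs n q. a I - delta b I \<in> LocD B D I))"

definition coh_nonzero :: "'f set \<Rightarrow> ('f \<Rightarrow> int) \<Rightarrow> ('f, 'k::field) laurent set \<Rightarrow> nat \<Rightarrow> int \<Rightarrow> bool" where
  "coh_nonzero B dg D q r \<longleftrightarrow> (\<exists>a. coh_witness B dg D q r a)"

section \<open>Closure properties of the localizations\<close>

lemma Loc_finite: "f \<in> Loc B I \<Longrightarrow> finite {\<alpha>. f b \<alpha> \<noteq> 0}"
  and Loc_basis: "f \<in> Loc B I \<Longrightarrow> f b \<alpha> \<noteq> 0 \<Longrightarrow> b \<in> B"
  and Loc_above: "f \<in> Loc B I \<Longrightarrow> f b \<alpha> \<noteq> 0 \<Longrightarrow> n \<le> i \<Longrightarrow> \<alpha> i = 0"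
  and Loc_nonneg: "f \<in> Loc B I \<Longrightarrow> f b \<alpha> \<noteq> 0 \<Longrightarrow> i < n \<Longrightarrow> i \<notin> I \<Longrightarrow> 0 \<le> \<alpha> i"
  by (simp_all add: Loc_def)

lemma finite_supp_add:
  fixes f g :: "'x \<Rightarrow> 'k::ab_group_add"
  assumes "finite {\<alpha>. f \<alpha> \<noteq> 0}" "finite {\<alpha>. g \<alpha> \<noteq> 0}"
  shows "finite {\<alpha>. f \<alpha> + g \<alpha> \<noteq> 0}"
  by (rule finite_subset[OF _ finite_UnI[OF assms]]) auto

lemma Loc_add:
  assumes "f \<in> Loc B I" "g \<in> Loc B I" shows "f + g \<in> Loc B I"
  unfolding Loc_def
proof (intro CollectI conjI allI impI)
  show "finite {\<alpha>. (f + g) b \<alpha> \<noteq> 0}" for b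
    using finite_supp_add[of "f b" "g b"] assms by (simp add: Loc_def)
  fix b \<alpha> assume "(f + g) b \<alpha> \<noteq> 0"
  then have "f b \<alpha> \<noteq> 0 \<or> g b \<alpha> \<noteq> 0" by auto
  then show "b \<in> B" "\<And>i. n \<le> i \<Longrightarrow> \<alpha> i = 0" "\<And>i. i < n \<Longrightarrow> i \<notin> I \<Longrightarrow> 0 \<le> \<alpha> i"
    using assms unfolding Loc_def by blast+
qed

lemma Loc_zero [simp]: "0 \<in> Loc B I"
  by (simp add: Loc_def)

lemma Loc_uminus: "f \<in> Loc B I \<Longrightarrow> - f \<in> Loc B I"
  by (simp add: Loc_def)

lemma Loc_diff: "f \<in> Loc B I \<Longrightarrow> g \<in> Loc B I \<Longrightarrow> f - g \<in> Loc B I"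
  using Loc_add[OF _ Loc_uminus, of f B I g] by simp

lemma Loc_scale: "f \<in> Loc B I \<Longrightarrow> (\<lambda>b \<alpha>. c * f b \<alpha>) \<in> Loc B I"
  by (auto simp: Loc_def)

lemma Loc_sum: "(\<And>i. i \<in> S \<Longrightarrow> g i \<in> Loc B I) \<Longrightarrow> (\<Sum>i\<in>S. g i) \<in> Loc B I"
  by (induction S rule: infinite_finite_induct) (auto intro: Loc_add)

lemma Loc_mono: "I \<subseteq> J \<Longrightarrow> f \<in> Loc B I \<Longrightarrow> f \<in> Loc B J"
  unfolding Loc_def by blast

lemma Loc_restrict: "f \<in> Loc B I \<Longrightarrow> (\<lambda>b \<alpha>. if P b \<alpha> then f b \<alpha> else 0) \<in> Loc B I"
proof -
  assume f: "f \<in> Loc B I"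
  have "finite {\<alpha>. (if P b \<alpha> then f b \<alpha> else 0) \<noteq> 0}" for b
    by (rule finite_subset[OF _ Loc_finite[OF f, of b]]) (auto split: if_splits)
  with f show ?thesis by (auto simp: Loc_def)
qed

lemma Loc_hcomp: "f \<in> Loc B I \<Longrightarrow> hcomp dg r f \<in> Loc B I"
  unfolding hcomp_def by (rule Loc_restrict)

lemma finite_shift_supp: "finite {\<alpha>. f \<alpha> \<noteq> 0} \<Longrightarrow> finite {\<alpha>. f (\<alpha> - m) \<noteq> 0}"
  for f :: "(nat \<Rightarrow> int) \<Rightarrow> 'k::field"
proof -
  assume fin: "finite {\<alpha>. f \<alpha> \<noteq> 0}"
  have "\<alpha> \<in> (\<lambda>\<alpha>. \<alpha> + m) ` {\<alpha>. f \<alpha> \<noteq> 0}" if "f (\<alpha> - m) \<noteq> 0" for \<alpha>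
    using that by (intro image_eqI[of _ _ "\<alpha> - m"]) simp_all
  then show ?thesis
    by (intro finite_surj[OF fin, of _ "\<lambda>\<alpha>. \<alpha> + m"]) blast
qed

lemma Loc_shift:
  assumes f: "f \<in> Loc B I" and I: "I \<subseteq> {..<n}" and m: "\<And>i. i \<notin> I \<Longrightarrow> m i = 0"
  shows "shift m f \<in> Loc B I"
  unfolding Loc_def
proof (intro CollectI conjI allI impI)
  show "finite {\<alpha>. shift m f b \<alpha> \<noteq> 0}" for b
    using f finite_shift_supp[of "f b" m] by (simp add: Loc_def shift_def)
  fix b \<alpha> assume nz: "shift m f b \<alpha> \<noteq> 0"
  show "b \<in> B" using nz Loc_basis[OF f] by (simp add: shift_apply)
  show "\<alpha> i = 0" if "n \<le> i" for i
  proof -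
    have "(\<alpha> - m) i = 0" "i \<notin> I"
      using nz that I Loc_above[OF f, of b "\<alpha> - m" i] by (auto simp: shift_apply)
    then show ?thesis using m by simp
  qed
  show "0 \<le> \<alpha> i" if "i < n" "i \<notin> I" for i
  proof -
    have "(\<alpha> - m) i \<ge> 0" using Loc_nonneg[OF f, of b "\<alpha> - m" i] nz that by (simp add: shift_apply)
    then show ?thesis using m[of i] that by simp
  qed
qed

lemma Loc_shift_expo:
  assumes f: "f \<in> Loc B I" and m: "m \<in> expo {..<n}"
  shows "shift m f \<in> Loc B I"
  unfolding Loc_def
proof (intro CollectI conjI allI impI)
  show "finite {\<alpha>. shift m f b \<alpha> \<noteq> 0}" for b
    using f finite_shift_supp[of "f b" m] by (simp add: Loc_def shift_def)
  fix b \<alpha> assume nz: "shift m f b \<alpha> \<noteq> 0"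
  show "b \<in> B" using nz Loc_basis[OF f] by (simp add: shift_apply)
  show "\<alpha> i = 0" if "n \<le> i" for i
  proof -
    have "(\<alpha> - m) i = 0"
      using nz that Loc_above[OF f, of b "\<alpha> - m" i] by (auto simp: shift_apply)
    then show ?thesis using m that by (simp add: expo_def)
  qed
  show "0 \<le> \<alpha> i" if "i < n" "i \<notin> I" for i
  proof -
    have "(\<alpha> - m) i \<ge> 0" "m i \<ge> 0"
      using m Loc_nonneg[OF f, of b "\<alpha> - m" i] nz that by (simp_all add: shift_apply expo_def)
    then show ?thesis by simp
  qed
qed

text \<open>Finiteness of \<open>B\<close> and of each support leaves finitely many exponents, and
  one monomial clears them all.\<close>

lemma Loc_clear_denominator:
  assumes f: "f \<in> Loc B I" and B: "finite B" and I: "I \<subseteq> {..<n}"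
  shows "\<exists>m\<in>expo I. shift m f \<in> Loc B {}"
proof -
  have "finite (\<Union>b\<in>B. {\<alpha>. f b \<alpha> \<noteq> 0})"
    using f B by (auto simp: Loc_def)
  from ex_expo_ge[OF this, of I] obtain m where m: "m \<in> expo I"
    "\<forall>\<alpha>\<in>(\<Union>b\<in>B. {\<alpha>. f b \<alpha> \<noteq> 0}). \<forall>i\<in>I. - \<alpha> i \<le> m i" by blast
  have *: "shift m f \<in> Loc B I"
    using m(1) by (intro Loc_shift f I) (auto simp: expo_def)
  have "shift m f \<in> Loc B {}"
    unfolding Loc_def
  proof (intro CollectI conjI allI impI)
    fix b \<alpha> i assume nz: "shift m f b \<alpha> \<noteq> 0" and "i < n"
    show "0 \<le> \<alpha> i"
    proof (cases "i \<in> I")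
      case True
      have "b \<in> B" using nz Loc_basis[OF f] by (simp add: shift_apply)
      then have "- (\<alpha> - m) i \<le> m i"
        using m(2) True nz unfolding shift_def by blast
      then show ?thesis by simp
    qed (use Loc_nonneg[OF * nz \<open>i < n\<close>] in simp)
  qed (use Loc_finite[OF *] Loc_basis[OF *] Loc_above[OF *] in auto)
  with m(1) show ?thesis by blast
qed

section \<open>Degrees and the Cech differential\<close>

lemma tdeg_diff: "tdeg (\<alpha> - \<beta>) = tdeg \<alpha> - tdeg \<beta>"
  and tdeg_uminus: "tdeg (- \<alpha>) = - tdeg \<alpha>"
  by (simp_all add: tdeg_def sum_subtractf sum_negf)

lemma homog_shift: "homog dg r f \<Longrightarrow> homog dg (r + tdeg m) (shift m f)"
  by (fastforce simp: homog_def shift_def tdeg_diff)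

lemma homog_hcomp: "homog dg r (hcomp dg r f)"
  by (simp add: homog_def hcomp_def)

lemma hcomp_homog: "homog dg r f \<Longrightarrow> hcomp dg s f = (if s = r then f else 0)"
  by (auto simp: homog_def hcomp_def fun_eq_iff)

lemma hcomp_homog_same: "homog dg r f \<Longrightarrow> hcomp dg r f = f"
  by (simp add: hcomp_homog)

lemma hcomp_shift: "hcomp dg (r + tdeg m) (shift m f) = shift m (hcomp dg r f)"
  by (auto simp: hcomp_def shift_def tdeg_diff fun_eq_iff)

lemma delta_eq_sum: "delta a J = (\<Sum>i\<in>J. (\<lambda>b \<alpha>. (-1) ^ card {j\<in>J. j < i} * a (J - {i}) b \<alpha>))"
  by (simp add: delta_def fun_eq_iff sum_fun_apply)

lemma delta_add: "delta (\<lambda>I. a I + b I) J = delta a J + delta b J"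
  by (simp add: delta_def fun_eq_iff sum.distrib algebra_simps)

lemma delta_diff: "delta (\<lambda>I. a I - b I) J = delta a J - delta b J"
  by (simp add: delta_def fun_eq_iff sum_subtractf algebra_simps)

lemma delta_hcomp: "delta (\<lambda>I. hcomp dg r (a I)) J = hcomp dg r (delta a J)"
  by (auto simp: delta_def hcomp_def fun_eq_iff intro!: sum.neutral)

lemma delta_cong: "(\<And>i. i \<in> J \<Longrightarrow> a (J - {i}) = b (J - {i})) \<Longrightarrow> delta a J = delta b J"
  by (simp add: delta_def)

lemma delta_zero [simp]: "delta (\<lambda>I. 0) J = 0"
  by (simp add: delta_def fun_eq_iff)

lemma homog_zero [simp]: "homog dg r 0"
  by (simp add: homog_def)

lemma cochain_remove:
  assumes "cochain B a" "J \<subseteq> {..<n}"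
  shows "a (J - {i}) \<in> Loc B J"
proof (rule Loc_mono)
  have "J - {i} \<subseteq> {..<n}" using assms(2) by blast
  then show "a (J - {i}) \<in> Loc B (J - {i})" using assms(1) by (simp add: cochain_def)
qed blast

lemma cochain_delta: "cochain B a \<Longrightarrow> cochain B (delta a)"
  unfolding cochain_def delta_eq_sum
  by (intro allI impI Loc_sum Loc_scale cochain_remove) (simp_all add: cochain_def)

lemma subs_subset: "I \<in> subs n q \<Longrightarrow> I \<subseteq> {..<n}"
  by (simp add: subs_def)

lemma subs_remove: "J \<in> subs n (Suc q) \<Longrightarrow> i \<in> J \<Longrightarrow> J - {i} \<in> subs n q"
  by (auto simp: subs_def)

lemma finite_subs_elem: "J \<in> subs n q \<Longrightarrow> finite J"
  by (auto simp: subs_def intro: finite_subset)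

text \<open>Removing the smaller index \<open>i\<close> lowers the position of \<open>k\<close> by
  one and leaves that of \<open>i\<close> alone. This is the only sign rule behind both
  \<open>delta_delta\<close> and the contracting homotopy.\<close>

lemma sign_swap_remove:
  fixes J :: "nat set"
  assumes "finite J" "i \<in> J" "k \<in> J" "i < k"
  shows "(-1) ^ card {j\<in>J. j < i} * (-1) ^ card {j\<in>J - {i}. j < k} =
    - ((-1) ^ card {j\<in>J. j < k} * (-1) ^ card {j\<in>J - {k}. j < i} :: 'k::field)"
proof -
  have 1: "{j\<in>J - {k}. j < i} = {j\<in>J. j < i}" using assms by auto
  have 2: "{j. j \<in> J \<and> j < k} = insert i {j\<in>J - {i}. j < k}" using assms by auto
  have "card {j\<in>J. j < k} = Suc (card {j\<in>J - {i}. j < k})"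
    unfolding 2 using assms(1) by simp
  then show ?thesis unfolding 1 by simp
qed

lemma delta_delta:
  assumes "finite J" shows "delta (delta a) J = 0"
proof (intro ext)
  fix b \<alpha>
  define t where "t i k = (-1) ^ card {j\<in>J. j < i} * ((-1) ^ card {j\<in>J - {i}. j < k} * a (J - {i} - {k}) b \<alpha>)" for i k
  have anti: "t i k = - t k i" if "i \<in> J" "k \<in> J" "i < k" for i k
    using sign_swap_remove[OF assms that, where 'k = 'b]
    by (simp add: t_def Diff_insert2[symmetric] insert_commute mult.assoc[symmetric])
  \<comment> \<open>The ordered pairs of removed indices split by which one is smaller; swapping
    matches the two halves with opposite signs.\<close>
  let ?U = "{(i, k). i \<in> J \<and> k \<in> J \<and> i < k}" and ?V = "{(i, k). i \<in> J \<and> k \<in> J \<and> k < i}"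
  have fin: "finite ?U" "finite ?V"
    by (rule finite_subset[of _ "J \<times> J"]; use assms in auto)+
  have "delta (delta a) J b \<alpha> = (\<Sum>i\<in>J. \<Sum>k\<in>J - {i}. t i k)"
    by (simp add: delta_def t_def sum_distrib_left)
  also have "\<dots> = (\<Sum>(i, k)\<in>(SIGMA i:J. J - {i}). t i k)"
    using assms by (subst sum.Sigma) auto
  also have "(SIGMA i:J. J - {i}) = ?U \<union> ?V"
    by auto
  also have "(\<Sum>(i, k)\<in>?U \<union> ?V. t i k) = (\<Sum>(i, k)\<in>?U. t i k) + (\<Sum>(i, k)\<in>?V. t i k)"
    using fin by (intro sum.union_disjoint) auto
  also have "(\<Sum>(i, k)\<in>?V. t i k) = (\<Sum>(i, k)\<in>?U. t k i)"
    by (rule sum.reindex_bij_witness[of _ prod.swap prod.swap]) auto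
  also have "(\<Sum>(i, k)\<in>?U. t i k) + (\<Sum>(i, k)\<in>?U. t k i) = (\<Sum>(i, k)\<in>?U. t i k + t k i)"
    by (simp add: sum.distrib case_prod_beta)
  also have "\<dots> = 0"
    using anti by (intro sum.neutral) auto
  finally show "delta (delta a) J b \<alpha> = 0 b \<alpha>" by simp
qed

text \<open>For a fixed multidegree \<open>\<alpha>\<close> with \<open>0 \<le> \<alpha> c\<close>, adjoining \<open>c\<close> is a contracting homotopy
  of the \<open>\<alpha>\<close>-part of the complex.\<close>

lemma free_cocycle_is_coboundary:
  assumes a: "cochain B a" and cyc: "\<And>J. J \<in> subs n (Suc q) \<Longrightarrow> delta a J = 0"
    and neg: "\<And>I b (\<alpha> :: nat \<Rightarrow> int). I \<in> subs n q \<Longrightarrow> (\<And>i. i < n \<Longrightarrow> \<alpha> i < 0) \<Longrightarrow> a I b \<alpha> = 0"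
  shows "\<exists>e. cochain B e \<and> (\<forall>I\<in>subs n q. a I = delta e I)"
proof -
  define N where "N \<alpha> \<longleftrightarrow> (\<exists>i<n. 0 \<le> \<alpha> i)" for \<alpha> :: "nat \<Rightarrow> int"
  \<comment> \<open>The pivot depends on the exponent alone, not on \<open>I\<close> or on the basis
    element, so the homotopy identity can be checked one coefficient at a time.\<close>
  define c where "c \<alpha> = (SOME i. i < n \<and> 0 \<le> \<alpha> i)" for \<alpha> :: "nat \<Rightarrow> int"
  have c: "c \<alpha> < n" "0 \<le> \<alpha> (c \<alpha>)" if "N \<alpha>" for \<alpha>
    using someI_ex[of "\<lambda>i. i < n \<and> 0 \<le> \<alpha> i"] that by (auto simp: N_def c_def)
  define e where "e I = (\<lambda>b \<alpha>. if N \<alpha> \<and> c \<alpha> \<notin> I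
      then (-1) ^ card {j\<in>I. j < c \<alpha>} * a (insert (c \<alpha>) I) b \<alpha> else 0)" for I
  have "cochain B e"
    unfolding cochain_def Loc_def
  proof (intro allI impI CollectI conjI)
    fix I assume I: "I \<subseteq> {..<n}"
    have ai: "a (insert i I) \<in> Loc B (insert i I)" if "i < n" for i
      using a I that by (auto simp: cochain_def)
    show "finite {\<alpha>. e I b \<alpha> \<noteq> 0}" for b
    proof (rule finite_subset)
      show "{\<alpha>. e I b \<alpha> \<noteq> 0} \<subseteq> (\<Union>i<n. {\<alpha>. a (insert i I) b \<alpha> \<noteq> 0})"
        using c by (auto simp: e_def split: if_splits)
      show "finite (\<Union>i<n. {\<alpha>. a (insert i I) b \<alpha> \<noteq> 0})"
        using Loc_finite[OF ai] by auto
    qed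
    fix b \<alpha> assume "e I b \<alpha> \<noteq> 0"
    then have N: "N \<alpha>" and nz: "a (insert (c \<alpha>) I) b \<alpha> \<noteq> 0"
      by (auto simp: e_def split: if_splits)
    note * = ai[OF c(1)[OF N]]
    show "b \<in> B" "\<And>i. n \<le> i \<Longrightarrow> \<alpha> i = 0"
      using nz Loc_basis[OF *] Loc_above[OF *] by auto
    \<comment> \<open>The vector used for \<open>I\<close> may have poles along the additional
      variable; at the pivot, nonnegativity comes from the choice of
      \<open>c \<alpha>\<close>.\<close>
    show "0 \<le> \<alpha> i" if "i < n" "i \<notin> I" for i
      using Loc_nonneg[OF * nz that(1)] that c(2)[OF N] by (cases "i = c \<alpha>") auto
  qed
  moreover have "a I = delta e I" if I: "I \<in> subs n q" for I
  proof (intro ext)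
    fix b \<alpha>
    have fin: "finite I" using I by (rule finite_subs_elem)
    show "a I b \<alpha> = delta e I b \<alpha>"
    proof (cases "N \<alpha>")
      \<comment> \<open>Without a pivot the homotopy is zero; here the assumption on all-negative
        exponents takes over.\<close>
      case False
      then have "delta e I b \<alpha> = 0"
        by (simp add: delta_def e_def)
      moreover have "a I b \<alpha> = 0"
        using False by (intro neg I) (auto simp: N_def not_le)
      ultimately show ?thesis by simp
    next
      case True
      let ?c = "c \<alpha>"
      show ?thesis
      proof (cases "?c \<in> I")
        \<comment> \<open>Only the summand that removes the pivot survives, since in all others the
          index set still contains it.\<close>
        case cI: True
        have "delta e I b \<alpha> = (\<Sum>i\<in>{?c}. (-1) ^ card {j\<in>I. j < i} * e (I - {i}) b \<alpha>)"
          unfolding delta_def using fin cI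
          by (intro sum.mono_neutral_right) (auto simp: e_def)
        also have "\<dots> = a I b \<alpha>"
        proof -
          have "{j\<in>I - {?c}. j < ?c} = {j\<in>I. j < ?c}" by auto
          then show ?thesis
            using True cI by (simp add: e_def insert_absorb mult.assoc[symmetric] power_add[symmetric])
        qed
        finally show ?thesis by simp
      next
        \<comment> \<open>The cocycle condition on \<open>insert ?c I\<close> is solved for the
          coefficient of \<open>a I\<close>; the remaining terms are those of
          \<open>delta e I\<close>.\<close>
        case cI: False
        let ?J = "insert ?c I"
        have J: "?J \<in> subs n (Suc q)"
          using I cI c(1)[OF True] fin by (auto simp: subs_def)
        have sq: "(-1) ^ k * ((-1) ^ k * x) = x" for k and x :: 'b
          by (simp add: mult.assoc[symmetric] power_add[symmetric])
        let ?S = "\<Sum>i\<in>I. (-1) ^ card {j\<in>?J. j < i} * a (?J - {i}) b \<alpha>"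
        have "0 = delta a ?J b \<alpha>"
          using cyc[OF J] by simp
        also have "\<dots> = (-1) ^ card {j\<in>?J. j < ?c} * a I b \<alpha> + ?S"
          unfolding delta_def using fin cI by (subst sum.insert) auto
        finally have "(-1) ^ card {j\<in>?J. j < ?c} * a I b \<alpha> = - ?S"
          unfolding eq_neg_iff_add_eq_0 by (rule sym)
        then have "a I b \<alpha> = (-1) ^ card {j\<in>?J. j < ?c} * - ?S"
          by (subst sq[symmetric, of _ "card {j\<in>?J. j < ?c}"]) (rule arg_cong)
        also have "\<dots> = (\<Sum>i\<in>I. - ((-1) ^ card {j\<in>?J. j < ?c} * (-1) ^ card {j\<in>?J. j < i} * a (?J - {i}) b \<alpha>))"
          by (simp only: sum_distrib_left sum_negf mult.assoc mult_minus_right)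
        also have "\<dots> = (\<Sum>i\<in>I. (-1) ^ card {j\<in>I. j < i} * e (I - {i}) b \<alpha>)"
        proof (rule sum.cong[OF refl])
          fix i assume i: "i \<in> I"
          then have ic: "i \<noteq> ?c" using cI by auto
          have 1: "{j\<in>?J - {?c}. j < i} = {j\<in>I. j < i}" "{j\<in>?J - {i}. j < ?c} = {j\<in>I - {i}. j < ?c}"
            using cI by auto
          have "(-1) ^ card {j\<in>?J. j < ?c} * (-1) ^ card {j\<in>?J - {?c}. j < i} =
            - ((-1) ^ card {j\<in>?J. j < i} * (-1) ^ card {j\<in>?J - {i}. j < ?c} :: 'b)"
          proof (cases "?c < i")
            case True
            show ?thesis
              by (rule sign_swap_remove) (use True i fin in auto)
          next
            case False
            have "(-1) ^ card {j\<in>?J. j < i} * (-1) ^ card {j\<in>?J - {i}. j < ?c} =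
             - ((-1) ^ card {j\<in>?J. j < ?c} * (-1) ^ card {j\<in>?J - {?c}. j < i} :: 'b)"
              by (rule sign_swap_remove) (use False i fin ic in auto)
            then show ?thesis by simp
          qed
          then have sgn: "(-1) ^ card {j\<in>?J. j < ?c} * (-1) ^ card {j\<in>I. j < i} =
            - ((-1) ^ card {j\<in>?J. j < i} * (-1) ^ card {j\<in>I - {i}. j < ?c} :: 'b)"
            unfolding 1 .
          have s1: "- ((-1) ^ card {j\<in>?J. j < ?c} * (-1) ^ card {j\<in>?J. j < i}) =
             (-1) ^ card {j\<in>I. j < i} * ((-1) ^ card {j\<in>I - {i}. j < ?c} :: 'b)"
            (is "- (?p * ?q) = ?r * ?s")
          proof -
            have "?p * ?r = - (?q * ?s)" by (rule sgn)
            then have "?q * (?p * ?r) * ?r = - (?q * (?q * ?s)) * ?r" by simp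
            moreover have "?q * (?p * ?r) * ?r = ?r * (?r * (?p * ?q))" by (simp add: mult_ac)
            ultimately have "?p * ?q = - ?s * ?r" by (simp only: sq)
            then show ?thesis by (simp add: mult.commute)
          qed
          have s2: "?J - {i} = insert ?c (I - {i})" using ic by auto
          have s3: "e (I - {i}) b \<alpha> = (-1) ^ card {j\<in>I - {i}. j < ?c} * a (insert ?c (I - {i})) b \<alpha>"
            unfolding e_def using True cI by simp
          show "- ((-1) ^ card {j\<in>?J. j < ?c} * (-1) ^ card {j\<in>?J. j < i} * a (?J - {i}) b \<alpha>) =
             (-1) ^ card {j\<in>I. j < i} * e (I - {i}) b \<alpha>"
            unfolding s2 s3 mult.assoc[symmetric] s1[symmetric] by (rule minus_mult_left)
        qed
        finally show ?thesis by (simp add: delta_def)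
      qed
    qed
  qed
  ultimately show ?thesis by blast
qed

text \<open>An index set of size q < n misses some variable, and exponents are nonnegative there. So
  all-negative exponents do not occur and the homotopy applies throughout.\<close>

lemma free_vanishing:
  assumes a: "cochain B a" and cyc: "\<And>J. J \<in> subs n (Suc q) \<Longrightarrow> delta a J = 0" and q: "q < n"
  shows "\<exists>e. cochain B e \<and> (\<forall>I\<in>subs n q. a I = delta e I)"
proof (rule free_cocycle_is_coboundary[OF a cyc])
  fix I b and \<alpha> :: "nat \<Rightarrow> int" assume I: "I \<in> subs n q" and neg: "\<And>i. i < n \<Longrightarrow> \<alpha> i < 0"
  have "I \<noteq> {..<n}" using I q by (auto simp: subs_def)
  then obtain i where "i < n" "i \<notin> I" using I by (auto simp: subs_def)
  moreover have "a I \<in> Loc B I" using a I by (auto simp: cochain_def subs_def)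
  ultimately show "a I b \<alpha> = 0"
    using neg[of i] Loc_nonneg[of "a I" B I b \<alpha> i] by force
qed

lemma subs_top: "subs n n = {{..<n}}"
  using card_subset_eq[of "{..<n}"] by (auto simp: subs_def)

lemma subs_above: "n < q \<Longrightarrow> subs n q = {}"
proof -
  assume q: "n < q"
  have "I \<notin> subs n q" for I
    using card_mono[of "{..<n}" I] q by (auto simp: subs_def)
  then show ?thesis by blast
qed

text \<open>In degree \<open>n\<close> the cocycle condition is empty. Together with
  \<open>delta_top_negative\<close> this identifies the top cohomology of a free module with the
  span of the all-negative exponents.\<close>

lemma free_top_coboundary:
  assumes a: "cochain B a" and neg: "\<And>b (\<alpha> :: nat \<Rightarrow> int). (\<And>i. i < n \<Longrightarrow> \<alpha> i < 0) \<Longrightarrow> a {..<n} b \<alpha> = 0"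
  shows "\<exists>e. cochain B e \<and> a {..<n} = delta e {..<n}"
  using free_cocycle_is_coboundary[OF a, of n] neg by (auto simp: subs_top subs_above)

text \<open>Each summand lacks one variable in its denominator and so has no negative exponent
  there.\<close>

lemma delta_top_negative:
  assumes "cochain B e" "\<And>i. i < n \<Longrightarrow> \<alpha> i < 0"
  shows "delta e {..<n} b \<alpha> = 0"
  unfolding delta_def
proof (rule sum.neutral, rule ballI)
  fix i assume i: "i \<in> {..<n}"
  have "e ({..<n} - {i}) \<in> Loc B ({..<n} - {i})" using assms by (auto simp: cochain_def)
  then have "e ({..<n} - {i}) b \<alpha> = 0"
    using assms(2)[of i] i Loc_nonneg[of _ B "{..<n} - {i}" b \<alpha> i] by force
  then show "(-1) ^ card {j\<in>{..<n}. j < i} * e ({..<n} - {i}) b \<alpha> = 0" by simp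
qed

end

section \<open>The connecting homomorphism\<close>

context laurent_vectors
begin

lemma hcomp_decomposition:
  assumes f: "f \<in> Loc B I" and B: "finite B"
  shows "\<exists>S. finite S \<and> f = (\<Sum>s\<in>S. hcomp dg s f) \<and> (\<forall>s. s \<notin> S \<longrightarrow> hcomp dg s f = 0)"
proof (intro exI conjI)
  let ?S = "(\<Union>b\<in>B. (\<lambda>\<alpha>. dg b + tdeg \<alpha>) ` {\<alpha>. f b \<alpha> \<noteq> 0})"
  show fin: "finite ?S"
    using B Loc_finite[OF f] by auto
  have S: "dg b + tdeg \<alpha> \<in> ?S" if "f b \<alpha> \<noteq> 0" for b \<alpha>
    using that Loc_basis[OF f that] by auto
  show "\<forall>s. s \<notin> ?S \<longrightarrow> hcomp dg s f = 0"
  proof (intro allI impI ext)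
    fix s b \<alpha> assume "s \<notin> ?S"
    then show "hcomp dg s f b \<alpha> = 0 b \<alpha>"
      using S[of b \<alpha>] by (auto simp: hcomp_def)
  qed
  show "f = (\<Sum>s\<in>?S. hcomp dg s f)"
  proof (intro ext)
    fix b \<alpha>
    have "(\<Sum>s\<in>?S. hcomp dg s f) b \<alpha> = (\<Sum>s\<in>?S. if dg b + tdeg \<alpha> = s then f b \<alpha> else 0)"
      by (simp add: sum_fun_apply hcomp_def)
    also have "\<dots> = (if dg b + tdeg \<alpha> \<in> ?S then f b \<alpha> else 0)"
      using fin by (subst sum.delta') auto
    also have "\<dots> = f b \<alpha>" using S[of b \<alpha>] by auto
    finally show "f b \<alpha> = (\<Sum>s\<in>?S. hcomp dg s f) b \<alpha>" by simp
  qed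
qed

end

text \<open>A degree-preserving map of free modules, given on vectors without denominators.
  Additivity and compatibility with monomials are what is required to extend it to fractions and to
  commute with the signs of \<open>delta\<close>.\<close>

locale laurent_map = laurent_vectors n for n +
  fixes B' :: "'g set" and dg' :: "'g \<Rightarrow> int" and B :: "'f set" and dg :: "'f \<Rightarrow> int"
    and d :: "('g, 'k::field) laurent \<Rightarrow> ('f, 'k) laurent"
  assumes fin': "finite B'" and fin: "finite B"
    and d_closed: "f \<in> Loc B' {} \<Longrightarrow> d f \<in> Loc B {}"
    and d_add: "f \<in> Loc B' {} \<Longrightarrow> g \<in> Loc B' {} \<Longrightarrow> d (f + g) = d f + d g"
    and d_shift: "f \<in> Loc B' {} \<Longrightarrow> m \<in> expo {..<n} \<Longrightarrow> d (shift m f) = shift m (d f)"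
    and d_homog: "f \<in> Loc B' {} \<Longrightarrow> homog dg' r f \<Longrightarrow> homog dg r (d f)"
begin

lemma d_zero [simp]: "d 0 = 0"
  using d_add[of 0 0] by simp

lemma d_sum: "(\<And>i. i \<in> S \<Longrightarrow> g i \<in> Loc B' {}) \<Longrightarrow> d (\<Sum>i\<in>S. g i) = (\<Sum>i\<in>S. d (g i))"
  by (induction S rule: infinite_finite_induct) (auto simp: d_add Loc_sum)

text \<open>\<open>d_homog\<close> speaks of homogeneous vectors; a general vector is a finite sum
  of such, and taking one component of the image picks out one summand.\<close>

lemma d_hcomp:
  assumes f: "f \<in> Loc B' {}"
  shows "d (hcomp dg' r f) = hcomp dg r (d f)"
proof -
  obtain S where S: "finite S" "f = (\<Sum>s\<in>S. hcomp dg' s f)" "\<forall>s. s \<notin> S \<longrightarrow> hcomp dg' s f = 0"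
    using hcomp_decomposition[OF f fin'] by blast
  have hs: "hcomp dg r (\<Sum>s\<in>S. g s) = (\<Sum>s\<in>S. hcomp dg r (g s))" for g :: "int \<Rightarrow> ('f, 'k) laurent"
    by (simp add: fun_eq_iff hcomp_def sum_fun_apply)
  have "d f = (\<Sum>s\<in>S. d (hcomp dg' s f))"
    by (subst S(2)) (auto intro!: d_sum Loc_hcomp f)
  then have "hcomp dg r (d f) = (\<Sum>s\<in>S. hcomp dg r (d (hcomp dg' s f)))"
    by (simp add: hs)
  also have "\<dots> = (\<Sum>s\<in>S. if r = s then d (hcomp dg' s f) else 0)"
    by (intro sum.cong refl hcomp_homog d_homog homog_hcomp Loc_hcomp f)
  also have "\<dots> = d (hcomp dg' r f)"
    using S(1,3) by (simp add: sum.delta)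
  finally show ?thesis by simp
qed

text \<open>The localization of \<open>d\<close>: clear denominators, apply \<open>d\<close>, divide
  again. No \<open>I\<close> occurs, so a single map serves all localizations and respects the
  inclusions between them.\<close>

definition dL :: "('g, 'k) laurent \<Rightarrow> ('f, 'k) laurent" where
  "dL f = (let m = (SOME m. m \<in> expo {..<n} \<and> shift m f \<in> Loc B' {}) in shift (- m) (d (shift m f)))"

text \<open>Two denominators are compared through their product, which \<open>d_shift\<close> moves
  through \<open>d\<close>; the arbitrary choice in \<open>dL\<close> is thereby harmless.\<close>

lemma dL_eq:
  assumes m: "m \<in> expo {..<n}" and f: "shift m f \<in> Loc B' {}"
  shows "dL f = shift (- m) (d (shift m f))"
proof -
  define m' where "m' = (SOME m. m \<in> expo {..<n} \<and> shift m f \<in> Loc B' {})"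
  have m': "m' \<in> expo {..<n}" "shift m' f \<in> Loc B' {}"
    using someI[of "\<lambda>m. m \<in> expo {..<n} \<and> shift m f \<in> Loc B' {}" m] m f by (auto simp: m'_def)
  have "shift m (d (shift m' f)) = d (shift (m + m') f)"
    using d_shift[OF m'(2) m] by simp
  also have "\<dots> = shift m' (d (shift m f))"
    using d_shift[OF f m'(1)] by (simp add: add.commute)
  finally have "shift (- m - m') (shift m (d (shift m' f))) = shift (- m - m') (shift m' (d (shift m f)))"
    by simp
  then show ?thesis
    by (simp add: dL_def m'_def[symmetric])
qed

lemma Loc_common_denominator:
  assumes "f \<in> Loc B' I" "g \<in> Loc B' I" "I \<subseteq> {..<n}"
  shows "\<exists>m\<in>expo I. shift m f \<in> Loc B' {} \<and> shift m g \<in> Loc B' {}"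
proof -
  obtain m1 where m1: "m1 \<in> expo I" "shift m1 f \<in> Loc B' {}"
    using Loc_clear_denominator[OF assms(1) fin' assms(3)] by blast
  obtain m2 where m2: "m2 \<in> expo I" "shift m2 g \<in> Loc B' {}"
    using Loc_clear_denominator[OF assms(2) fin' assms(3)] by blast
  have "shift (m2 + m1) f \<in> Loc B' {}" "shift (m1 + m2) g \<in> Loc B' {}"
    using Loc_shift_expo[OF m1(2) expo_mono[OF assms(3) m2(1)]]
      Loc_shift_expo[OF m2(2) expo_mono[OF assms(3) m1(1)]] by simp_all
  then show ?thesis
    using expo_add[OF m1(1) m2(1)] by (auto simp: add.commute)
qed

lemma dL_closed:
  assumes f: "f \<in> Loc B' I" and I: "I \<subseteq> {..<n}" shows "dL f \<in> Loc B I"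
proof -
  obtain m where m: "m \<in> expo I" "shift m f \<in> Loc B' {}"
    using Loc_clear_denominator[OF f fin' I] by blast
  have "d (shift m f) \<in> Loc B I"
    using d_closed[OF m(2)] by (rule Loc_mono[rotated]) simp
  then show ?thesis
    unfolding dL_eq[OF expo_mono[OF I m(1)] m(2)]
    using I m(1) by (intro Loc_shift) (auto simp: expo_def)
qed

lemma dL_add:
  assumes fg: "f \<in> Loc B' I" "g \<in> Loc B' I" and I: "I \<subseteq> {..<n}"
  shows "dL (f + g) = dL f + dL g"
proof -
  obtain m where m: "m \<in> expo I" "shift m f \<in> Loc B' {}" "shift m g \<in> Loc B' {}"
    using Loc_common_denominator[OF assms] by blast
  note m1 = expo_mono[OF I m(1)]
  have "shift m (f + g) \<in> Loc B' {}"
    using m by (simp add: shift_add Loc_add)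
  from dL_eq[OF m1 this] show ?thesis
    using m by (simp add: dL_eq[OF m1] shift_add d_add)
qed

lemma dL_uminus:
  assumes f: "f \<in> Loc B' I" and I: "I \<subseteq> {..<n}" shows "dL (- f) = - dL f"
proof -
  have "dL f + dL (- f) = dL 0"
    using dL_add[OF f Loc_uminus[OF f] I] by simp
  also have "dL 0 = 0"
    using dL_add[of 0 I 0] I by simp
  finally show ?thesis by (simp add: add_eq_0_iff)
qed

lemma dL_diff:
  assumes "f \<in> Loc B' I" "g \<in> Loc B' I" and I: "I \<subseteq> {..<n}"
  shows "dL (f - g) = dL f - dL g"
  using dL_add[OF assms(1) Loc_uminus[OF assms(2)] I] dL_uminus[OF assms(2) I] by simp

lemma dL_zero [simp]: "dL 0 = 0"
  using dL_diff[of 0 "{}" 0] by simp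

lemma dL_sign:
  assumes f: "f \<in> Loc B' I" and I: "I \<subseteq> {..<n}"
  shows "dL (\<lambda>b \<alpha>. (-1) ^ k * f b \<alpha>) = (\<lambda>b \<alpha>. (-1) ^ k * dL f b \<alpha>)"
proof (cases "even k")
  case False
  then have neg: "(\<lambda>b \<alpha>. (-1) ^ k * g b \<alpha>) = - g" for g :: "('h, 'k) laurent"
    by (simp add: fun_eq_iff)
  show ?thesis unfolding neg by (rule dL_uminus[OF assms])
qed simp

lemma dL_sum:
  assumes "\<And>i. i \<in> S \<Longrightarrow> g i \<in> Loc B' I" and I: "I \<subseteq> {..<n}"
  shows "dL (\<Sum>i\<in>S. g i) = (\<Sum>i\<in>S. dL (g i))"
  using assms(1)
  by (induction S rule: infinite_finite_induct) (auto simp: dL_add[OF _ _ I] Loc_sum)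

lemma cochain_dL: "cochain B' a \<Longrightarrow> cochain B (\<lambda>I. dL (a I))"
  by (simp add: cochain_def dL_closed)

lemma dL_delta:
  assumes a: "cochain B' a" and J: "J \<subseteq> {..<n}"
  shows "dL (delta a J) = delta (\<lambda>I. dL (a I)) J"
proof -
  have "dL (delta a J) = (\<Sum>i\<in>J. dL (\<lambda>b \<alpha>. (-1) ^ card {j\<in>J. j < i} * a (J - {i}) b \<alpha>))"
    unfolding delta_eq_sum by (intro dL_sum[OF _ J] Loc_scale cochain_remove a J)
  also have "\<dots> = delta (\<lambda>I. dL (a I)) J"
    unfolding delta_eq_sum by (intro sum.cong refl dL_sign[OF _ J] cochain_remove a J)
  finally show ?thesis .
qed

lemma dL_hcomp:
  assumes f: "f \<in> Loc B' I" and I: "I \<subseteq> {..<n}"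
  shows "dL (hcomp dg' r f) = hcomp dg r (dL f)"
proof -
  obtain m where m: "m \<in> expo I" "shift m f \<in> Loc B' {}"
    using Loc_clear_denominator[OF f fin' I] by blast
  note m1 = expo_mono[OF I m(1)]
  have h: "shift m (hcomp dg' r f) = hcomp dg' (r + tdeg m) (shift m f)"
    by (simp add: hcomp_shift)
  have "dL (hcomp dg' r f) = shift (- m) (d (shift m (hcomp dg' r f)))"
    using m by (intro dL_eq m1) (simp add: h Loc_hcomp)
  also have "\<dots> = shift (- m) (hcomp dg (r + tdeg m) (d (shift m f)))"
    using m by (simp add: h d_hcomp)
  also have "\<dots> = hcomp dg r (dL f)"
    using hcomp_shift[of dg "r + tdeg m" "- m" "d (shift m f)"]
    by (simp add: dL_eq[OF m1 m(2)] tdeg_uminus)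
  finally show ?thesis .
qed

abbreviation "Im_d \<equiv> d ` Loc B' {}"
abbreviation "Ker_d \<equiv> {f \<in> Loc B' {}. d f = 0}"

text \<open>One half of the exactness of localization: it commutes with images, and by
  \<open>LocD_kernel\<close> with kernels. A preimage is divided by the same denominator as its
  image.\<close>

lemma LocD_image:
  assumes I: "I \<subseteq> {..<n}"
  shows "LocD B Im_d I = dL ` Loc B' I"
proof (intro equalityI subsetI)
  fix h assume "h \<in> LocD B Im_d I"
  then obtain m f where h: "h \<in> Loc B I" and m: "m \<in> expo I" and f: "f \<in> Loc B' {}" "shift m h = d f"
    by (auto simp: LocD_def)
  have "shift (- m) f \<in> Loc B' I"
    by (intro Loc_shift Loc_mono[OF _ f(1)] I) (use m in \<open>auto simp: expo_def\<close>)
  moreover have "dL (shift (- m) f) = h"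
    using dL_eq[OF expo_mono[OF I m], of "shift (- m) f"] f(1)
    by (simp add: f(2)[symmetric])
  ultimately show "h \<in> dL ` Loc B' I" by blast
next
  fix h assume "h \<in> dL ` Loc B' I"
  then obtain f where f: "f \<in> Loc B' I" "h = dL f" by blast
  obtain m where m: "m \<in> expo I" "shift m f \<in> Loc B' {}"
    using Loc_clear_denominator[OF f(1) fin' I] by blast
  have "shift m h \<in> Im_d"
    using m(2) by (simp add: f(2) dL_eq[OF expo_mono[OF I m(1)] m(2)])
  then show "h \<in> LocD B Im_d I"
    using m(1) f dL_closed[OF f(1) I] by (auto simp: LocD_def)
qed

lemma shift_eq_zero_iff [simp]: "shift m h = 0 \<longleftrightarrow> h = 0" for h :: "('h, 'k) laurent"
proof
  assume "shift m h = 0"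
  then have "shift (- m) (shift m h) = shift (- m) 0" by simp
  then show "h = 0" by simp
qed simp

lemma LocD_kernel:
  assumes I: "I \<subseteq> {..<n}"
  shows "LocD B' Ker_d I = {f \<in> Loc B' I. dL f = 0}"
proof (intro equalityI subsetI)
  fix f assume "f \<in> LocD B' Ker_d I"
  then obtain m where "f \<in> Loc B' I" "m \<in> expo I" "shift m f \<in> Loc B' {}" "d (shift m f) = 0"
    by (auto simp: LocD_def)
  then show "f \<in> {f \<in> Loc B' I. dL f = 0}"
    using dL_eq[OF expo_mono[OF I]] by simp
next
  fix f assume f: "f \<in> {f \<in> Loc B' I. dL f = 0}"
  then obtain m where m: "m \<in> expo I" "shift m f \<in> Loc B' {}"
    using Loc_clear_denominator[OF _ fin' I] by blast
  then have "d (shift m f) = 0"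
    using dL_eq[OF expo_mono[OF I m(1)] m(2)] f by simp
  then show "f \<in> LocD B' Ker_d I"
    using f m by (auto simp: LocD_def)
qed

text \<open>The target modulo \<open>Im_d\<close> plays N_j; the source modulo \<open>Ker_d\<close>,
  being isomorphic to the image, plays N_{j+1}. The class of \<open>a\<close> goes to that of a lift
  of \<open>delta a\<close> through \<open>dL\<close>. If the lift is \<open>delta b\<close> modulo
  the kernel, then \<open>a - dL b\<close> is a cocycle of the free module itself and bounds because
  q < n.\<close>

lemma connecting_injective:
  assumes nz: "coh_nonzero B dg Im_d q r" and q: "q < n"
  shows "coh_nonzero B' dg' Ker_d (Suc q) r"
proof -
  obtain a where a: "cochain B a" "\<forall>I\<in>subs n q. homog dg r (a I)"
      "\<forall>J\<in>subs n (Suc q). delta a J \<in> LocD B Im_d J"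
    and nb: "\<not> (\<exists>b. cochain B b \<and> (\<forall>I\<in>subs n q. a I - delta b I \<in> LocD B Im_d I))"
    using nz by (auto simp: coh_nonzero_def coh_witness_def)
  have "\<forall>J\<in>subs n (Suc q). \<exists>c\<in>Loc B' J. delta a J = dL c"
    using a(3) LocD_image[OF subs_subset] by blast
  then obtain c0 where c0: "\<And>J. J \<in> subs n (Suc q) \<Longrightarrow> c0 J \<in> Loc B' J \<and> delta a J = dL (c0 J)"
    by metis
  \<comment> \<open>A witness must be homogeneous, so the lift is cut down to degree
    \<open>r\<close>; \<open>dL\<close> respects components, hence it still lifts
    \<open>delta a\<close>.\<close>
  define c where "c J = (if J \<in> subs n (Suc q) then hcomp dg' r (c0 J) else 0)" for J
  have c: "cochain B' c"
    using c0 by (simp add: cochain_def c_def Loc_hcomp)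
  have dc: "dL (c J) = delta a J" if J: "J \<in> subs n (Suc q)" for J
  proof -
    have "delta a J = delta (\<lambda>I. hcomp dg r (a I)) J"
      using a(2) subs_remove[OF J] by (intro delta_cong hcomp_homog_same[symmetric]) blast
    also have "\<dots> = hcomp dg r (dL (c0 J))"
      using c0[OF J] by (simp add: delta_hcomp)
    also have "\<dots> = dL (c J)"
      using c0[OF J] J by (simp add: c_def dL_hcomp[OF _ subs_subset[OF J]])
    finally show ?thesis by simp
  qed
  have "coh_witness B' dg' Ker_d (Suc q) r c"
    unfolding coh_witness_def
  proof (intro conjI ballI notI)
    show "cochain B' c" by (rule c)
    show "homog dg' r (c I)" if "I \<in> subs n (Suc q)" for I
      using that by (simp add: c_def homog_hcomp)
    show "delta c K \<in> LocD B' Ker_d K" if K: "K \<in> subs n (Suc (Suc q))" for K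
    proof -
      note K' = subs_subset[OF K]
      have "dL (delta c K) = delta (\<lambda>J. dL (c J)) K"
        by (rule dL_delta[OF c K'])
      also have "\<dots> = delta (delta a) K"
        using dc[OF subs_remove[OF K]] by (intro delta_cong) simp
      also have "\<dots> = 0"
        by (rule delta_delta[OF finite_subs_elem[OF K]])
      finally show ?thesis
        using cochain_delta[OF c] K' by (auto simp: LocD_kernel[OF K'] cochain_def)
    qed
    assume "\<exists>b. cochain B' b \<and> (\<forall>I\<in>subs n (Suc q). c I - delta b I \<in> LocD B' Ker_d I)"
    then obtain b where b: "cochain B' b" "\<And>I. I \<in> subs n (Suc q) \<Longrightarrow> c I - delta b I \<in> LocD B' Ker_d I"
      by blast
    have "delta (\<lambda>I. a I - dL (b I)) J = 0" if J: "J \<in> subs n (Suc q)" for J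
    proof -
      note J' = subs_subset[OF J]
      have "dL (c J) - dL (delta b J) = 0"
        using b(2)[OF J] dL_diff[OF _ _ J'] c cochain_delta[OF b(1)] J'
        by (auto simp: LocD_kernel[OF J'] cochain_def)
      then show ?thesis
        using dc[OF J] by (simp add: delta_diff dL_delta[OF b(1) J'])
    qed
    moreover have "cochain B (\<lambda>I. a I - dL (b I))"
      using a(1) cochain_dL[OF b(1)] by (simp add: cochain_def Loc_diff)
    ultimately obtain e where e: "cochain B e" "\<forall>I\<in>subs n q. a I - dL (b I) = delta e I"
      using free_vanishing[OF _ _ q, of B "\<lambda>I. a I - dL (b I)"] by blast
    have "a I - delta e I \<in> LocD B Im_d I" if I: "I \<in> subs n q" for I
    proof -
      have "a I - delta e I = dL (b I)"
        using e(2) I by (simp add: algebra_simps)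
      then show ?thesis
        using b(1) subs_subset[OF I] by (auto simp: LocD_image[OF subs_subset[OF I]] cochain_def)
    qed
    with nb e(1) show False by blast
  qed
  then show ?thesis by (auto simp: coh_nonzero_def)
qed

text \<open>The primitive \<open>e0\<close> of \<open>dL a\<close> represents a preimage of the
  class of \<open>a\<close> under the connecting map. Having it as a hypothesis, instead of deriving
  it from q < n, makes the lemma applicable to those top classes that happen to die in the free
  module.\<close>

lemma connecting_surjective_witness:
  assumes nz: "coh_witness B' dg' Ker_d q r a"
    and e0: "cochain B e0" "\<And>I. I \<in> subs n q \<Longrightarrow> dL (a I) = delta e0 I"
  shows "\<exists>q'. q = Suc q' \<and> coh_nonzero B dg Im_d q' r"
proof -
  have a: "cochain B' a" "\<And>I. I \<in> subs n q \<Longrightarrow> homog dg' r (a I)"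
    and nb: "\<not> (\<exists>b. cochain B' b \<and> (\<forall>I\<in>subs n q. a I - delta b I \<in> LocD B' Ker_d I))"
    using nz by (auto simp: coh_witness_def)
  show ?thesis
  proof (cases q)
    \<comment> \<open>The differential into degree 0 is an empty sum, so \<open>dL\<close> kills
      \<open>a\<close> and its class is zero, against the assumption.\<close>
    case 0
    have "a I - delta (\<lambda>I. 0) I \<in> LocD B' Ker_d I" if I: "I \<in> subs n q" for I
    proof -
      have "I = {}" using I 0 finite_subs_elem[OF I] by (auto simp: subs_def)
      then have "dL (a I) = 0" using e0(2)[OF I] by (simp add: delta_def fun_eq_iff)
      then show ?thesis
        using a(1) subs_subset[OF I] by (auto simp: LocD_kernel[OF subs_subset[OF I]] cochain_def)
    qed
    moreover have "cochain B' (\<lambda>I. 0 :: ('g, 'k) laurent)" by (simp add: cochain_def)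
    ultimately show ?thesis using nb by blast
  next
    case (Suc q')
    \<comment> \<open>The primitive need not be homogeneous, but its component of degree
      \<open>r\<close> is again a primitive because \<open>dL (a I)\<close> has degree
      \<open>r\<close>.\<close>
    define e where "e I = hcomp dg r (e0 I)" for I
    have e: "cochain B e" using e0(1) by (simp add: cochain_def e_def Loc_hcomp)
    have de: "delta e J = dL (a J)" if J: "J \<in> subs n q" for J
    proof -
      have "delta e J = hcomp dg r (dL (a J))"
        unfolding e_def delta_hcomp using e0(2)[OF J] by simp
      also have "\<dots> = dL (hcomp dg' r (a J))"
        using a(1) subs_subset[OF J] by (simp add: dL_hcomp[of _ J] cochain_def)
      also have "\<dots> = dL (a J)" using a(2)[OF J] by (simp add: hcomp_homog)
      finally show ?thesis .
    qed
    have "coh_witness B dg Im_d q' r e"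
      unfolding coh_witness_def
    proof (intro conjI ballI notI)
      show "cochain B e" by (rule e)
      show "homog dg r (e I)" for I by (simp add: e_def homog_hcomp)
      show "delta e J \<in> LocD B Im_d J" if "J \<in> subs n (Suc q')" for J
        using that de[of J] a(1) subs_subset[OF that] Suc
        by (auto simp: LocD_image[OF subs_subset[OF that]] cochain_def)
      assume "\<exists>b. cochain B b \<and> (\<forall>I\<in>subs n q'. e I - delta b I \<in> LocD B Im_d I)"
      then obtain b where b: "cochain B b" "\<And>I. I \<in> subs n q' \<Longrightarrow> e I - delta b I \<in> LocD B Im_d I"
        by blast
      have "\<forall>I\<in>subs n q'. \<exists>g\<in>Loc B' I. e I - delta b I = dL g"
        using b(2) LocD_image[OF subs_subset] by blast
      then obtain g0 where g0: "\<And>I. I \<in> subs n q' \<Longrightarrow> g0 I \<in> Loc B' I \<and> e I - delta b I = dL (g0 I)"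
        by metis
      define g where "g I = (if I \<in> subs n q' then g0 I else 0)" for I
      have g: "cochain B' g" using g0 by (simp add: cochain_def g_def)
      have "a J - delta g J \<in> LocD B' Ker_d J" if J: "J \<in> subs n q" for J
      proof -
        note J' = subs_subset[OF J]
        have "dL (delta g J) = delta (\<lambda>I. dL (g I)) J" by (rule dL_delta[OF g J'])
        also have "\<dots> = delta (\<lambda>I. e I - delta b I) J"
          using g0 subs_remove[of J q'] J Suc by (intro delta_cong) (simp add: g_def)
        also have "\<dots> = delta e J"
          using delta_delta[OF finite_subs_elem[OF J], of b] by (simp add: delta_diff)
        finally have "dL (a J - delta g J) = 0"
          using de[OF J] dL_diff[OF _ _ J', of "a J" "delta g J"] a(1) cochain_delta[OF g] J'
          by (simp add: cochain_def)
        then show ?thesis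
          using a(1) cochain_delta[OF g] J' by (simp add: LocD_kernel[OF J'] cochain_def Loc_diff)
      qed
      with nb g show False by blast
    qed
    then show ?thesis using Suc by (auto simp: coh_nonzero_def)
  qed
qed

lemma connecting_surjective:
  assumes nz: "coh_nonzero B' dg' Ker_d q r" and q: "q < n"
  shows "\<exists>q'. q = Suc q' \<and> coh_nonzero B dg Im_d q' r"
proof -
  obtain a where a: "coh_witness B' dg' Ker_d q r a" using nz by (auto simp: coh_nonzero_def)
  have ca: "cochain B' a" using a by (simp add: coh_witness_def)
  have "delta (\<lambda>I. dL (a I)) J = 0" if J: "J \<in> subs n (Suc q)" for J
    using a J dL_delta[OF ca subs_subset[OF J]] LocD_kernel[OF subs_subset[OF J]]
    by (auto simp: coh_witness_def)
  then obtain e where "cochain B e" "\<forall>I\<in>subs n q. dL (a I) = delta e I"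
    using free_vanishing[OF cochain_dL[OF ca] _ q] by blast
  with connecting_surjective_witness[OF a] show ?thesis by blast
qed

end

section \<open>Minimal resolutions\<close>

text \<open>\<open>minimal\<close> says that the image of \<open>d j\<close> lies in R_+ F_j,
  exponent 0 being the constant coefficient. The resolved module appears as the cokernel of
  \<open>d 0\<close>.\<close>

locale laurent_resolution = laurent_vectors n for n +
  fixes B :: "nat \<Rightarrow> 'f set" and dg :: "nat \<Rightarrow> 'f \<Rightarrow> int"
    and d :: "nat \<Rightarrow> ('f, 'k::field) laurent \<Rightarrow> ('f, 'k) laurent" and s :: nat
  assumes map: "laurent_map n (B (Suc j)) (dg (Suc j)) (B j) (dg j) (d j)"
    and exact: "{f \<in> Loc (B (Suc j)) {}. d j f = 0} = d (Suc j) ` Loc (B (Suc (Suc j))) {}"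
    and minimal: "f \<in> Loc (B (Suc j)) {} \<Longrightarrow> d j f b 0 = 0"
    and bounded: "s < j \<Longrightarrow> B j = {}"
begin

definition D :: "nat \<Rightarrow> ('f, 'k) laurent set" where
  "D j = d j ` Loc (B (Suc j)) {}"

text \<open>Nonvanishing of H^q(N_j) in degree \<open>r\<close>, with N_j given as F_j modulo the
  relations \<open>D j\<close>.\<close>

abbreviation nz :: "nat \<Rightarrow> nat \<Rightarrow> int \<Rightarrow> bool" where
  "nz j q r \<equiv> coh_nonzero (B j) (dg j) (D j) q r"

text \<open>Exactness identifies the kernel of \<open>d j\<close> with \<open>D (Suc j)\<close>, so
  the target of one connecting map is the source of the next.\<close>

lemma nz_step_up: "nz j q r \<Longrightarrow> q < n \<Longrightarrow> nz (Suc j) (Suc q) r"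
  using laurent_map.connecting_injective[OF map] by (simp add: D_def exact)

lemma nz_step_down: "nz (Suc j) q r \<Longrightarrow> q < n \<Longrightarrow> \<exists>q'. q = Suc q' \<and> nz j q' r"
  using laurent_map.connecting_surjective[OF map] by (simp add: D_def exact[symmetric])

lemma nz_step_down_witness:
  "coh_witness (B (Suc j)) (dg (Suc j)) (D (Suc j)) q r a \<Longrightarrow> cochain (B j) e \<Longrightarrow>
    (\<And>I. I \<in> subs n q \<Longrightarrow>
      laurent_map.dL n (B (Suc j)) (d j) (a I) = delta e I) \<Longrightarrow>
    \<exists>q'. q = Suc q' \<and> nz j q' r"
  using laurent_map.connecting_surjective_witness[OF map] by (simp add: D_def exact[symmetric])

lemma nz_up: "nz 0 q r \<Longrightarrow> q + j \<le> n \<Longrightarrow> nz j (q + j) r"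
  by (induction j) (auto intro: nz_step_up)

text \<open>Each step lowers the cohomological degree by one, so the bound q < n persists all the
  way down.\<close>

lemma nz_down: "nz j q r \<Longrightarrow> q < n \<Longrightarrow> \<exists>q'. q = q' + j \<and> nz 0 q' r"
proof (induction j arbitrary: q)
  case (Suc j)
  then obtain q' where q': "q = Suc q'" "nz j q' r"
    using nz_step_down by blast
  with Suc.IH[OF q'(2)] Suc.prems show ?case by auto
qed simp

lemma zero_in_D: "0 \<in> D j"
proof -
  interpret laurent_map n "B (Suc j)" "dg (Suc j)" "B j" "dg j" "d j" by (rule map)
  show ?thesis unfolding D_def by (rule image_eqI[of _ _ 0]) simp_all
qed

lemma zero_in_LocD: "0 \<in> LocD (B j) (D j) I"
  unfolding LocD_def using zero_in_D[of j] by (intro CollectI conjI bexI[of _ 0]) simp_all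

lemma nz_le: "nz j q r \<Longrightarrow> q \<le> n"
proof (rule ccontr)
  assume "nz j q r" "\<not> q \<le> n"
  moreover have "cochain (B j) (\<lambda>I. 0 :: ('f, 'k) laurent)" by (simp add: cochain_def)
  ultimately show False by (auto simp: coh_nonzero_def coh_witness_def subs_above)
qed

lemma tdeg_negative: "(\<And>i. i < n \<Longrightarrow> \<alpha> i < 0) \<Longrightarrow> tdeg \<alpha> \<le> - int n"
  using sum_mono[of "{..<n}" \<alpha> "\<lambda>_. -1"] by (force simp: tdeg_def)

lemma tdeg_negative_eq:
  assumes neg: "\<And>i. i < n \<Longrightarrow> \<alpha> i < 0" and eq: "- int n \<le> tdeg \<alpha>" and i: "i < n"
  shows "\<alpha> i = -1"
proof (rule ccontr)
  assume "\<alpha> i \<noteq> -1"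
  then have "tdeg \<alpha> < (\<Sum>i<n. -1)"
    unfolding tdeg_def using neg i by (intro sum_strict_mono_ex1) (force intro!: bexI[of _ i])+
  then show False using eq by simp
qed

text \<open>A top cocycle that does not bound has a term with all exponents negative, hence of total
  exponent at most -n; its basis element is the generator sought.\<close>

lemma top_generator:
  assumes "nz j n r" shows "\<exists>b\<in>B j. r + int n \<le> dg j b"
proof -
  obtain a where a: "cochain (B j) a" "homog (dg j) r (a {..<n})"
    and nb: "\<not> (\<exists>b. cochain (B j) b \<and> a {..<n} - delta b {..<n} \<in> LocD (B j) (D j) {..<n})"
    using assms by (auto simp: coh_nonzero_def coh_witness_def subs_top)
  have "\<not> (\<exists>e. cochain (B j) e \<and> a {..<n} = delta e {..<n})"
    using nb zero_in_LocD by force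
  then obtain b \<alpha> where b: "\<And>i. i < n \<Longrightarrow> \<alpha> i < 0" "a {..<n} b \<alpha> \<noteq> 0"
    using free_top_coboundary[OF a(1)] by blast
  have "a {..<n} \<in> Loc (B j) {..<n}" using a(1) by (simp add: cochain_def)
  from Loc_basis[OF this b(2)] have "b \<in> B j" .
  moreover have "dg j b + tdeg \<alpha> = r" using a(2) b(2) by (simp add: homog_def)
  ultimately show ?thesis using tdeg_negative[OF b(1)] by force
qed

definition one_vec :: "nat \<Rightarrow> int" where
  "one_vec = (\<lambda>i. if i < n then 1 else 0)"

lemma one_vec_expo: "one_vec \<in> expo {..<n}"
  by (auto simp: one_vec_def expo_def)

lemma tdeg_one_vec: "tdeg (- one_vec) = - int n"
  by (simp add: tdeg_def one_vec_def)

text \<open>Up to coboundaries, the part of \<open>g\<close> that can contribute is $x_1^{-1} \cdots x_n^{-1} g_0$ with $g_0$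
  constant, as no generator has larger degree. Minimality puts $d g_0$ in $R_+ F_j$, so that the
  image has no term with exponent $(-1, \dots, -1)$.\<close>

lemma minimal_kills_socle:
  assumes g: "g \<in> Loc (B (Suc j)) {..<n}" and top: "\<And>b. b \<in> B (Suc j) \<Longrightarrow> dg (Suc j) b \<le> dg j b0"
  shows "laurent_map.dL n (B (Suc j)) (d j) g b0 (- one_vec) = 0"
proof -
  interpret dm: laurent_map n "B (Suc j)" "dg (Suc j)" "B j" "dg j" "d j" by (rule map)
  let ?T = "{..<n}" and ?r = "dg j b0 - int n"
  \<comment> \<open>This is the degree of a term with basis element \<open>b0\<close> and exponent
    \<open>- one_vec\<close>, so passing to the component keeps the coefficient in question.\<close>
  define h where "h = hcomp (dg (Suc j)) ?r g"
  define P where "P \<alpha> \<longleftrightarrow> (\<forall>i<n. \<alpha> i < 0)" for \<alpha> :: "nat \<Rightarrow> int"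
  define h1 where "h1 = (\<lambda>b \<alpha>. if P \<alpha> then h b \<alpha> else 0)"
  define h2 where "h2 = (\<lambda>b \<alpha>. if \<not> P \<alpha> then h b \<alpha> else 0)"
  have h: "h \<in> Loc (B (Suc j)) ?T" unfolding h_def by (rule Loc_hcomp[OF g])
  have h1: "h1 \<in> Loc (B (Suc j)) ?T" and h2: "h2 \<in> Loc (B (Suc j)) ?T"
    unfolding h1_def h2_def by (intro Loc_restrict h)+
  have "dm.dL h1 b0 (- one_vec) = 0"
  proof -
    have sh: "shift one_vec h1 \<in> Loc (B (Suc j)) {}"
      unfolding Loc_def
    proof (intro CollectI conjI allI impI)
      have *: "shift one_vec h1 \<in> Loc (B (Suc j)) ?T"
        by (rule Loc_shift_expo[OF h1 one_vec_expo])
      show "finite {\<alpha>. shift one_vec h1 b \<alpha> \<noteq> 0}" for b by (rule Loc_finite[OF *])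
      fix b \<alpha> assume n0: "shift one_vec h1 b \<alpha> \<noteq> 0"
      show "b \<in> B (Suc j)" by (rule Loc_basis[OF * n0])
      show "\<alpha> i = 0" if "n \<le> i" for i by (rule Loc_above[OF * n0 that])
      fix i assume i: "i < n"
      have P: "P (\<alpha> - one_vec)" and hb: "h b (\<alpha> - one_vec) \<noteq> 0"
        using n0 by (auto simp: shift_apply h1_def split: if_splits)
      have "b \<in> B (Suc j)" by (rule Loc_basis[OF h hb])
      moreover have "dg (Suc j) b + tdeg (\<alpha> - one_vec) = ?r"
        using hb unfolding h_def hcomp_def by (auto split: if_splits)
      \<comment> \<open>Since no generator exceeds the degree of \<open>b0\<close>, an all-negative
        exponent in this component cannot have total below -n and must be (-1, ..., -1). One
        multiplication by x_1 ... x_n then clears \<open>h1\<close> completely.\<close>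
      ultimately have "- int n \<le> tdeg (\<alpha> - one_vec)" using top[of b] by simp
      then have "(\<alpha> - one_vec) i = -1"
        by (rule tdeg_negative_eq[rotated, OF _ i]) (use P in \<open>simp add: P_def\<close>)
      then show "0 \<le> \<alpha> i" using i by (simp add: one_vec_def)
    qed
    have "dm.dL h1 b0 (- one_vec) = d j (shift one_vec h1) b0 0"
      unfolding dm.dL_eq[OF one_vec_expo sh] by (simp add: shift_apply)
    also have "\<dots> = 0" by (rule minimal[OF sh])
    finally show ?thesis .
  qed
  \<comment> \<open>\<open>h2\<close> has no all-negative exponent, hence bounds; its image bounds
    too and so avoids the socle exponent.\<close>
  moreover have "dm.dL h2 b0 (- one_vec) = 0"
  proof -
    define a where "a I = (if I = ?T then h2 else 0)" for I
    have "cochain (B (Suc j)) a" using h2 by (simp add: a_def cochain_def)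
    moreover have "a ?T b \<alpha> = 0" if "\<And>i. i < n \<Longrightarrow> \<alpha> i < 0" for b \<alpha>
      using that by (auto simp: a_def h2_def P_def)
    ultimately obtain e where e: "cochain (B (Suc j)) e" "a ?T = delta e ?T"
      using free_top_coboundary[of "B (Suc j)" a] by blast
    have "dm.dL h2 = delta (\<lambda>I. dm.dL (e I)) ?T"
      using e(2) dm.dL_delta[OF e(1), of ?T] by (simp add: a_def)
    then show ?thesis
      using delta_top_negative[OF dm.cochain_dL[OF e(1)], of "- one_vec"] by (simp add: one_vec_def)
  qed
  moreover have "h = h1 + h2" by (simp add: h1_def h2_def fun_eq_iff)
  ultimately have "dm.dL h b0 (- one_vec) = 0"
    using dm.dL_add[OF h1 h2] by simp
  moreover have "dm.dL h = hcomp (dg j) ?r (dm.dL g)"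
    unfolding h_def by (rule dm.dL_hcomp[OF g]) simp
  ultimately show ?thesis
    by (simp add: hcomp_def tdeg_one_vec)
qed

text \<open>Generators of F_{j+1} leave a trace in the cohomology of N_j below the top. The sum
  \<open>r' + q\<close> is bounded, and not \<open>r'\<close> alone, because it is this sum that
  drops by exactly one when the induction hypothesis for N_{j+1} is pulled back to N_j.\<close>

lemma generator_detected:
  assumes "b \<in> B (Suc j)" "r + int n \<le> dg (Suc j) b"
  shows "\<exists>q r'. q < n \<and> r + int n - 1 \<le> r' + int q \<and> nz j q r'"
  using assms
\<comment> \<open>The induction runs down from the end of the resolution; once \<open>j\<close>
  reaches \<open>s\<close> there is no generator and nothing to prove.\<close>
proof (induction "Suc s - j" arbitrary: j b r rule: less_induct)
  case less
  interpret dm: laurent_map n "B (Suc j)" "dg (Suc j)" "B j" "dg j" "d j" by (rule map)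
  interpret dm': laurent_map n "B (Suc (Suc j))" "dg (Suc (Suc j))" "B (Suc j)" "dg (Suc j)" "d (Suc j)"
    by (rule map)
  let ?T = "{..<n}"
  have js: "j < s" using less.prems(1) bounded[of "Suc j"] by (cases "s < Suc j") auto
  obtain b0 where b0: "b0 \<in> B (Suc j)" "\<And>b. b \<in> B (Suc j) \<Longrightarrow> dg (Suc j) b \<le> dg (Suc j) b0"
  proof -
    let ?X = "dg (Suc j) ` B (Suc j)"
    have X: "finite ?X" "?X \<noteq> {}" using dm.fin' less.prems(1) by auto
    from Max_in[OF X] obtain b0 where "b0 \<in> B (Suc j)" "Max ?X = dg (Suc j) b0" by auto
    with Max_ge[OF X(1)] that show ?thesis by force
  qed
  have r: "r + int n \<le> dg (Suc j) b0" using b0(2)[OF less.prems(1)] less.prems(2) by simp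
  let ?r = "dg (Suc j) b0 - int n"
  define \<xi> :: "('f, 'k) laurent" where "\<xi> = (\<lambda>b \<alpha>. if b = b0 \<and> \<alpha> = - one_vec then 1 else 0)"
  have \<xi>: "\<xi> \<in> Loc (B (Suc j)) ?T"
    using b0(1) by (auto simp: Loc_def \<xi>_def one_vec_def)
  define a where "a I = (if I = ?T then \<xi> else 0)" for I
  have ca: "cochain (B (Suc j)) a" using \<xi> by (simp add: a_def cochain_def)
  show ?case
  proof (cases "coh_witness (B (Suc j)) (dg (Suc j)) (D (Suc j)) n ?r a")
    case True
    define a' where "a' I = dm.dL (a I)" for I
    have ca': "cochain (B j) a'" unfolding a'_def by (rule dm.cochain_dL[OF ca])
    \<comment> \<open>The image of the generator has nonnegative exponents, so after division by x_1
      ... x_n an all-negative exponent can only stem from its constant coefficient, which minimality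
      excludes.\<close>
    have "a' ?T b \<alpha> = 0" if neg: "\<And>i. i < n \<Longrightarrow> \<alpha> i < 0" for b \<alpha>
    proof (rule ccontr)
      assume n0: "a' ?T b \<alpha> \<noteq> 0"
      have sh: "shift one_vec \<xi> \<in> Loc (B (Suc j)) {}"
        using b0(1) Loc_finite[OF Loc_shift_expo[OF \<xi> one_vec_expo]]
        by (auto simp: Loc_def \<xi>_def shift_apply split: if_splits)
      have eq: "a' ?T = shift (- one_vec) (d j (shift one_vec \<xi>))"
        by (simp add: a'_def a_def dm.dL_eq[OF one_vec_expo sh])
      then have n1: "d j (shift one_vec \<xi>) b (\<alpha> + one_vec) \<noteq> 0"
        using n0 by (simp add: shift_apply)
      have "(\<alpha> + one_vec) i = 0" for i
      proof (cases "i < n")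
        case True
        have "0 \<le> (\<alpha> + one_vec) i" by (rule Loc_nonneg[OF dm.d_closed[OF sh] n1 True]) simp
        then show ?thesis using neg[OF True] True by (simp add: one_vec_def)
      qed (rule Loc_above[OF dm.d_closed[OF sh] n1], simp)
      then have "\<alpha> + one_vec = 0" by (simp add: fun_eq_iff)
      then show False using n1 minimal[OF sh] by simp
    qed
    then obtain e where e: "cochain (B j) e" "a' ?T = delta e ?T"
      using free_top_coboundary[OF ca'] by blast
    then have "\<exists>q'. n = Suc q' \<and> nz j q' ?r"
      using True by (intro nz_step_down_witness) (auto simp: subs_top a'_def)
    \<comment> \<open>The class found lies in H^{n-1} and its degree is that of \<open>b0\<close>
      minus n; this is the source of the \<open>- 1\<close> in the bound.\<close>
    then obtain q' where "n = Suc q'" "nz j q' ?r" by blast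
    then show ?thesis
      using r by (intro exI[of _ q'] exI[of _ ?r]) auto
  next
    case False
    have "homog (dg (Suc j)) ?r \<xi>"
      by (simp add: homog_def \<xi>_def tdeg_one_vec)
    then have "\<exists>b. cochain (B (Suc j)) b \<and> \<xi> - delta b ?T \<in> LocD (B (Suc j)) (D (Suc j)) ?T"
      using False ca by (auto simp: coh_witness_def subs_top subs_above a_def)
    then obtain c where c: "cochain (B (Suc j)) c" "\<xi> - delta c ?T \<in> LocD (B (Suc j)) (D (Suc j)) ?T"
      by blast
    then obtain g where g: "g \<in> Loc (B (Suc (Suc j))) ?T" "\<xi> - delta c ?T = dm'.dL g"
      using dm'.LocD_image[of ?T] by (auto simp: D_def)
    \<comment> \<open>Coboundaries have no term at the socle exponent, so the coefficient 1 of
      \<open>\<xi>\<close> must be produced by the image of \<open>g\<close>.\<close>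
    have "(\<xi> - delta c ?T) b0 (- one_vec) = 1"
      using delta_top_negative[OF c(1), of "- one_vec"] by (simp add: \<xi>_def one_vec_def)
    then have "dm'.dL g b0 (- one_vec) \<noteq> 0" by (simp add: g(2))
    then obtain b' where b': "b' \<in> B (Suc (Suc j))" "dg (Suc j) b0 < dg (Suc (Suc j)) b'"
      using minimal_kills_socle[OF g(1)] by (meson not_le)
    \<comment> \<open>As \<open>b'\<close> has degree above that of \<open>b0\<close>, the
      hypothesis may be used with \<open>?r + 1\<close>; the gain of one makes up for the index lost
      when \<open>q\<close> becomes \<open>q'\<close>.\<close>
    have "\<exists>q r'. q < n \<and> ?r + 1 + int n - 1 \<le> r' + int q \<and> nz (Suc j) q r'"
      by (rule less.hyps[of "Suc j" b']) (use js b' in auto)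
    then obtain q r' where qr: "q < n" "?r + int n \<le> r' + int q" "nz (Suc j) q r'" by auto
    then obtain q' where "q = Suc q'" "nz j q' r'" using nz_step_down by blast
    then show ?thesis
      using qr r by (intro exI[of _ q'] exI[of _ r']) auto
  qed
qed

text \<open>The bound on \<open>r'\<close> serves the a-invariants, the bound on
  \<open>r' + q'\<close> the regularity. Below the top degree the class itself descends and
  \<open>r' = r\<close>; a top class is traded for one detected from a generator; for
  \<open>t = n\<close> nothing has to be moved.\<close>

lemma nz_from_syzygy:
  assumes nz: "nz (n - t) q r" and t: "t \<le> n"
  shows "\<exists>q' r'. q' \<le> t \<and> r \<le> r' \<and> r + int q - int n + int t \<le> r' + int q' \<and> nz 0 q' r'"
proof (cases "q < n \<or> t = n")
  case True
  then show ?thesis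
  proof
    assume "q < n"
    with nz_down[OF nz] obtain q' where "q = q' + (n - t)" "nz 0 q' r" by blast
    then show ?thesis using \<open>q < n\<close> t by (intro exI[of _ q'] exI[of _ r]) auto
  next
    assume "t = n"
    then show ?thesis using nz nz_le[OF nz] by (intro exI[of _ q] exI[of _ r]) auto
  qed
next
  case False
  then have q: "q = n" and "t < n" using nz_le[OF nz] t by auto
  \<comment> \<open>Now t < n, so N_{n-t} has a predecessor N_j with j = n - t - 1, in whose
    cohomology the generator is detected.\<close>
  then obtain j where j: "n - t = Suc j" by (metis Suc_diff_Suc)
  obtain b where "b \<in> B (Suc j)" "r + int n \<le> dg (Suc j) b"
    using top_generator[of "Suc j" r] nz q j by auto
  then obtain q1 r' where q1: "q1 < n" "r + int n - 1 \<le> r' + int q1" "nz j q1 r'"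
    using generator_detected by blast
  then obtain q' where "q1 = q' + j" "nz 0 q' r'" using nz_down by blast
  then show ?thesis using q1 q j t by (intro exI[of _ q'] exI[of _ r']) auto
qed

lemma nz_to_syzygy: "nz 0 q r \<Longrightarrow> q \<le> t \<Longrightarrow> t \<le> n \<Longrightarrow> nz (n - t) (q + (n - t)) r"
  by (rule nz_up) auto

end

section \<open>Local cohomology of a presented module\<close>

definition emb :: "(nat \<Rightarrow>\<^sub>0 nat) \<Rightarrow> nat \<Rightarrow> int" where
  "emb m = (\<lambda>i. int (Poly_Mapping.lookup m i))"

lemma emb_add: "emb (a + b) = emb a + emb b"
  by (simp add: emb_def fun_eq_iff lookup_add)

lemma emb_zero [simp]: "emb 0 = 0"
  by (simp add: emb_def fun_eq_iff)

lemma emb_inject: "emb a = emb b \<longleftrightarrow> a = b"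
  by (auto simp: emb_def fun_eq_iff intro: poly_mapping_eqI)

lemma emb_expo: "emb m \<in> expo I \<longleftrightarrow> Poly_Mapping.keys m \<subseteq> I"
  by (auto simp: emb_def expo_def in_keys_iff)

lemma ex_emb:
  assumes "finite I" "e \<in> expo I"
  obtains m where "Poly_Mapping.keys m \<subseteq> I" "emb m = e"
proof -
  have "finite {i. nat (e i) \<noteq> 0}"
    by (rule finite_subset[OF _ assms(1)]) (use assms(2) in \<open>auto simp: expo_def\<close>)
  then have "emb (Abs_poly_mapping (\<lambda>i. nat (e i))) = e"
    using assms(2) by (simp add: emb_def expo_def fun_eq_iff)
  with that[of "Abs_poly_mapping (\<lambda>i. nat (e i))"] assms(2) show thesis
    by (metis emb_expo)
qed

lemma monom_of_mult: "monom_of a * monom_of b = monom_of (a + b)"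
  by (simp add: monom_of_def mult_single)

lemma monom_of_zero: "monom_of 0 = 1"
  by (simp add: monom_of_def)

lemma monom_of_inject: "(monom_of a :: 'k::field mpol) = monom_of b \<longleftrightarrow> a = b"
proof
  assume "(monom_of a :: 'k mpol) = monom_of b"
  then have "Poly_Mapping.keys (monom_of a :: 'k mpol) = Poly_Mapping.keys (monom_of b :: 'k mpol)"
    by simp
  then show "a = b" by (simp add: monom_of_def)
qed simp

lemma (in laurent_vectors) mdeg_emb:
  assumes "Poly_Mapping.keys m \<subseteq> {..<n}" shows "int (mdeg m) = tdeg (emb m)"
proof -
  have "mdeg m = (\<Sum>i<n. Poly_Mapping.lookup m i)"
    unfolding mdeg_def using assms by (intro sum.mono_neutral_left) (auto simp: in_keys_iff)
  then show ?thesis by (simp add: tdeg_def emb_def)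
qed

lemma UN_constant_nonempty: "A \<noteq> {} \<Longrightarrow> (\<And>x. x \<in> A \<Longrightarrow> F x = c) \<Longrightarrow> (\<Union>x\<in>A. F x) = c"
  by auto

text \<open>\<open>N\<close> as a quotient of a free module in coordinates. Monomials and -1 are the
  scalars that occur in the localizations and in the Cech signs. All laws are carried over from
  Laurent vectors by \<open>\<pi>\<close>, so that a quotient record qualifies directly.\<close>

locale presentation = laurent_vectors n for n +
  fixes B :: "'f set" and dg :: "'f \<Rightarrow> int" and N :: "(('k::field) mpol, 'b) gmodule"
    and \<pi> :: "('f, 'k) laurent \<Rightarrow> 'b"
  assumes finB: "finite B"
    and pi_image: "\<pi> ` Loc B {} = carrier N"
    and pi_add: "f \<in> Loc B {} \<Longrightarrow> g \<in> Loc B {} \<Longrightarrow> \<pi> f \<oplus>\<^bsub>N\<^esub> \<pi> g = \<pi> (f + g)"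
    and pi_monom: "f \<in> Loc B {} \<Longrightarrow> Poly_Mapping.keys m \<subseteq> {..<n} \<Longrightarrow>
      monom_of m \<odot>\<^bsub>N\<^esub> \<pi> f = \<pi> (shift (emb m) f)"
    and pi_uminus: "f \<in> Loc B {} \<Longrightarrow> (- 1) \<odot>\<^bsub>N\<^esub> \<pi> f = \<pi> (- f)"
    and pi_zero: "\<pi> 0 = \<zero>\<^bsub>N\<^esub>"
    and pi_gr: "gr N r = \<pi> ` {f \<in> Loc B {}. homog dg r f}"
begin

definition D :: "('f, 'k) laurent set" where
  "D = {f \<in> Loc B {}. \<pi> f = \<zero>\<^bsub>N\<^esub>}"

lemma D_shift:
  assumes f: "f \<in> D" and m: "m \<in> expo {..<n}" shows "shift m f \<in> D"
proof -
  obtain w where w: "Poly_Mapping.keys w \<subseteq> {..<n}" "emb w = m"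
    using ex_emb[OF _ m] by blast
  have "\<pi> (shift m f) = monom_of w \<odot>\<^bsub>N\<^esub> \<pi> 0"
    using f w pi_monom[of f w] by (simp add: D_def pi_zero)
  also have "\<dots> = \<pi> 0" using pi_monom[OF _ w(1), of 0] by simp
  finally show ?thesis
    using f Loc_shift_expo[of f B "{}" m] m by (simp add: D_def pi_zero)
qed

lemma pi_eq_iff:
  assumes "f \<in> Loc B {}" "g \<in> Loc B {}" shows "\<pi> f = \<pi> g \<longleftrightarrow> f - g \<in> D"
proof
  assume eq: "\<pi> f = \<pi> g"
  have "\<pi> (f - g) = \<pi> f \<oplus>\<^bsub>N\<^esub> \<pi> (- g)"
    using pi_add[OF assms(1) Loc_uminus[OF assms(2)]] by simp
  also have "\<dots> = \<pi> (g - g)"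
    using pi_add[OF assms(2) Loc_uminus[OF assms(2)]] by (simp add: eq)
  finally show "f - g \<in> D" using assms by (simp add: D_def pi_zero Loc_diff)
next
  assume D: "f - g \<in> D"
  have "\<pi> f = \<pi> (f - g) \<oplus>\<^bsub>N\<^esub> \<pi> g"
    using pi_add[OF Loc_diff[OF assms] assms(2)] by simp
  also have "\<dots> = \<pi> (0 + g)"
    using D pi_add[of 0 g] assms(2) by (simp add: D_def pi_zero)
  finally show "\<pi> f = \<pi> g" by simp
qed

lemma D_add: "f \<in> D \<Longrightarrow> g \<in> D \<Longrightarrow> f + g \<in> D"
  using pi_add[of f g] pi_add[of 0 0] by (simp add: D_def Loc_add pi_zero)

lemma D_zero: "0 \<in> D"
  by (simp add: D_def pi_zero)

lemma D_uminus: "f \<in> D \<Longrightarrow> - f \<in> D"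
  using pi_uminus[of f] pi_uminus[of 0] by (simp add: D_def Loc_uminus pi_zero)

section \<open>Localized relations and fractions\<close>

abbreviation LD :: "nat set \<Rightarrow> ('f, 'k) laurent set" where
  "LD I \<equiv> LocD B D I"

lemma LD_zero [simp]: "0 \<in> LD I"
  unfolding LocD_def using D_zero by (intro CollectI conjI bexI[of _ 0]) simp_all

lemma LD_uminus: "f \<in> LD I \<Longrightarrow> - f \<in> LD I"
proof -
  assume "f \<in> LD I"
  then obtain m where "f \<in> Loc B I" "m \<in> expo I" "shift m f \<in> D" by (auto simp: LocD_def)
  moreover have "shift m (- f) = - shift m f" by (simp add: shift_def fun_eq_iff)
  ultimately show ?thesis
    unfolding LocD_def using D_uminus by (intro CollectI conjI bexI[of _ m]) (simp_all add: Loc_uminus)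
qed

lemma LD_add:
  assumes "f \<in> LD I" "g \<in> LD I" and I: "I \<subseteq> {..<n}" shows "f + g \<in> LD I"
proof -
  obtain m1 m2 where f: "f \<in> Loc B I" "m1 \<in> expo I" "shift m1 f \<in> D"
    and g: "g \<in> Loc B I" "m2 \<in> expo I" "shift m2 g \<in> D"
    using assms by (auto simp: LocD_def)
  have "shift (m1 + m2) (f + g) \<in> D"
    using D_add[OF D_shift[OF f(3) expo_mono[OF I g(2)]] D_shift[OF g(3) expo_mono[OF I f(2)]]]
    by (simp add: shift_add add.commute)
  then show ?thesis
    unfolding LocD_def using f g by (intro CollectI conjI bexI[of _ "m1 + m2"]) (simp_all add: Loc_add expo_add)
qed

lemma LD_diff: "f \<in> LD I \<Longrightarrow> g \<in> LD I \<Longrightarrow> I \<subseteq> {..<n} \<Longrightarrow> f - g \<in> LD I"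
  using LD_add[OF _ LD_uminus, of f I g] by simp

lemma LD_mono: "f \<in> LD I \<Longrightarrow> I \<subseteq> J \<Longrightarrow> f \<in> LD J"
  unfolding LocD_def using Loc_mono[of I J f B] expo_mono[of I J] by blast

lemma LD_scale_sign: "f \<in> LD I \<Longrightarrow> (\<lambda>b \<alpha>. (-1) ^ k * f b \<alpha>) \<in> LD I"
proof (cases "even k")
  case False
  assume f: "f \<in> LD I"
  have "(\<lambda>b \<alpha>. (-1) ^ k * f b \<alpha>) = - f" using False by (simp add: fun_eq_iff)
  then show ?thesis using LD_uminus[OF f] by simp
qed simp

lemma Loc_shift_back:
  assumes "f \<in> Loc B {}" "Poly_Mapping.keys u \<subseteq> I" "I \<subseteq> {..<n}"
  shows "shift (- emb u) f \<in> Loc B I"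
  using assms by (intro Loc_shift Loc_mono[OF _ assms(1)]) (auto simp: emb_def in_keys_iff)

text \<open>Clearing both denominators turns equality of fractions into membership in
  \<open>D\<close>. The auxiliary monomial of \<open>loc_rel\<close> is the denominator allowed by
  \<open>LocD\<close>; the two differ by the factor x^(u+v), which \<open>D_shift\<close>
  absorbs.\<close>

lemma loc_rel_iff:
  assumes fg: "f \<in> Loc B {}" "g \<in> Loc B {}" and I: "I \<subseteq> {..<n}"
    and uv: "Poly_Mapping.keys u \<subseteq> I" "Poly_Mapping.keys v \<subseteq> I"
  shows "((\<pi> f, monom_of u), (\<pi> g, monom_of v)) \<in> loc_rel I N \<longleftrightarrow>
    shift (- emb u) f - shift (- emb v) g \<in> LD I" (is "_ \<longleftrightarrow> ?h \<in> _")
proof -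
  have keys: "Poly_Mapping.keys (w + u) \<subseteq> I" "Poly_Mapping.keys (w + v) \<subseteq> I"
    if "Poly_Mapping.keys w \<subseteq> I" for w
    using that uv Poly_Mapping.keys_add[of w u] Poly_Mapping.keys_add[of w v] by blast+
  have eq: "(monom_of w * monom_of v) \<odot>\<^bsub>N\<^esub> \<pi> f = (monom_of w * monom_of u) \<odot>\<^bsub>N\<^esub> \<pi> g \<longleftrightarrow>
      shift (emb w + emb u + emb v) ?h \<in> D" if w: "Poly_Mapping.keys w \<subseteq> I" for w
  proof -
    note kw = keys[OF w, THEN subset_trans[OF _ I]]
    have "(monom_of w * monom_of v) \<odot>\<^bsub>N\<^esub> \<pi> f = \<pi> (shift (emb w + emb v) f)"
      "(monom_of w * monom_of u) \<odot>\<^bsub>N\<^esub> \<pi> g = \<pi> (shift (emb w + emb u) g)"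
      using pi_monom[OF fg(1) kw(2)] pi_monom[OF fg(2) kw(1)] by (simp_all add: monom_of_mult emb_add)
    moreover have "shift (emb w + emb v) f \<in> Loc B {}" "shift (emb w + emb u) g \<in> Loc B {}"
      using kw by (auto intro!: Loc_shift_expo fg simp: emb_add[symmetric] emb_expo)
    moreover have "shift (emb w + emb v) f - shift (emb w + emb u) g = shift (emb w + emb u + emb v) ?h"
      by (simp add: shift_diff algebra_simps)
    ultimately show ?thesis by (simp add: pi_eq_iff)
  qed
  have h: "?h \<in> Loc B I" using fg uv I by (intro Loc_diff Loc_shift_back)
  have "((\<pi> f, monom_of u), (\<pi> g, monom_of v)) \<in> loc_rel I N \<longleftrightarrow>
      (\<exists>w. Poly_Mapping.keys w \<subseteq> I \<and> shift (emb w + emb u + emb v) ?h \<in> D)"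
    using fg uv pi_image eq unfolding loc_rel_def monoms_on_def by auto
  also have "\<dots> \<longleftrightarrow> ?h \<in> LD I"
  proof
    assume "\<exists>w. Poly_Mapping.keys w \<subseteq> I \<and> shift (emb w + emb u + emb v) ?h \<in> D"
    then obtain w where w: "Poly_Mapping.keys w \<subseteq> I" "shift (emb w + emb u + emb v) ?h \<in> D" by blast
    moreover have "emb w + emb u + emb v \<in> expo I"
      using w uv by (intro expo_add) (simp_all add: emb_expo)
    ultimately show "?h \<in> LD I" unfolding LocD_def using h by blast
  next
    assume "?h \<in> LD I"
    then obtain m where m: "m \<in> expo I" "shift m ?h \<in> D" by (auto simp: LocD_def)
    obtain w where w: "Poly_Mapping.keys w \<subseteq> I" "emb w = m"
      using ex_emb[OF finite_subset[OF I] m(1)] by auto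
    have "emb u + emb v \<in> expo {..<n}"
      using uv I by (intro expo_add) (auto simp: emb_expo)
    from D_shift[OF m(2) this] show "\<exists>w. Poly_Mapping.keys w \<subseteq> I \<and> shift (emb w + emb u + emb v) ?h \<in> D"
      using w by (intro exI[of _ w]) (simp add: algebra_simps)
  qed
  finally show ?thesis .
qed

text \<open>The fraction named by a Laurent vector, as the full set of pairs that represent it; it
  is literally the set built by \<open>frac\<close>.\<close>

definition phi :: "nat set \<Rightarrow> ('f, 'k) laurent \<Rightarrow> ('b \<times> 'k mpol) set" where
  "phi I h = {(\<pi> g, monom_of v) | g v. g \<in> Loc B {} \<and> Poly_Mapping.keys v \<subseteq> I \<and>
     h - shift (- emb v) g \<in> LD I}"

lemma mem_phiI: "f \<in> Loc B {} \<Longrightarrow> Poly_Mapping.keys u \<subseteq> I \<Longrightarrow>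
    (\<pi> f, monom_of u) \<in> phi I (shift (- emb u) f)"
proof -
  assume *: "f \<in> Loc B {}" "Poly_Mapping.keys u \<subseteq> I"
  have "shift (- emb u) f - shift (- emb u) f \<in> LD I"
    by (subst diff_self) (rule LD_zero)
  with * show ?thesis
    unfolding phi_def by blast
qed

lemma mem_phiE:
  assumes "(x, s) \<in> phi I h"
  obtains g v where "x = \<pi> g" "s = monom_of v" "g \<in> Loc B {}" "Poly_Mapping.keys v \<subseteq> I"
    "h - shift (- emb v) g \<in> LD I"
  using assms unfolding phi_def by blast

lemma frac_phi:
  assumes f: "f \<in> Loc B {}" and I: "I \<subseteq> {..<n}" and u: "Poly_Mapping.keys u \<subseteq> I"
  shows "frac I N (\<pi> f) (monom_of u) = phi I (shift (- emb u) f)"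
proof (intro equalityI subsetI)
  fix z assume z: "z \<in> frac I N (\<pi> f) (monom_of u)"
  then have "fst z \<in> carrier N" "snd z \<in> monoms_on I"
    by (auto simp: frac_def loc_rel_def)
  then obtain g v where gv: "g \<in> Loc B {}" "Poly_Mapping.keys v \<subseteq> I" "z = (\<pi> g, monom_of v)"
    unfolding pi_image[symmetric] monoms_on_def by (metis (no_types, lifting) imageE mem_Collect_eq prod.collapse)
  then show "z \<in> phi I (shift (- emb u) f)"
    using z loc_rel_iff[OF f gv(1) I u gv(2)] by (auto simp: frac_def phi_def)
next
  fix z assume "z \<in> phi I (shift (- emb u) f)"
  then obtain g v where "g \<in> Loc B {}" "Poly_Mapping.keys v \<subseteq> I" "z = (\<pi> g, monom_of v)"
    "shift (- emb u) f - shift (- emb v) g \<in> LD I"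
    by (auto simp: phi_def)
  then show "z \<in> frac I N (\<pi> f) (monom_of u)"
    using loc_rel_iff[OF f _ I u] by (auto simp: frac_def)
qed

lemma Loc_representative:
  assumes h: "h \<in> Loc B I" and I: "I \<subseteq> {..<n}"
  obtains f u where "f \<in> Loc B {}" "Poly_Mapping.keys u \<subseteq> I" "h = shift (- emb u) f"
proof -
  obtain m where m: "m \<in> expo I" "shift m h \<in> Loc B {}"
    using Loc_clear_denominator[OF h finB I] by blast
  obtain u where "Poly_Mapping.keys u \<subseteq> I" "emb u = m"
    using ex_emb[OF finite_subset[OF I] m(1)] by auto
  with m(2) show thesis by (intro that[of "shift m h" u]) auto
qed

lemma phi_cong:
  assumes "h - h' \<in> LD I" and I: "I \<subseteq> {..<n}" shows "phi I h = phi I h'"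
proof -
  have "h - x \<in> LD I \<longleftrightarrow> h' - x \<in> LD I" for x
    using LD_add[OF assms(1) _ I, of "h' - x"] LD_diff[OF _ assms(1) I, of "h - x"] by auto
  then show ?thesis by (simp add: phi_def)
qed

lemma phi_eq_iff:
  assumes h: "h \<in> Loc B I" "h' \<in> Loc B I" and I: "I \<subseteq> {..<n}"
  shows "phi I h = phi I h' \<longleftrightarrow> h - h' \<in> LD I"
proof
  assume eq: "phi I h = phi I h'"
  obtain f u where f: "f \<in> Loc B {}" "Poly_Mapping.keys u \<subseteq> I" "h = shift (- emb u) f"
    using Loc_representative[OF h(1) I] .
  have "(\<pi> f, monom_of u) \<in> phi I h" unfolding f(3) by (rule mem_phiI[OF f(1,2)])
  then have "(\<pi> f, monom_of u) \<in> phi I h'" by (simp add: eq)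
  then obtain g v where g: "g \<in> Loc B {}" "\<pi> f = \<pi> g" "(monom_of u :: 'k mpol) = monom_of v"
    "h' - shift (- emb v) g \<in> LD I"
    by (auto simp: phi_def)
  have uv: "v = u" using g(3) by (simp add: monom_of_inject)
  have "f - g \<in> D" using g f by (simp add: pi_eq_iff)
  moreover have "shift (- emb u) f - shift (- emb u) g \<in> Loc B I"
    using f g I by (intro Loc_diff Loc_shift_back)
  ultimately have "shift (- emb u) f - shift (- emb u) g \<in> LD I"
    unfolding LocD_def using f(2)
    by (intro CollectI conjI bexI[of _ "emb u"]) (simp_all add: shift_diff emb_expo)
  from LD_diff[OF this g(4) I] show "h - h' \<in> LD I"
    by (simp add: uv f(3))
qed (rule phi_cong[OF _ I])

lemma phi_nonempty:
  assumes "h \<in> Loc B I" "I \<subseteq> {..<n}" shows "phi I h \<noteq> {}"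
proof -
  obtain f u where f: "f \<in> Loc B {}" "Poly_Mapping.keys u \<subseteq> I" "h = shift (- emb u) f"
    using Loc_representative[OF assms] .
  have "(\<pi> f, monom_of u) \<in> phi I h" unfolding f(3) by (rule mem_phiI[OF f(1,2)])
  then show ?thesis by blast
qed

lemma carrier_gloc:
  assumes I: "I \<subseteq> {..<n}" shows "carrier (gloc I N) = phi I ` Loc B I"
proof (intro equalityI subsetI)
  fix A assume "A \<in> carrier (gloc I N)"
  then obtain f u where "f \<in> Loc B {}" "Poly_Mapping.keys u \<subseteq> I" "A = frac I N (\<pi> f) (monom_of u)"
    by (auto simp: gloc_def quotient_def frac_def pi_image[symmetric] monoms_on_def)
  then show "A \<in> phi I ` Loc B I"
    using frac_phi[OF _ I] Loc_shift_back[OF _ _ I] by blast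
next
  fix A assume "A \<in> phi I ` Loc B I"
  then obtain h where h: "h \<in> Loc B I" "A = phi I h" by blast
  obtain f u where f: "f \<in> Loc B {}" "Poly_Mapping.keys u \<subseteq> I" "h = shift (- emb u) f"
    using Loc_representative[OF h(1) I] .
  then have "A = frac I N (\<pi> f) (monom_of u)" using frac_phi[OF _ I] h(2) by simp
  moreover have "(\<pi> f, monom_of u) \<in> carrier N \<times> monoms_on I"
    using f by (auto simp: pi_image[symmetric] monoms_on_def)
  ultimately show "A \<in> carrier (gloc I N)"
    by (auto simp: gloc_def frac_def intro: quotientI)
qed

lemma zero_gloc: "I \<subseteq> {..<n} \<Longrightarrow> \<zero>\<^bsub>gloc I N\<^esub> = phi I 0"
  using frac_phi[of 0 I 0] by (simp add: gloc_def pi_zero monom_of_zero)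

text \<open>Every choice of representatives gives the same class, so the union that defines addition
  is a union of equal nonempty sets. \<open>sign_gloc\<close> and \<open>loc_map_phi\<close> work in
  the same way.\<close>

lemma add_gloc:
  assumes h: "h \<in> Loc B I" "h' \<in> Loc B I" and I: "I \<subseteq> {..<n}"
  shows "phi I h \<oplus>\<^bsub>gloc I N\<^esub> phi I h' = phi I (h + h')"
proof -
  have *: "frac I N (u \<odot>\<^bsub>N\<^esub> x \<oplus>\<^bsub>N\<^esub> s \<odot>\<^bsub>N\<^esub> y) (s * u) = phi I (h + h')"
    if xs: "(x, s) \<in> phi I h" and yu: "(y, u) \<in> phi I h'" for x s y u
  proof -
    obtain f a where f: "x = \<pi> f" "s = monom_of a" "f \<in> Loc B {}" "Poly_Mapping.keys a \<subseteq> I"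
      "h - shift (- emb a) f \<in> LD I" using mem_phiE[OF xs] .
    obtain g b where g: "y = \<pi> g" "u = monom_of b" "g \<in> Loc B {}" "Poly_Mapping.keys b \<subseteq> I"
      "h' - shift (- emb b) g \<in> LD I" using mem_phiE[OF yu] .
    have ab: "Poly_Mapping.keys a \<subseteq> {..<n}" "Poly_Mapping.keys b \<subseteq> {..<n}"
      "Poly_Mapping.keys (a + b) \<subseteq> I"
      using f(4) g(4) I Poly_Mapping.keys_add[of a b] by auto
    have L: "shift (emb b) f \<in> Loc B {}" "shift (emb a) g \<in> Loc B {}"
      using f g ab by (simp_all add: Loc_shift_expo emb_expo)
    have "frac I N (u \<odot>\<^bsub>N\<^esub> x \<oplus>\<^bsub>N\<^esub> s \<odot>\<^bsub>N\<^esub> y) (s * u) =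
        frac I N (\<pi> (shift (emb b) f + shift (emb a) g)) (monom_of (a + b))"
      using f g ab L by (simp add: pi_monom pi_add monom_of_mult)
    also have "\<dots> = phi I (shift (- emb (a + b)) (shift (emb b) f + shift (emb a) g))"
      using L ab by (intro frac_phi[OF _ I] Loc_add)
    also have "shift (- emb (a + b)) (shift (emb b) f + shift (emb a) g) =
        shift (- emb a) f + shift (- emb b) g"
      by (simp add: shift_add emb_add algebra_simps)
    also have "phi I \<dots> = phi I (h + h')"
    proof (rule phi_cong[OF _ I])
      show "shift (- emb a) f + shift (- emb b) g - (h + h') \<in> LD I"
        using LD_uminus[OF LD_add[OF f(5) g(5) I]] by (simp add: algebra_simps)
    qed
    finally show ?thesis .
  qed
  have "phi I h \<oplus>\<^bsub>gloc I N\<^esub> phi I h' =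
    (\<Union>z\<in>phi I h. \<Union>w\<in>phi I h'. frac I N (snd w \<odot>\<^bsub>N\<^esub> fst z \<oplus>\<^bsub>N\<^esub> snd z \<odot>\<^bsub>N\<^esub> fst w) (snd z * snd w))"
    by (simp add: gloc_def case_prod_beta)
  also have "\<dots> = phi I (h + h')"
    by (intro UN_constant_nonempty phi_nonempty h I *) simp_all
  finally show ?thesis .
qed

lemma sign_gloc:
  assumes h: "h \<in> Loc B I" and I: "I \<subseteq> {..<n}"
  shows "(-1) ^ k \<odot>\<^bsub>gloc I N\<^esub> phi I h = phi I (\<lambda>b \<alpha>. (-1) ^ k * h b \<alpha>)"
proof -
  have *: "frac I N ((-1) ^ k \<odot>\<^bsub>N\<^esub> x) s = phi I (\<lambda>b \<alpha>. (-1) ^ k * h b \<alpha>)"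
    if xs: "(x, s) \<in> phi I h" for x s
  proof -
    obtain f a where f: "x = \<pi> f" "s = monom_of a" "f \<in> Loc B {}" "Poly_Mapping.keys a \<subseteq> I"
      "h - shift (- emb a) f \<in> LD I" using mem_phiE[OF xs] .
    let ?f = "\<lambda>b \<alpha>. (-1) ^ k * f b \<alpha>"
    have "(-1) ^ k \<odot>\<^bsub>N\<^esub> x = \<pi> ?f"
    proof (cases "even k")
      case True
      then show ?thesis using pi_monom[OF f(3), of 0] f(1) by (simp add: monom_of_zero)
    next
      case False
      then have "?f = - f" by (simp add: fun_eq_iff)
      then show ?thesis using False pi_uminus[OF f(3)] f(1) by simp
    qed
    then have "frac I N ((-1) ^ k \<odot>\<^bsub>N\<^esub> x) s = phi I (shift (- emb a) ?f)"
      using frac_phi[OF Loc_scale[OF f(3)] I f(4)] f(2) by simp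
    also have "\<dots> = phi I (\<lambda>b \<alpha>. (-1) ^ k * h b \<alpha>)"
    proof (rule phi_cong[OF _ I])
      have "shift (- emb a) ?f - (\<lambda>b \<alpha>. (-1) ^ k * h b \<alpha>) =
        (\<lambda>b \<alpha>. (-1) ^ k * (- (h - shift (- emb a) f)) b \<alpha>)"
        by (simp add: fun_eq_iff shift_apply algebra_simps)
      then show "shift (- emb a) ?f - (\<lambda>b \<alpha>. (-1) ^ k * h b \<alpha>) \<in> LD I"
        using LD_scale_sign[OF LD_uminus[OF f(5)], of k] by simp
    qed
    finally show ?thesis .
  qed
  have "(-1) ^ k \<odot>\<^bsub>gloc I N\<^esub> phi I h = (\<Union>z\<in>phi I h. frac I N ((-1) ^ k \<odot>\<^bsub>N\<^esub> fst z) (snd z))"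
    by (simp add: gloc_def case_prod_beta)
  also have "\<dots> = phi I (\<lambda>b \<alpha>. (-1) ^ k * h b \<alpha>)"
    by (intro UN_constant_nonempty phi_nonempty h I *) simp
  finally show ?thesis .
qed

lemma loc_map_phi:
  assumes h: "h \<in> Loc B I" and IJ: "I \<subseteq> J" and J: "J \<subseteq> {..<n}"
  shows "loc_map J N (phi I h) = phi J h"
proof -
  note I = subset_trans[OF IJ J]
  have *: "frac J N x s = phi J h" if xs: "(x, s) \<in> phi I h" for x s
  proof -
    obtain f a where f: "x = \<pi> f" "s = monom_of a" "f \<in> Loc B {}" "Poly_Mapping.keys a \<subseteq> I"
      "h - shift (- emb a) f \<in> LD I" using mem_phiE[OF xs] .
    have "frac J N x s = phi J (shift (- emb a) f)"
      using frac_phi[OF f(3) J] f IJ by auto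
    also have "\<dots> = phi J h"
      using LD_mono[OF LD_uminus[OF f(5)] IJ] by (intro phi_cong[OF _ J]) simp
    finally show ?thesis .
  qed
  have "loc_map J N (phi I h) = (\<Union>z\<in>phi I h. frac J N (fst z) (snd z))"
    by (simp add: loc_map_def case_prod_beta)
  also have "\<dots> = phi J h"
    by (intro UN_constant_nonempty phi_nonempty h I *) simp
  finally show ?thesis .
qed

lemma gr_gloc:
  assumes I: "I \<subseteq> {..<n}"
  shows "gr (gloc I N) r = phi I ` {h \<in> Loc B I. homog dg r h}"
proof (intro equalityI subsetI)
  fix A assume "A \<in> gr (gloc I N) r"
  then obtain f u where f: "f \<in> Loc B {}" "Poly_Mapping.keys u \<subseteq> I" "A = frac I N (\<pi> f) (monom_of u)"
    "homog dg (r + int (mdeg u)) f"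
    by (auto simp: gloc_def pi_gr)
  have "homog dg r (shift (- emb u) f)"
    using homog_shift[OF f(4), of "- emb u"] mdeg_emb[of u] f(2) I by (simp add: tdeg_uminus)
  then show "A \<in> phi I ` {h \<in> Loc B I. homog dg r h}"
    using f frac_phi[OF f(1) I f(2)] Loc_shift_back[OF f(1,2) I] by auto
next
  fix A assume "A \<in> phi I ` {h \<in> Loc B I. homog dg r h}"
  then obtain h where h: "h \<in> Loc B I" "A = phi I h" "homog dg r h" by blast
  obtain f u where f: "f \<in> Loc B {}" "Poly_Mapping.keys u \<subseteq> I" "h = shift (- emb u) f"
    using Loc_representative[OF h(1) I] .
  have "A = frac I N (\<pi> f) (monom_of u)" using frac_phi[OF _ I] h(2) f by simp
  moreover have "homog dg (r + int (mdeg u)) f"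
    using homog_shift[OF h(3), of "emb u"] mdeg_emb[of u] f(2,3) I by simp
  then have "\<pi> f \<in> gr N (r + int (mdeg u))" using f(1) by (auto simp: pi_gr)
  ultimately show "A \<in> gr (gloc I N) r"
    using f(2) by (auto simp: gloc_def)
qed

lemma abelian_monoid_gloc:
  assumes I: "I \<subseteq> {..<n}" shows "abelian_monoid (gloc I N)"
  by (rule abelian_monoidI)
    (auto simp: carrier_gloc[OF I] zero_gloc[OF I] add_gloc[OF _ _ I] Loc_add add_ac)

lemma finsum_gloc:
  assumes I: "I \<subseteq> {..<n}" and "finite S" and "\<And>i. i \<in> S \<Longrightarrow> h i \<in> Loc B I"
  shows "(\<Oplus>\<^bsub>gloc I N\<^esub>i\<in>S. phi I (h i)) = phi I (\<Sum>i\<in>S. h i)"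
proof -
  interpret abelian_monoid "gloc I N" by (rule abelian_monoid_gloc[OF I])
  show ?thesis
    using assms(2,3)
  proof (induction S)
    case empty
    show ?case by (simp only: finsum_empty sum.empty zero_gloc[OF I])
  next
    case (insert x S)
    then have "(\<Oplus>\<^bsub>gloc I N\<^esub>i\<in>insert x S. phi I (h i)) = phi I (h x) \<oplus>\<^bsub>gloc I N\<^esub> phi I (\<Sum>i\<in>S. h i)"
      by (subst finsum_insert) (auto simp: carrier_gloc[OF I])
    also have "\<dots> = phi I (h x + (\<Sum>i\<in>S. h i))"
      using insert.prems by (intro add_gloc[OF _ _ I] Loc_sum) auto
    finally show ?case by (simp only: sum.insert[OF insert.hyps])
  qed
qed

section \<open>The Cech complex of the presented module\<close>

definition Phi :: "nat \<Rightarrow> (nat set \<Rightarrow> ('f, 'k) laurent) \<Rightarrow> nat set \<Rightarrow> ('b \<times> 'k mpol) set" where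
  "Phi q a = (\<lambda>I\<in>subs n q. phi I (a I))"

lemma cochain_subs: "cochain B a \<Longrightarrow> I \<in> subs n q \<Longrightarrow> a I \<in> Loc B I"
  by (simp add: cochain_def subs_def)

text \<open>Representatives are chosen index set by index set and extended by 0 to a family on all
  subsets. The parameter \<open>P\<close> lets the argument serve both the carrier and the graded
  parts.\<close>

lemma Phi_surjective_aux:
  assumes P: "\<And>I. I \<subseteq> {..<n} \<Longrightarrow> P I \<subseteq> Loc B I" and x: "x \<in> (\<Pi>\<^sub>E I\<in>subs n q. phi I ` P I)"
  shows "\<exists>a. cochain B a \<and> (\<forall>I\<in>subs n q. a I \<in> P I) \<and> x = Phi q a"
proof -
  have "\<forall>I\<in>subs n q. \<exists>h\<in>P I. x I = phi I h" using x by (auto simp: PiE_def Pi_def)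
  then obtain a where a: "\<And>I. I \<in> subs n q \<Longrightarrow> a I \<in> P I \<and> x I = phi I (a I)" by metis
  let ?a = "\<lambda>I. if I \<in> subs n q then a I else 0"
  have "cochain B ?a"
    unfolding cochain_def
  proof (intro allI impI)
    fix I assume "I \<subseteq> {..<n}"
    from P[OF this] show "?a I \<in> Loc B I" using a[of I] by auto
  qed
  moreover have "x = Phi q ?a"
  proof
    fix I show "x I = Phi q ?a I"
    proof (cases "I \<in> subs n q")
      case True
      then show ?thesis using a[OF True] by (simp add: Phi_def)
    qed (simp add: Phi_def PiE_arb[OF x])
  qed
  moreover have "\<forall>I\<in>subs n q. ?a I \<in> P I" using a by simp
  ultimately show ?thesis by blast
qed

lemma carrier_cech: "carrier (cech n N q) = Phi q ` {a. cochain B a}"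
proof -
  have "carrier (cech n N q) = (\<Pi>\<^sub>E I\<in>subs n q. phi I ` Loc B I)"
    unfolding cech_def using carrier_gloc[OF subs_subset] by (auto intro!: PiE_cong)
  also have "\<dots> = Phi q ` {a. cochain B a}"
  proof (intro equalityI subsetI)
    fix x assume "x \<in> (\<Pi>\<^sub>E I\<in>subs n q. phi I ` Loc B I)"
    from Phi_surjective_aux[OF _ this] show "x \<in> Phi q ` {a. cochain B a}" by auto
  qed (auto simp: Phi_def intro: cochain_subs)
  finally show ?thesis .
qed

lemma gr_cech: "gr (cech n N q) r = Phi q ` {a. cochain B a \<and> (\<forall>I\<in>subs n q. homog dg r (a I))}"
proof -
  let ?P = "\<lambda>I. {h \<in> Loc B I. homog dg r h}"
  have "gr (cech n N q) r = (\<Pi>\<^sub>E I\<in>subs n q. phi I ` ?P I)"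
    unfolding cech_def using gr_gloc[OF subs_subset] by (auto intro!: PiE_cong)
  also have "\<dots> = Phi q ` {a. cochain B a \<and> (\<forall>I\<in>subs n q. homog dg r (a I))}"
  proof (intro equalityI subsetI)
    fix x assume "x \<in> (\<Pi>\<^sub>E I\<in>subs n q. phi I ` ?P I)"
    from Phi_surjective_aux[OF _ this]
    show "x \<in> Phi q ` {a. cochain B a \<and> (\<forall>I\<in>subs n q. homog dg r (a I))}" by auto
  qed (auto simp: Phi_def intro!: imageI cochain_subs)
  finally show ?thesis .
qed

lemma zero_cech: "\<zero>\<^bsub>cech n N q\<^esub> = Phi q (\<lambda>I. 0)"
  by (auto simp: cech_def Phi_def zero_gloc[OF subs_subset] intro!: restrict_ext)

lemma add_cech:
  "cochain B a \<Longrightarrow> cochain B b \<Longrightarrow> Phi q a \<oplus>\<^bsub>cech n N q\<^esub> Phi q b = Phi q (\<lambda>I. a I + b I)"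
  unfolding cech_def Phi_def by (simp add: add_gloc cochain_subs subs_subset cong: restrict_cong)

lemma Phi_eq_iff:
  assumes "cochain B a" "cochain B b"
  shows "Phi q a = Phi q b \<longleftrightarrow> (\<forall>I\<in>subs n q. a I - b I \<in> LD I)"
proof -
  have "Phi q a = Phi q b \<longleftrightarrow> (\<forall>I\<in>subs n q. phi I (a I) = phi I (b I))"
    by (auto simp: Phi_def fun_eq_iff restrict_def)
  also have "\<dots> \<longleftrightarrow> (\<forall>I\<in>subs n q. a I - b I \<in> LD I)"
    using phi_eq_iff[OF cochain_subs[OF assms(1)] cochain_subs[OF assms(2)] subs_subset] by blast
  finally show ?thesis .
qed

lemma cech_diff_Phi:
  assumes a: "cochain B a" shows "cech_diff n N q (Phi q a) = Phi (Suc q) (delta a)"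
  unfolding cech_diff_def Phi_def[of "Suc q"]
proof (rule restrict_ext)
  fix J assume J: "J \<in> subs n (Suc q)"
  note J' = subs_subset[OF J]
  interpret abelian_monoid "gloc J N" by (rule abelian_monoid_gloc[OF J'])
  have "(-1) ^ card {j\<in>J. j < i} \<odot>\<^bsub>gloc J N\<^esub> loc_map J N (Phi q a (J - {i})) =
      phi J (\<lambda>b \<alpha>. (-1) ^ card {j\<in>J. j < i} * a (J - {i}) b \<alpha>)" if i: "i \<in> J" for i
    using subs_remove[OF J i] cochain_subs[OF a, of "J - {i}" q] cochain_remove[OF a J']
    by (simp add: Phi_def loc_map_phi[OF _ _ J'] sign_gloc[OF _ J'])
  then have "(\<Oplus>\<^bsub>gloc J N\<^esub>i\<in>J. (-1) ^ card {j\<in>J. j < i} \<odot>\<^bsub>gloc J N\<^esub> loc_map J N (Phi q a (J - {i}))) =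
      (\<Oplus>\<^bsub>gloc J N\<^esub>i\<in>J. phi J (\<lambda>b \<alpha>. (-1) ^ card {j\<in>J. j < i} * a (J - {i}) b \<alpha>))"
    by (intro finsum_cong) (auto simp: simp_implies_def carrier_gloc[OF J']
        intro!: imageI Loc_scale cochain_remove a J')
  also have "\<dots> = phi J (delta a J)"
    unfolding delta_eq_sum
    by (intro finsum_gloc[OF J' finite_subs_elem[OF J]] Loc_scale cochain_remove a J')
  finally show "(\<Oplus>\<^bsub>gloc J N\<^esub>i\<in>J. (-1) ^ card {j\<in>J. j < i} \<odot>\<^bsub>gloc J N\<^esub> loc_map J N (Phi q a (J - {i}))) =
     phi J (delta a J)" .
qed

lemma coboundaries_eq: "cech_coboundaries n N q = {Phi q (delta b) | b. cochain B b}"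
proof (cases q)
  case 0
  \<comment> \<open>On the empty index set \<open>delta b\<close> is an empty sum, so the uniform
    description also covers the separate clause for degree 0.\<close>
  have "Phi 0 (delta b) = Phi 0 (\<lambda>I. 0)" for b
    by (auto simp: Phi_def subs_def delta_def fun_eq_iff restrict_def zero_fun_def
        dest: finite_subset intro!: arg_cong[of _ _ "phi _"])
  moreover have "cochain B (\<lambda>I. 0)" by (simp add: cochain_def)
  ultimately show ?thesis using 0 zero_cech[of 0] by auto
next
  case (Suc p)
  have "cech_coboundaries n N q = cech_diff n N p ` Phi p ` {a. cochain B a}"
    using Suc by (simp add: carrier_cech)
  also have "\<dots> = {Phi q (delta b) | b. cochain B b}"
    using cech_diff_Phi Suc by (auto simp: image_iff)
  finally show ?thesis .
qed

text \<open>Cochains, cocycles and coboundaries all correspond through \<open>Phi\<close>, and a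
  coset is trivial exactly if its representative bounds modulo the localized relations.\<close>

theorem local_cohomology_nonzero_iff:
  "gr (local_cohomology n N q) r \<noteq> {\<zero>\<^bsub>local_cohomology n N q\<^esub>} \<longleftrightarrow> coh_nonzero B dg D q r"
proof -
  let ?H = "cech_coboundaries n N q"
  define Z where "Z = a_kernel (cech n N q) (cech n N (Suc q)) (cech_diff n N q)"
  define C where "C = gsub (cech n N q) Z"
  have addC: "x \<oplus>\<^bsub>C\<^esub> y = x \<oplus>\<^bsub>cech n N q\<^esub> y" for x y
    by (simp add: C_def gsub_def)
  have cz: "cochain B (\<lambda>I. 0)" by (simp add: cochain_def)
  have lc: "gr (local_cohomology n N q) r = (\<lambda>x. ?H +>\<^bsub>C\<^esub> x) ` (gr (cech n N q) r \<inter> Z)"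
    "\<zero>\<^bsub>local_cohomology n N q\<^esub> = ?H"
    by (simp_all add: local_cohomology_def gquot_def C_def gsub_def Z_def)
  have coset: "?H +>\<^bsub>C\<^esub> Phi q a = {Phi q (\<lambda>I. delta b I + a I) | b. cochain B b}" if a: "cochain B a" for a
    using add_cech[OF cochain_delta a]
    by (auto simp: a_r_coset_def' coboundaries_eq addC)
  have coset_eq: "?H +>\<^bsub>C\<^esub> Phi q a = ?H \<longleftrightarrow> (\<exists>b. cochain B b \<and> (\<forall>I\<in>subs n q. a I - delta b I \<in> LD I))"
    if a: "cochain B a" for a
  proof
    assume "?H +>\<^bsub>C\<^esub> Phi q a = ?H"
    moreover have "Phi q (\<lambda>I. delta (\<lambda>I. 0) I + a I) \<in> ?H +>\<^bsub>C\<^esub> Phi q a"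
      unfolding coset[OF a] using cz by blast
    ultimately have "Phi q a \<in> ?H" by simp
    then obtain b where b: "cochain B b" "Phi q a = Phi q (delta b)" by (auto simp: coboundaries_eq)
    then show "\<exists>b. cochain B b \<and> (\<forall>I\<in>subs n q. a I - delta b I \<in> LD I)"
      using Phi_eq_iff[OF a cochain_delta[OF b(1)]] by blast
  next
    assume "\<exists>b. cochain B b \<and> (\<forall>I\<in>subs n q. a I - delta b I \<in> LD I)"
    then obtain b where b: "cochain B b" "\<And>I. I \<in> subs n q \<Longrightarrow> a I - delta b I \<in> LD I" by blast
    \<comment> \<open>Adding a coboundary only translates the parameter \<open>c\<close> by
      \<open>b\<close>; the coset and the coboundaries are thus parametrized by the same
      cochains.\<close>
    have sum: "Phi q (\<lambda>I. delta c I + a I) = Phi q (delta (\<lambda>I. c I + b I))" if c: "cochain B c" for c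
    proof -
      have "cochain B (\<lambda>I. delta c I + a I)" "cochain B (delta (\<lambda>I. c I + b I))"
        using a b(1) c cochain_delta[OF c] cochain_delta[of B "\<lambda>I. c I + b I"]
        by (auto simp: cochain_def Loc_add)
      then show ?thesis using b(2) by (simp add: Phi_eq_iff delta_add)
    qed
    show "?H +>\<^bsub>C\<^esub> Phi q a = ?H"
      unfolding coset[OF a] unfolding coboundaries_eq
    proof (intro equalityI subsetI)
      fix x assume "x \<in> {Phi q (\<lambda>I. delta b I + a I) | b. cochain B b}"
      then obtain c where c: "cochain B c" "x = Phi q (\<lambda>I. delta c I + a I)" by blast
      have "cochain B (\<lambda>I. c I + b I)" using c b by (simp add: cochain_def Loc_add)
      then show "x \<in> {Phi q (delta b) | b. cochain B b}" using c sum by blast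
    next
      fix x assume "x \<in> {Phi q (delta b) | b. cochain B b}"
      then obtain c where c: "cochain B c" "x = Phi q (delta c)" by blast
      have c': "cochain B (\<lambda>I. c I - b I)" using c b by (simp add: cochain_def Loc_diff)
      have "x = Phi q (\<lambda>I. delta (\<lambda>I. c I - b I) I + a I)" using sum[OF c'] c by simp
      then show "x \<in> {Phi q (\<lambda>I. delta b I + a I) | b. cochain B b}" using c' by blast
    qed
  qed
  have Z: "Phi q a \<in> Z \<longleftrightarrow> (\<forall>J\<in>subs n (Suc q). delta a J \<in> LD J)" if a: "cochain B a" for a
    using Phi_eq_iff[OF cochain_delta[OF a] cz, of "Suc q"] a
    by (auto simp: Z_def a_kernel_def' cech_diff_Phi[OF a] zero_cech carrier_cech)
  \<comment> \<open>The graded part always contains the zero class, so being different from the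
    singleton means having a nontrivial coset.\<close>
  have ne: "?H \<in> (\<lambda>x. ?H +>\<^bsub>C\<^esub> x) ` (gr (cech n N q) r \<inter> Z)"
  proof (rule image_eqI[of _ _ "Phi q (\<lambda>I. 0)"])
    have "0 - delta (\<lambda>I. 0) I \<in> LD I" for I
      unfolding delta_zero diff_self by (rule LD_zero)
    with cz show "?H = ?H +>\<^bsub>C\<^esub> Phi q (\<lambda>I. 0)"
      by (intro coset_eq[OF cz, THEN iffD2, symmetric]) blast
    show "Phi q (\<lambda>I. 0) \<in> gr (cech n N q) r \<inter> Z"
    proof
      show "Phi q (\<lambda>I. 0) \<in> gr (cech n N q) r"
        unfolding gr_cech by (intro imageI CollectI conjI ballI cz homog_zero)
      show "Phi q (\<lambda>I. 0) \<in> Z"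
        by (intro Z[OF cz, THEN iffD2] ballI) (simp only: delta_zero LD_zero)
    qed
  qed
  have "gr (local_cohomology n N q) r \<noteq> {\<zero>\<^bsub>local_cohomology n N q\<^esub>} \<longleftrightarrow>
      (\<exists>x\<in>gr (cech n N q) r \<inter> Z. ?H +>\<^bsub>C\<^esub> x \<noteq> ?H)"
    using ne unfolding lc by blast
  also have "\<dots> \<longleftrightarrow> (\<exists>a. cochain B a \<and> (\<forall>I\<in>subs n q. homog dg r (a I)) \<and> Phi q a \<in> Z \<and>
      ?H +>\<^bsub>C\<^esub> Phi q a \<noteq> ?H)"
    by (auto simp: gr_cech)
  also have "\<dots> \<longleftrightarrow> coh_nonzero B dg D q r"
    unfolding coh_nonzero_def coh_witness_def using Z coset_eq by blast
  finally show ?thesis .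
qed

end

section \<open>Coordinates on graded free modules\<close>

definition to_poly :: "((nat \<Rightarrow> int) \<Rightarrow> 'k::field) \<Rightarrow> 'k mpol" where
  "to_poly g = Abs_poly_mapping (\<lambda>m. g (emb m))"

lemma inj_emb: "inj emb"
  by (simp add: inj_def emb_inject)

lemma lookup_to_poly:
  assumes "finite {\<alpha>. g \<alpha> \<noteq> 0}"
  shows "Poly_Mapping.lookup (to_poly g) m = g (emb m)"
proof -
  have "finite (emb -` {\<alpha>. g \<alpha> \<noteq> 0})"
    by (rule finite_vimageI[OF assms inj_emb])
  then have "finite {m. g (emb m) \<noteq> 0}"
    by (simp add: vimage_def)
  then show ?thesis by (simp add: to_poly_def)
qed

lemma lookup_monom_times:
  "Poly_Mapping.lookup (monom_of u * p) (u + m) = Poly_Mapping.lookup p m"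
  for p :: "'k::field mpol"
proof -
  have "(\<Sum>q. Poly_Mapping.lookup p q when u + m = u + q) = (\<Sum>q. Poly_Mapping.lookup p q when m = q)"
    by simp
  also have "\<dots> = Poly_Mapping.lookup p m"
    by (simp add: when_def)
  finally have *: "(\<Sum>q. Poly_Mapping.lookup p q when u + m = u + q) = Poly_Mapping.lookup p m" .
  have "Poly_Mapping.lookup (monom_of u * p) (u + m) =
      (\<Sum>l. ((\<Sum>q. Poly_Mapping.lookup p q when u + m = l + q)) when u = l)"
    by (simp add: lookup_mult monom_of_def lookup_single when_mult)
  also have "\<dots> = (\<Sum>q. Poly_Mapping.lookup p q when u + m = u + q)"
    by (simp add: when_def)
  finally show ?thesis using * by simp
qed

lemma lookup_monom_times_other:
  fixes p :: "'k::field mpol"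
  assumes "\<And>m. v \<noteq> u + m"
  shows "Poly_Mapping.lookup (monom_of u * p) v = 0"
proof (rule ccontr)
  assume "Poly_Mapping.lookup (monom_of u * p) v \<noteq> 0"
  then have "v \<in> Poly_Mapping.keys (monom_of u * p)" by (simp add: in_keys_iff)
  then have "v \<in> {a + b | a b. a \<in> Poly_Mapping.keys (monom_of u :: 'k mpol) \<and> b \<in> Poly_Mapping.keys p}"
    using keys_mult by blast
  then obtain a b where "v = a + b" "a \<in> Poly_Mapping.keys (monom_of u :: 'k mpol)" by blast
  then show False using assms[of b] by (simp add: monom_of_def)
qed

context laurent_vectors
begin

lemma Loc_exponent:
  assumes "f \<in> Loc B {}" "f b \<alpha> \<noteq> 0"
  obtains m where "Poly_Mapping.keys m \<subseteq> {..<n}" "emb m = \<alpha>"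
proof -
  have "0 \<le> \<alpha> i" "n \<le> i \<longrightarrow> \<alpha> i = 0" for i
    using Loc_above[OF assms, of i] Loc_nonneg[OF assms, of i] by (cases "i < n"; simp)+
  then have "\<alpha> \<in> expo {..<n}" by (auto simp: expo_def)
  with ex_emb[of "{..<n}" \<alpha>] that show thesis by blast
qed

lemma lookup_to_poly_Loc:
  "f \<in> Loc B I \<Longrightarrow> Poly_Mapping.lookup (to_poly (f b)) m = f b (emb m)"
  by (rule lookup_to_poly[OF Loc_finite])

lemma to_poly_carrier:
  assumes f: "f \<in> Loc B {}" shows "to_poly (f b) \<in> carrier (polyring n)"
proof -
  have "Poly_Mapping.keys m \<subseteq> {..<n}" if "m \<in> Poly_Mapping.keys (to_poly (f b))" for m
  proof -
    have "f b (emb m) \<noteq> 0" using that by (simp add: in_keys_iff lookup_to_poly_Loc[OF f])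
    then obtain m' where "Poly_Mapping.keys m' \<subseteq> {..<n}" "emb m' = emb m"
      using Loc_exponent[OF f] by blast
    then show ?thesis by (simp add: emb_inject)
  qed
  then show ?thesis by (simp add: polyring_def)
qed

lemma to_poly_add:
  assumes "f \<in> Loc B {}" "g \<in> Loc B {}"
  shows "to_poly ((f + g) b) = to_poly (f b) + to_poly (g b)"
proof (rule poly_mapping_eqI)
  fix m
  show "Poly_Mapping.lookup (to_poly ((f + g) b)) m = Poly_Mapping.lookup (to_poly (f b) + to_poly (g b)) m"
    unfolding lookup_add lookup_to_poly_Loc[OF Loc_add[OF assms]] lookup_to_poly_Loc[OF assms(1)]
      lookup_to_poly_Loc[OF assms(2)] by simp
qed

lemma to_poly_uminus:
  assumes "f \<in> Loc B {}" shows "to_poly ((- f) b) = - 1 * to_poly (f b)"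
proof (rule poly_mapping_eqI)
  fix m
  show "Poly_Mapping.lookup (to_poly ((- f) b)) m = Poly_Mapping.lookup (- 1 * to_poly (f b)) m"
    unfolding lookup_to_poly_Loc[OF Loc_uminus[OF assms]] by (simp add: lookup_to_poly_Loc[OF assms])
qed

lemma to_poly_shift:
  assumes f: "f \<in> Loc B {}" and u: "Poly_Mapping.keys u \<subseteq> {..<n}"
  shows "to_poly (shift (emb u) f b) = monom_of u * to_poly (f b)"
proof (intro poly_mapping_eqI)
  fix v
  have sh: "shift (emb u) f \<in> Loc B {}" using u by (intro Loc_shift_expo f) (simp add: emb_expo)
  have l: "Poly_Mapping.lookup (to_poly (shift (emb u) f b)) v = f b (emb v - emb u)"
    by (simp add: lookup_to_poly_Loc[OF sh] shift_apply)
  show "Poly_Mapping.lookup (to_poly (shift (emb u) f b)) v = Poly_Mapping.lookup (monom_of u * to_poly (f b)) v"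
  proof (cases "\<exists>m. v = u + m")
    case True
    then obtain m where v: "v = u + m" by blast
    show ?thesis unfolding l unfolding v lookup_monom_times lookup_to_poly_Loc[OF f]
      by (simp add: emb_add)
  next
    case False
    have "f b (emb v - emb u) = 0"
    proof (rule ccontr)
      assume "f b (emb v - emb u) \<noteq> 0"
      then obtain m where "emb m = emb v - emb u" using Loc_exponent[OF f] by blast
      then have "emb (u + m) = emb v" by (simp add: emb_add)
      then show False using False by (metis emb_inject)
    qed
    then show ?thesis using False by (simp add: l lookup_monom_times_other)
  qed
qed

lemma monom_of_carrier: "Poly_Mapping.keys m \<subseteq> {..<n} \<Longrightarrow> monom_of m \<in> carrier (polyring n)"
  by (simp add: polyring_def monom_of_def)

lemma minus_one_carrier: "- 1 \<in> carrier (polyring n)"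
  by (simp add: polyring_def)

lemma finsum_additive_map:
  assumes M: "abelian_monoid M" and closed: "\<pi> ` Loc B {} \<subseteq> carrier M" and zero: "\<pi> 0 = \<zero>\<^bsub>M\<^esub>"
    and add: "\<And>f g. f \<in> Loc B {} \<Longrightarrow> g \<in> Loc B {} \<Longrightarrow> \<pi> f \<oplus>\<^bsub>M\<^esub> \<pi> g = \<pi> (f + g)"
    and S: "finite S" "\<And>i. i \<in> S \<Longrightarrow> h i \<in> Loc B {}"
  shows "(\<Oplus>\<^bsub>M\<^esub>i\<in>S. \<pi> (h i)) = \<pi> (\<Sum>i\<in>S. h i)"
proof -
  interpret abelian_monoid M by (rule M)
  show ?thesis
    using S
  proof (induction S)
    case empty
    show ?case by (simp only: finsum_empty sum.empty zero)
  next
    case (insert x S)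
    then have "(\<Oplus>\<^bsub>M\<^esub>i\<in>insert x S. \<pi> (h i)) = \<pi> (h x) \<oplus>\<^bsub>M\<^esub> \<pi> (\<Sum>i\<in>S. h i)"
      using closed by (subst finsum_insert) auto
    also have "\<dots> = \<pi> (h x + (\<Sum>i\<in>S. h i))"
      using insert.prems by (intro add Loc_sum) auto
    finally show ?case by (simp only: sum.insert[OF insert.hyps])
  qed
qed

text \<open>Uniqueness of homogeneous decompositions makes a degree-preserving surjection surjective in
  every degree.\<close>

lemma gr_eq_image:
  assumes M: "graded_module n M" and B: "finite B" and surj: "\<pi> ` Loc B {} = carrier M"
    and zero: "\<pi> 0 = \<zero>\<^bsub>M\<^esub>"
    and add: "\<And>f g. f \<in> Loc B {} \<Longrightarrow> g \<in> Loc B {} \<Longrightarrow> \<pi> f \<oplus>\<^bsub>M\<^esub> \<pi> g = \<pi> (f + g)"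
    and deg: "\<And>f r. f \<in> Loc B {} \<Longrightarrow> homog dg r f \<Longrightarrow> \<pi> f \<in> gr M r"
  shows "gr M r = \<pi> ` {f \<in> Loc B {}. homog dg r f}"
proof (intro equalityI subsetI)
  interpret graded_module n M by (rule M)
  fix x assume x: "x \<in> gr M r"
  have "additive_subgroup (gr M r) M" by (rule gr_subgroup)
  then have xc: "x \<in> carrier M" using x by (rule additive_subgroup.a_Hcarr)
  then obtain f where f: "f \<in> Loc B {}" "x = \<pi> f" using surj by blast
  obtain S where S: "finite S" "f = (\<Sum>s\<in>S. hcomp dg s f)" "\<forall>s. s \<notin> S \<longrightarrow> hcomp dg s f = 0"
    using hcomp_decomposition[OF f(1) B] by blast
  \<comment> \<open>Two homogeneous decompositions of \<open>x\<close> are compared: the images of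
    the components of a preimage, and \<open>x\<close> itself placed in degree
    \<open>r\<close>.\<close>
  define c where "c s = \<pi> (hcomp dg s f)" for s
  define c' where "c' s = (if s = r then x else \<zero>\<^bsub>M\<^esub>)" for s
  have hc: "hcomp dg s f \<in> Loc B {}" for s by (rule Loc_hcomp[OF f(1)])
  have cc: "c s \<in> carrier M" for s using hc surj by (auto simp: c_def)
  have sub: "{s. c s \<noteq> \<zero>\<^bsub>M\<^esub>} \<subseteq> S" using S(3) zero by (auto simp: c_def)
  have "(\<Oplus>\<^bsub>M\<^esub>s\<in>S. c s) = \<pi> (\<Sum>s\<in>S. hcomp dg s f)"
    unfolding c_def
    by (rule finsum_additive_map[where B = B, OF M.abelian_monoid_axioms _ zero add S(1)])
      (use hc surj in auto)
  then have "x = (\<Oplus>\<^bsub>M\<^esub>s\<in>S. c s)" using f(2) S(2) by simp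
  also have "\<dots> = (\<Oplus>\<^bsub>M\<^esub>s\<in>{s. c s \<noteq> \<zero>\<^bsub>M\<^esub>}. c s)"
    by (rule M.add.finprod_mono_neutral_cong_right) (use S(1) sub cc in auto)
  finally have d1: "(\<forall>s. c s \<in> gr M s) \<and> finite {s. c s \<noteq> \<zero>\<^bsub>M\<^esub>} \<and> x = (\<Oplus>\<^bsub>M\<^esub>s\<in>{s. c s \<noteq> \<zero>\<^bsub>M\<^esub>}. c s)"
    using finite_subset[OF sub S(1)] deg[OF hc homog_hcomp] by (simp add: c_def)
  have "c' s \<in> gr M s" for s
    using x additive_subgroup.zero_closed[OF gr_subgroup] by (simp add: c'_def)
  moreover have "finite {s. c' s \<noteq> \<zero>\<^bsub>M\<^esub>} \<and> x = (\<Oplus>\<^bsub>M\<^esub>s\<in>{s. c' s \<noteq> \<zero>\<^bsub>M\<^esub>}. c' s)"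
  proof (cases "x = \<zero>\<^bsub>M\<^esub>")
    case True
    then have "{s. c' s \<noteq> \<zero>\<^bsub>M\<^esub>} = {}" by (auto simp: c'_def)
    then show ?thesis using True by simp
  next
    case False
    then have "{s. c' s \<noteq> \<zero>\<^bsub>M\<^esub>} = {r}" by (auto simp: c'_def)
    then show ?thesis using xc by (simp add: c'_def)
  qed
  ultimately have d2: "(\<forall>s. c' s \<in> gr M s) \<and> finite {s. c' s \<noteq> \<zero>\<^bsub>M\<^esub>} \<and>
      x = (\<Oplus>\<^bsub>M\<^esub>s\<in>{s. c' s \<noteq> \<zero>\<^bsub>M\<^esub>}. c' s)" by blast
  have "c = c'" using gr_direct_sum[OF xc] d1 d2 by blast
  then have "x = \<pi> (hcomp dg r f)" by (metis c_def c'_def)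
  then show "x \<in> \<pi> ` {f \<in> Loc B {}. homog dg r f}" using hc homog_hcomp by blast
qed (use deg in blast)

text \<open>The homogeneous basis, a subset of \<open>F\<close>, is itself the index set, and
  Laurent vectors without denominators are the coordinate vectors. Existence and uniqueness of
  coordinates give surjectivity and injectivity.\<close>

lemma graded_free_coordinates:
  fixes F :: "('k::field mpol, 'f) gmodule"
  assumes "graded_free n F"
  shows "\<exists>(B :: 'f set) dg \<kappa>. presentation n B dg F \<kappa> \<and> inj_on \<kappa> (Loc B {})"
proof -
  interpret graded_module n F using assms by (simp add: graded_free_def)
  obtain B where B: "finite B" "B \<subseteq> (\<Union>r. gr F r)"
    and uniq: "\<forall>x\<in>carrier F. \<exists>!c. c \<in> B \<rightarrow>\<^sub>E carrier (polyring n) \<and> x = (\<Oplus>\<^bsub>F\<^esub>b\<in>B. c b \<odot>\<^bsub>F\<^esub> b)"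
    using assms by (auto simp: graded_free_def)
  have "\<forall>b\<in>B. \<exists>r. b \<in> gr F r" using B(2) by blast
  then obtain dg where dg: "\<And>b. b \<in> B \<Longrightarrow> b \<in> gr F (dg b)" by metis
  have Bc: "b \<in> carrier F" if "b \<in> B" for b
    using additive_subgroup.a_Hcarr[OF gr_subgroup dg[OF that]] .
  define \<kappa> where "\<kappa> f = (\<Oplus>\<^bsub>F\<^esub>b\<in>B. to_poly (f b) \<odot>\<^bsub>F\<^esub> b)" for f :: "('f, 'k) laurent"
  note tc = to_poly_carrier
  have term_closed: "(\<lambda>b. to_poly (f b) \<odot>\<^bsub>F\<^esub> b) \<in> B \<rightarrow> carrier F" if "f \<in> Loc B {}" for f
    using tc[OF that] Bc by auto
  have closed: "\<kappa> f \<in> carrier F" if "f \<in> Loc B {}" for f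
    unfolding \<kappa>_def by (rule M.finsum_closed[OF term_closed[OF that]])
  have surj: "\<kappa> ` Loc B {} = carrier F"
  proof (intro equalityI subsetI)
    fix x assume "x \<in> carrier F"
    then obtain c where c: "c \<in> B \<rightarrow>\<^sub>E carrier (polyring n)" "x = (\<Oplus>\<^bsub>F\<^esub>b\<in>B. c b \<odot>\<^bsub>F\<^esub> b)"
      using uniq by blast
    \<comment> \<open>Off the natural exponents the value is set to 0, as \<open>inv_into\<close>
      carries no information there.\<close>
    define f where "f b \<alpha> = (if b \<in> B \<and> \<alpha> \<in> range emb then Poly_Mapping.lookup (c b) (inv_into UNIV emb \<alpha>) else 0)" for b \<alpha>
    have fe: "f b (emb m) = Poly_Mapping.lookup (c b) m" if "b \<in> B" for b m
      using that by (simp add: f_def inv_f_f[OF inj_emb])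
    have supp: "\<exists>m. \<alpha> = emb m \<and> m \<in> Poly_Mapping.keys (c b) \<and> b \<in> B" if "f b \<alpha> \<noteq> 0" for b \<alpha>
      using that by (auto simp: f_def inv_f_f[OF inj_emb] in_keys_iff split: if_splits)
    have ck: "Poly_Mapping.keys m \<subseteq> {..<n}" if "b \<in> B" "m \<in> Poly_Mapping.keys (c b)" for b m
    proof -
      have "c b \<in> carrier (polyring n)" using c(1) that(1) by blast
      then show ?thesis using that(2) by (auto simp: polyring_def)
    qed
    have fL: "f \<in> Loc B {}"
      unfolding Loc_def
    proof (intro CollectI conjI allI impI)
      show "finite {\<alpha>. f b \<alpha> \<noteq> 0}" for b
        by (rule finite_subset[of _ "emb ` Poly_Mapping.keys (c b)"]) (use supp in blast, simp)
      fix b \<alpha> assume "f b \<alpha> \<noteq> 0"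
      then obtain m where m: "\<alpha> = emb m" "m \<in> Poly_Mapping.keys (c b)" "b \<in> B" using supp by blast
      show "b \<in> B" by (rule m(3))
      show "\<alpha> i = 0" if "n \<le> i" for i
        using ck[OF m(3,2)] that by (auto simp: m(1) emb_def in_keys_iff)
      show "0 \<le> \<alpha> i" for i by (simp add: m(1) emb_def)
    qed
    have "to_poly (f b) = c b" if "b \<in> B" for b
      by (rule poly_mapping_eqI) (simp add: lookup_to_poly_Loc[OF fL] fe[OF that])
    then have "\<kappa> f = x"
      unfolding \<kappa>_def c(2) using c(1) Bc by (intro M.finsum_cong') auto
    then show "x \<in> \<kappa> ` Loc B {}" using fL by blast
  qed (use closed in blast)
  have add: "\<kappa> f \<oplus>\<^bsub>F\<^esub> \<kappa> g = \<kappa> (f + g)" if f: "f \<in> Loc B {}" and g: "g \<in> Loc B {}" for f g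
  proof -
    have "to_poly ((f + g) b) \<odot>\<^bsub>F\<^esub> b = to_poly (f b) \<odot>\<^bsub>F\<^esub> b \<oplus>\<^bsub>F\<^esub> to_poly (g b) \<odot>\<^bsub>F\<^esub> b" if "b \<in> B" for b
      using smult_l_distr[OF tc[OF f] tc[OF g] Bc[OF that], of b b]
      unfolding to_poly_add[OF f g] by (simp add: polyring_def)
    then have "\<kappa> (f + g) = (\<Oplus>\<^bsub>F\<^esub>b\<in>B. to_poly (f b) \<odot>\<^bsub>F\<^esub> b \<oplus>\<^bsub>F\<^esub> to_poly (g b) \<odot>\<^bsub>F\<^esub> b)"
      unfolding \<kappa>_def using term_closed[OF f] term_closed[OF g] by (intro M.finsum_cong') auto
    also have "\<dots> = \<kappa> f \<oplus>\<^bsub>F\<^esub> \<kappa> g"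
      unfolding \<kappa>_def by (rule M.finsum_addf[OF term_closed[OF f] term_closed[OF g]])
    finally show ?thesis by simp
  qed
  have smult: "p \<odot>\<^bsub>F\<^esub> \<kappa> f = \<kappa> g" if f: "f \<in> Loc B {}" and p: "p \<in> carrier (polyring n)"
    and pg: "\<And>b. to_poly (g b) = p * to_poly (f b)" for f g p
  proof -
    have "p \<odot>\<^bsub>F\<^esub> \<kappa> f = (\<Oplus>\<^bsub>F\<^esub>b\<in>B. p \<odot>\<^bsub>F\<^esub> (to_poly (f b) \<odot>\<^bsub>F\<^esub> b))"
      unfolding \<kappa>_def by (rule finsum_smult_ldistr[OF B(1) p term_closed[OF f]])
    also have "\<dots> = \<kappa> g"
      unfolding \<kappa>_def
    proof (rule M.finsum_cong')
      have *: "to_poly (g b) \<odot>\<^bsub>F\<^esub> b = p \<odot>\<^bsub>F\<^esub> (to_poly (f b) \<odot>\<^bsub>F\<^esub> b)" if "b \<in> B" for b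
        using smult_assoc1[OF p tc[OF f] Bc[OF that], of b] by (simp add: pg polyring_def)
      then show "p \<odot>\<^bsub>F\<^esub> (to_poly (f b) \<odot>\<^bsub>F\<^esub> b) = to_poly (g b) \<odot>\<^bsub>F\<^esub> b" if "b \<in> B" for b
        using that by simp
      show "(\<lambda>b. to_poly (g b) \<odot>\<^bsub>F\<^esub> b) \<in> B \<rightarrow> carrier F"
        by (intro Pi_I) (simp add: * tc[OF f] Bc p)
    qed simp
    finally show ?thesis .
  qed
  have zero: "\<kappa> 0 = \<zero>\<^bsub>F\<^esub>"
    using add[of 0 0] closed[of 0] M.add.l_cancel_one'[of "\<kappa> 0" "\<kappa> 0"] by simp
  have deg: "\<kappa> f \<in> gr F r" if f: "f \<in> Loc B {}" and h: "homog dg r f" for f r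
  proof -
    interpret gr: additive_subgroup "gr F r" F by (rule gr_subgroup)
    have tg: "to_poly (f b) \<odot>\<^bsub>F\<^esub> b \<in> gr F r" if b: "b \<in> B" for b
    \<comment> \<open>\<open>homog_poly\<close> takes a natural degree, while
      \<open>r - dg b\<close> may be negative if the coefficient is 0; otherwise the degree is read
      off a monomial that occurs.\<close>
    proof (cases "to_poly (f b) = 0")
      case True
      have "\<zero>\<^bsub>polyring n\<^esub> = (0 :: 'k mpol)" by (simp add: polyring_def)
      then show ?thesis using True smult_l_null[OF Bc[OF b]] gr.zero_closed by simp
    next
      case False
      have md: "dg b + int (mdeg m) = r" if m: "m \<in> Poly_Mapping.keys (to_poly (f b))" for m
      proof -
        have "f b (emb m) \<noteq> 0" using m by (simp add: in_keys_iff lookup_to_poly_Loc[OF f])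
        moreover have "Poly_Mapping.keys m \<subseteq> {..<n}" using tc[OF f, of b] m by (simp add: polyring_def)
        ultimately show ?thesis using h by (simp add: homog_def mdeg_emb)
      qed
      from False obtain m0 where m0: "m0 \<in> Poly_Mapping.keys (to_poly (f b))"
        by (metis all_not_in_conv keys_eq_empty)
      have "to_poly (f b) \<in> homog_poly n (mdeg m0)"
        using tc[OF f, of b] md md[OF m0] by (force simp: homog_poly_def)
      from gr_smult[OF this dg[OF b]] show ?thesis using md[OF m0] by simp
    qed
    have "(\<Oplus>\<^bsub>F\<^esub>b\<in>S. to_poly (f b) \<odot>\<^bsub>F\<^esub> b) \<in> gr F r" if "S \<subseteq> B" for S
      using finite_subset[OF that B(1)] that
    proof (induction S)
      case (insert x S)
      then show ?case
        using tg term_closed[OF f] by (subst M.finsum_insert) (auto intro!: gr.a_closed)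
    qed (simp add: gr.zero_closed)
    then show ?thesis by (simp add: \<kappa>_def)
  qed
  have pres: "presentation n B dg F \<kappa>"
  proof
    show "monom_of m \<odot>\<^bsub>F\<^esub> \<kappa> f = \<kappa> (shift (emb m) f)" if "f \<in> Loc B {}" "Poly_Mapping.keys m \<subseteq> {..<n}" for f m
      using that by (intro smult monom_of_carrier to_poly_shift)
    show "(- 1) \<odot>\<^bsub>F\<^esub> \<kappa> f = \<kappa> (- f)" if "f \<in> Loc B {}" for f
      using that by (intro smult minus_one_carrier to_poly_uminus)
    show "gr F r = \<kappa> ` {f \<in> Loc B {}. homog dg r f}" for r
      by (rule gr_eq_image[OF graded_module_axioms B(1) surj zero add deg])
  qed (use B(1) surj add zero in simp_all)
  have "inj_on \<kappa> (Loc B {})"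
  proof (rule inj_onI)
    fix f g assume f: "f \<in> Loc B {}" and g: "g \<in> Loc B {}" and eq: "\<kappa> f = \<kappa> g"
    \<comment> \<open>Uniqueness of coordinates holds among functions that are undefined off
      \<open>B\<close>, hence the restriction.\<close>
    let ?c = "\<lambda>f. \<lambda>b\<in>B. to_poly (f b)"
    have ch: "?c h \<in> B \<rightarrow>\<^sub>E carrier (polyring n) \<and> \<kappa> h = (\<Oplus>\<^bsub>F\<^esub>b\<in>B. ?c h b \<odot>\<^bsub>F\<^esub> b)" if h: "h \<in> Loc B {}" for h
      unfolding \<kappa>_def using tc[OF h] term_closed[OF h] by (auto intro!: M.finsum_cong')
    obtain c0 where c0: "\<And>c. c \<in> B \<rightarrow>\<^sub>E carrier (polyring n) \<and> \<kappa> f = (\<Oplus>\<^bsub>F\<^esub>b\<in>B. c b \<odot>\<^bsub>F\<^esub> b) \<Longrightarrow> c = c0"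
      using uniq[rule_format, OF closed[OF f]] by (elim ex1E) blast
    have "?c f = c0" by (rule c0[OF ch[OF f]])
    moreover have "?c g = c0" by (rule c0) (use ch[OF g] eq in simp)
    ultimately have "?c f = ?c g" by simp
    then have p: "to_poly (f b) = to_poly (g b)" if "b \<in> B" for b
      using that by (metis restrict_apply')
    show "f = g"
    proof (intro ext, rule ccontr)
      fix b \<alpha> assume ne: "f b \<alpha> \<noteq> g b \<alpha>"
      then have "f b \<alpha> \<noteq> 0 \<or> g b \<alpha> \<noteq> 0" by auto
      then obtain m where "b \<in> B" "emb m = \<alpha>"
        using Loc_exponent[OF f, of b \<alpha>] Loc_exponent[OF g, of b \<alpha>] Loc_basis[OF f, of b \<alpha>] Loc_basis[OF g, of b \<alpha>]
        by metis
      then show False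
        using ne p[of b] lookup_to_poly_Loc[OF f, of b m] lookup_to_poly_Loc[OF g, of b m] by simp
    qed
  qed
  with pres show ?thesis by blast
qed

end

context presentation
begin

text \<open>Meant for the augmentation: it presents M directly by F_0, without an isomorphism
  between M and N_0.\<close>

lemma presentation_hom:
  assumes N: "graded_module n N" and M: "graded_module n M" and h: "graded_hom n N M h"
    and surj: "h ` carrier N = carrier M"
  shows "presentation n B dg M (\<lambda>f. h (\<pi> f))"
proof -
  interpret N: graded_module n N by (rule N)
  interpret M: graded_module n M by (rule M)
  have pc: "\<pi> f \<in> carrier N" if "f \<in> Loc B {}" for f using that pi_image by blast
  have hc: "h x \<in> carrier M" if "x \<in> carrier N" for x using that surj by blast
  have hadd: "h (x \<oplus>\<^bsub>N\<^esub> y) = h x \<oplus>\<^bsub>M\<^esub> h y" if "x \<in> carrier N" "y \<in> carrier N" for x y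
    using h that by (simp add: graded_hom_def)
  have hsm: "h (p \<odot>\<^bsub>N\<^esub> x) = p \<odot>\<^bsub>M\<^esub> h x" if "p \<in> carrier (polyring n)" "x \<in> carrier N" for p x
    using h that by (simp add: graded_hom_def)
  have surj': "(\<lambda>f. h (\<pi> f)) ` Loc B {} = carrier M"
    using surj pi_image by (metis image_image)
  have add: "h (\<pi> f) \<oplus>\<^bsub>M\<^esub> h (\<pi> g) = h (\<pi> (f + g))" if "f \<in> Loc B {}" "g \<in> Loc B {}" for f g
    using hadd[OF pc[OF that(1)] pc[OF that(2)]] pi_add[OF that] by simp
  have zero: "h (\<pi> 0) = \<zero>\<^bsub>M\<^esub>"
    using add[of 0 0] hc[OF pc[of 0]] M.M.add.l_cancel_one'[of "h (\<pi> 0)" "h (\<pi> 0)"] by simp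
  have deg: "h (\<pi> f) \<in> gr M r" if "f \<in> Loc B {}" "homog dg r f" for f r
  proof -
    have "\<pi> f \<in> gr N r" using that by (auto simp: pi_gr)
    then show ?thesis using h unfolding graded_hom_def by blast
  qed
  show ?thesis
  proof
    show "monom_of m \<odot>\<^bsub>M\<^esub> h (\<pi> f) = h (\<pi> (shift (emb m) f))" if "f \<in> Loc B {}" "Poly_Mapping.keys m \<subseteq> {..<n}" for f m
      using hsm[OF monom_of_carrier[OF that(2)] pc[OF that(1)]] pi_monom[OF that] by simp
    show "(- 1) \<odot>\<^bsub>M\<^esub> h (\<pi> f) = h (\<pi> (- f))" if "f \<in> Loc B {}" for f
      using hsm[OF minus_one_carrier pc[OF that]] pi_uminus[OF that] by simp
    show "gr M r = (\<lambda>f. h (\<pi> f)) ` {f \<in> Loc B {}. homog dg r f}" for r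
      by (rule gr_eq_image[OF M finB surj' zero add deg])
  qed (use finB surj' add zero in simp_all)
qed

text \<open>Meant for F_j modulo the image of the next differential; the second part identifies the
  relations of the resulting presentation.\<close>

lemma presentation_quotient:
  assumes N: "graded_module n N" and H: "additive_subgroup H N"
    and Hs: "\<And>p x. p \<in> carrier (polyring n) \<Longrightarrow> x \<in> H \<Longrightarrow> p \<odot>\<^bsub>N\<^esub> x \<in> H"
  shows "presentation n B dg (gquot N H) (\<lambda>f. H +>\<^bsub>N\<^esub> \<pi> f)"
    and "x \<in> carrier N \<Longrightarrow> H +>\<^bsub>N\<^esub> x = \<zero>\<^bsub>gquot N H\<^esub> \<longleftrightarrow> x \<in> H"
proof -
  interpret N: graded_module n N by (rule N)
  interpret H: abelian_subgroup H N
    by (rule abelian_subgroupI3[OF H N.M.abelian_group_axioms])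
  have pc: "\<pi> f \<in> carrier N" if "f \<in> Loc B {}" for f using that pi_image by blast
  have Hc: "x \<in> carrier N" if "x \<in> H" for x using that H.a_Hcarr by blast
  have zero_iff: "H +>\<^bsub>N\<^esub> x = H \<longleftrightarrow> x \<in> H" if "x \<in> carrier N" for x
    using that H.a_rcos_self[OF that] H.a_rcos_const by blast
  then show "x \<in> carrier N \<Longrightarrow> H +>\<^bsub>N\<^esub> x = \<zero>\<^bsub>gquot N H\<^esub> \<longleftrightarrow> x \<in> H"
    by (simp add: gquot_def)
  have sm: "p \<odot>\<^bsub>gquot N H\<^esub> (H +>\<^bsub>N\<^esub> x) = H +>\<^bsub>N\<^esub> (p \<odot>\<^bsub>N\<^esub> x)"
    if p: "p \<in> carrier (polyring n)" and x: "x \<in> carrier N" for p x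
  proof -
    have "H +>\<^bsub>N\<^esub> (p \<odot>\<^bsub>N\<^esub> y) = H +>\<^bsub>N\<^esub> (p \<odot>\<^bsub>N\<^esub> x)" if y: "y \<in> H +>\<^bsub>N\<^esub> x" for y
    proof -
      obtain z where z: "z \<in> H" "y = z \<oplus>\<^bsub>N\<^esub> x" using y by (auto simp: a_r_coset_def')
      have "p \<odot>\<^bsub>N\<^esub> y = p \<odot>\<^bsub>N\<^esub> z \<oplus>\<^bsub>N\<^esub> p \<odot>\<^bsub>N\<^esub> x"
        using N.smult_r_distr[OF p Hc[OF z(1)] x] z(2) by simp
      then have "p \<odot>\<^bsub>N\<^esub> y \<in> H +>\<^bsub>N\<^esub> (p \<odot>\<^bsub>N\<^esub> x)"
        using Hs[OF p z(1)] by (auto simp: a_r_coset_def')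
      from H.a_repr_independence'[OF this] show ?thesis using N.smult_closed[OF p x] by simp
    qed
    moreover have "H +>\<^bsub>N\<^esub> x \<noteq> {}" using H.a_rcos_self[OF x] by blast
    ultimately show ?thesis
      by (auto simp: gquot_def)
  qed
  show "presentation n B dg (gquot N H) (\<lambda>f. H +>\<^bsub>N\<^esub> \<pi> f)"
  proof
    show "(\<lambda>f. H +>\<^bsub>N\<^esub> \<pi> f) ` Loc B {} = carrier (gquot N H)"
      by (auto simp: gquot_def A_RCOSETS_def' pi_image[symmetric])
    show "(H +>\<^bsub>N\<^esub> \<pi> f) \<oplus>\<^bsub>gquot N H\<^esub> (H +>\<^bsub>N\<^esub> \<pi> g) = H +>\<^bsub>N\<^esub> \<pi> (f + g)" if "f \<in> Loc B {}" "g \<in> Loc B {}" for f g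
      using H.a_rcos_sum[OF pc[OF that(1)] pc[OF that(2)]] pi_add[OF that] by (simp add: gquot_def)
    show "monom_of m \<odot>\<^bsub>gquot N H\<^esub> (H +>\<^bsub>N\<^esub> \<pi> f) = H +>\<^bsub>N\<^esub> \<pi> (shift (emb m) f)"
      if "f \<in> Loc B {}" "Poly_Mapping.keys m \<subseteq> {..<n}" for f m
      using sm[OF monom_of_carrier[OF that(2)] pc[OF that(1)]] pi_monom[OF that] by simp
    show "(- 1) \<odot>\<^bsub>gquot N H\<^esub> (H +>\<^bsub>N\<^esub> \<pi> f) = H +>\<^bsub>N\<^esub> \<pi> (- f)" if "f \<in> Loc B {}" for f
      using sm[OF minus_one_carrier pc[OF that]] pi_uminus[OF that] by simp
    show "H +>\<^bsub>N\<^esub> \<pi> 0 = \<zero>\<^bsub>gquot N H\<^esub>"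
      using zero_iff[of "\<zero>\<^bsub>N\<^esub>"] H.zero_closed by (simp add: gquot_def pi_zero)
    show "gr (gquot N H) r = (\<lambda>f. H +>\<^bsub>N\<^esub> \<pi> f) ` {f \<in> Loc B {}. homog dg r f}" for r
      by (simp add: gquot_def pi_gr image_image)
  qed (rule finB)
qed

end

section \<open>Syzygies of a minimal free resolution\<close>

lemma graded_hom_image_subgroup:
  assumes M: "graded_module n M" and N: "graded_module n N" and h: "graded_hom n M N h"
  shows "additive_subgroup (h ` carrier M) N"
    and "p \<in> carrier (polyring n) \<Longrightarrow> y \<in> h ` carrier M \<Longrightarrow> p \<odot>\<^bsub>N\<^esub> y \<in> h ` carrier M"
proof -
  interpret M: graded_module n M by (rule M)
  interpret N: graded_module n N by (rule N)
  have "abelian_group_hom M N h"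
    using h by (intro abelian_group_homI M.M.abelian_group_axioms N.M.abelian_group_axioms group_hom.intro
        group_hom_axioms.intro M.M.a_group N.M.a_group) (auto simp: hom_def graded_hom_def)
  then interpret h: abelian_group_hom M N h .
  show "additive_subgroup (h ` carrier M) N"
    using group_hom.img_is_subgroup[OF h.a_group_hom] by (auto intro: additive_subgroup.intro)
  show "p \<in> carrier (polyring n) \<Longrightarrow> y \<in> h ` carrier M \<Longrightarrow> p \<odot>\<^bsub>N\<^esub> y \<in> h ` carrier M"
  proof -
    assume p: "p \<in> carrier (polyring n)" and "y \<in> h ` carrier M"
    then obtain x where x: "x \<in> carrier M" "y = h x" by blast
    have "h (p \<odot>\<^bsub>M\<^esub> x) = p \<odot>\<^bsub>N\<^esub> y" using h p x by (simp add: graded_hom_def)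
    then show ?thesis using M.smult_closed[OF p x(1)] by (metis imageI)
  qed
qed

locale resolution_coordinates = laurent_vectors n for n +
  fixes M :: "('k::field mpol, 'm) gmodule" and F :: "nat \<Rightarrow> ('k mpol, 'f) gmodule"
    and d :: "nat \<Rightarrow> 'f \<Rightarrow> 'f" and aug :: "'f \<Rightarrow> 'm" and s :: nat
    and B :: "nat \<Rightarrow> 'f set" and dg :: "nat \<Rightarrow> 'f \<Rightarrow> int"
    and \<kappa> :: "nat \<Rightarrow> ('f, 'k) laurent \<Rightarrow> 'f"
  assumes M: "graded_module n M" and res: "minimal_free_resolution n M s F d aug"
    and pres: "presentation n (B j) (dg j) (F j) (\<kappa> j)"
    and inj: "inj_on (\<kappa> j) (Loc (B j) {})"
begin

abbreviation A :: "nat \<Rightarrow> ('f, 'k) laurent set" where "A j \<equiv> Loc (B j) {}"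

lemma graded_F: "graded_module n (F j)"
  using res by (simp add: minimal_free_resolution_def graded_free_def)

lemma hom_d: "graded_hom n (F (Suc j)) (F j) (d j)"
  using res by (simp add: minimal_free_resolution_def)

text \<open>The differential conjugated by the coordinate isomorphisms, i.e. its matrix
  form.\<close>

definition dc :: "nat \<Rightarrow> ('f, 'k) laurent \<Rightarrow> ('f, 'k) laurent" where
  "dc j f = inv_into (A j) (\<kappa> j) (d j (\<kappa> (Suc j) f))"

lemma kappa_image: "\<kappa> j ` A j = carrier (F j)"
  using presentation.pi_image[OF pres] .

lemma kappa_eq_iff: "f \<in> A j \<Longrightarrow> g \<in> A j \<Longrightarrow> \<kappa> j f = \<kappa> j g \<longleftrightarrow> f = g"
  using inj by (meson inj_onD)

lemma dc_closed: "f \<in> A (Suc j) \<Longrightarrow> dc j f \<in> A j"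
  and kappa_dc: "f \<in> A (Suc j) \<Longrightarrow> \<kappa> j (dc j f) = d j (\<kappa> (Suc j) f)"
proof -
  assume f: "f \<in> A (Suc j)"
  have "d j (\<kappa> (Suc j) f) \<in> carrier (F j)"
    using f hom_d[of j] kappa_image[of "Suc j"] by (auto simp: graded_hom_def)
  then have *: "d j (\<kappa> (Suc j) f) \<in> \<kappa> j ` A j" by (simp add: kappa_image)
  show "dc j f \<in> A j" unfolding dc_def by (rule inv_into_into[OF *])
  show "\<kappa> j (dc j f) = d j (\<kappa> (Suc j) f)" unfolding dc_def by (rule f_inv_into_f[OF *])
qed

lemma kappa_dc_image: "\<kappa> j ` dc j ` A (Suc j) = d j ` carrier (F (Suc j))"
proof -
  have "\<kappa> j ` dc j ` A (Suc j) = (\<lambda>f. d j (\<kappa> (Suc j) f)) ` A (Suc j)"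
    using kappa_dc by (simp add: image_image cong: image_cong)
  also have "\<dots> = d j ` carrier (F (Suc j))"
    by (simp add: image_image kappa_image[symmetric])
  finally show ?thesis .
qed

lemma kappa_in_image_iff:
  assumes f: "f \<in> A j" shows "\<kappa> j f \<in> d j ` carrier (F (Suc j)) \<longleftrightarrow> f \<in> dc j ` A (Suc j)"
  unfolding kappa_dc_image[symmetric] using dc_closed f
  by (auto simp: image_iff) (metis kappa_eq_iff)

lemma laurent_map_dc: "laurent_map n (B (Suc j)) (dg (Suc j)) (B j) (dg j) (dc j)"
proof -
  interpret P: presentation n "B j" "dg j" "F j" "\<kappa> j" by (rule pres)
  interpret P': presentation n "B (Suc j)" "dg (Suc j)" "F (Suc j)" "\<kappa> (Suc j)" by (rule pres)
  have kc: "\<kappa> (Suc j) f \<in> carrier (F (Suc j))" if "f \<in> A (Suc j)" for f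
    using that kappa_image by blast
  show ?thesis
  proof
    show "finite (B (Suc j))" "finite (B j)" by (rule P'.finB, rule P.finB)
    show "dc j f \<in> A j" if "f \<in> A (Suc j)" for f by (rule dc_closed[OF that])
    show "dc j (f + g) = dc j f + dc j g" if f: "f \<in> A (Suc j)" and g: "g \<in> A (Suc j)" for f g
    proof -
      have "\<kappa> j (dc j (f + g)) = d j (\<kappa> (Suc j) f \<oplus>\<^bsub>F (Suc j)\<^esub> \<kappa> (Suc j) g)"
        using f g by (simp only: kappa_dc[OF Loc_add] P'.pi_add)
      also have "\<dots> = \<kappa> j (dc j f) \<oplus>\<^bsub>F j\<^esub> \<kappa> j (dc j g)"
        using hom_d[of j] kc f g by (simp add: graded_hom_def kappa_dc)
      also have "\<dots> = \<kappa> j (dc j f + dc j g)"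
        using f g by (intro P.pi_add dc_closed)
      finally show ?thesis
        using f g kappa_eq_iff[OF dc_closed[OF Loc_add] Loc_add[OF dc_closed dc_closed]] by blast
    qed
    show "dc j (shift m f) = shift m (dc j f)" if f: "f \<in> A (Suc j)" and m: "m \<in> expo {..<n}" for f m
    proof -
      obtain u where u: "Poly_Mapping.keys u \<subseteq> {..<n}" "emb u = m" using ex_emb[OF _ m] by blast
      note sf = Loc_shift_expo[OF f m]
      have "\<kappa> j (dc j (shift m f)) = d j (monom_of u \<odot>\<^bsub>F (Suc j)\<^esub> \<kappa> (Suc j) f)"
        using P'.pi_monom[OF f u(1)] u(2) by (simp add: kappa_dc[OF sf])
      also have "\<dots> = monom_of u \<odot>\<^bsub>F j\<^esub> \<kappa> j (dc j f)"
      proof -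
        have "monom_of u \<in> carrier (polyring n :: 'k mpol ring)" by (rule monom_of_carrier[OF u(1)])
        then show ?thesis using hom_d[of j] kc[OF f] by (simp add: graded_hom_def kappa_dc[OF f])
      qed
      also have "\<dots> = \<kappa> j (shift m (dc j f))"
        using P.pi_monom[OF dc_closed[OF f] u(1)] u(2) by simp
      finally show ?thesis
        using kappa_eq_iff[OF dc_closed[OF sf] Loc_shift_expo[OF dc_closed[OF f] m]] by blast
    qed
    show "homog (dg j) r (dc j f)" if f: "f \<in> A (Suc j)" and h: "homog (dg (Suc j)) r f" for f r
    proof -
      have "\<kappa> (Suc j) f \<in> gr (F (Suc j)) r" using f h by (auto simp: P'.pi_gr)
      then have "d j (\<kappa> (Suc j) f) \<in> gr (F j) r" using hom_d[of j] unfolding graded_hom_def by blast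
      then obtain g where g: "g \<in> A j" "homog (dg j) r g" "\<kappa> j (dc j f) = \<kappa> j g"
        by (auto simp: P.pi_gr kappa_dc[OF f])
      then have "dc j f = g" using kappa_eq_iff[OF dc_closed[OF f] g(1)] by blast
      then show ?thesis using g(2) by simp
    qed
  qed
qed

lemma dc_exact: "{f \<in> A (Suc j). dc j f = 0} = dc (Suc j) ` A (Suc (Suc j))"
proof -
  interpret P: presentation n "B j" "dg j" "F j" "\<kappa> j" by (rule pres)
  have ker: "a_kernel (F (Suc j)) (F j) (d j) = d (Suc j) ` carrier (F (Suc (Suc j)))"
    using res by (simp add: minimal_free_resolution_def)
  have "dc j f = 0 \<longleftrightarrow> f \<in> dc (Suc j) ` A (Suc (Suc j))" if f: "f \<in> A (Suc j)" for f
  proof -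
    have "dc j f = 0 \<longleftrightarrow> \<kappa> j (dc j f) = \<kappa> j 0"
      using kappa_eq_iff[OF dc_closed[OF f] Loc_zero] by simp
    also have "\<dots> \<longleftrightarrow> \<kappa> (Suc j) f \<in> a_kernel (F (Suc j)) (F j) (d j)"
      using f kappa_image[of "Suc j"] by (auto simp: kappa_dc[OF f] P.pi_zero a_kernel_def')
    also have "\<dots> \<longleftrightarrow> f \<in> dc (Suc j) ` A (Suc (Suc j))"
      unfolding ker by (rule kappa_in_image_iff[OF f])
    finally show ?thesis .
  qed
  moreover have "dc (Suc j) ` A (Suc (Suc j)) \<subseteq> A (Suc j)" using dc_closed by blast
  ultimately show ?thesis by blast
qed

text \<open>An element of R_+ F_j is a sum of products x_i g_i, and a constant coefficient would
  require exponent -1 at \<open>i\<close> in \<open>g i\<close>.\<close>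

lemma dc_minimal:
  assumes f: "f \<in> A (Suc j)" shows "dc j f b 0 = 0"
proof -
  interpret P: presentation n "B j" "dg j" "F j" "\<kappa> j" by (rule pres)
  interpret F: graded_module n "F j" by (rule graded_F)
  have "d j ` carrier (F (Suc j)) \<subseteq> irrelevant_smult n (F j)"
    using res by (simp add: minimal_free_resolution_def)
  moreover have "\<kappa> (Suc j) f \<in> carrier (F (Suc j))" using f kappa_image by blast
  ultimately have "d j (\<kappa> (Suc j) f) \<in> irrelevant_smult n (F j)" by blast
  then obtain y where y: "y \<in> {..<n} \<rightarrow> carrier (F j)"
    "\<kappa> j (dc j f) = (\<Oplus>\<^bsub>F j\<^esub>i\<in>{..<n}. var i \<odot>\<^bsub>F j\<^esub> y i)"
    by (auto simp: irrelevant_smult_def kappa_dc[OF f])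
  have "\<forall>i\<in>{..<n}. \<exists>g\<in>A j. y i = \<kappa> j g" using y(1) kappa_image[of j] by blast
  then obtain g where g: "\<And>i. i < n \<Longrightarrow> g i \<in> A j \<and> y i = \<kappa> j (g i)" by (metis lessThan_iff)
  define e where "e i = emb (Poly_Mapping.single i 1)" for i
  have k: "Poly_Mapping.keys (Poly_Mapping.single i (1::nat)) \<subseteq> {..<n}" if "i < n" for i
    using that by simp
  have sg: "shift (e i) (g i) \<in> A j" if "i < n" for i
    using g[OF that] k[OF that] by (intro Loc_shift_expo) (auto simp: e_def emb_expo)
  have vy: "var i \<odot>\<^bsub>F j\<^esub> y i = \<kappa> j (shift (e i) (g i))" if "i < n" for i
    using P.pi_monom[OF _ k[OF that], of "g i"] g[OF that] by (simp add: var_def e_def)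
  have "(\<Oplus>\<^bsub>F j\<^esub>i\<in>{..<n}. var i \<odot>\<^bsub>F j\<^esub> y i) = (\<Oplus>\<^bsub>F j\<^esub>i\<in>{..<n}. \<kappa> j (shift (e i) (g i)))"
    using vy sg kappa_image[of j] by (intro F.M.finsum_cong') auto
  also have "\<dots> = \<kappa> j (\<Sum>i<n. shift (e i) (g i))"
    by (rule finsum_additive_map[where B = "B j", OF F.M.abelian_monoid_axioms _ P.pi_zero P.pi_add])
      (use sg kappa_image[of j] in auto)
  finally have "\<kappa> j (dc j f) = \<kappa> j (\<Sum>i<n. shift (e i) (g i))" using y(2) by simp
  moreover have "(\<Sum>i<n. shift (e i) (g i)) \<in> A j"
    by (rule Loc_sum) (use sg in simp)
  ultimately have "dc j f = (\<Sum>i<n. shift (e i) (g i))"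
    using kappa_eq_iff[OF dc_closed[OF f]] by blast
  then have "dc j f b 0 = (\<Sum>i<n. g i b (0 - e i))"
    by (simp add: sum_fun_apply shift_apply)
  also have "\<dots> = 0"
  proof (rule sum.neutral, rule ballI, rule ccontr)
    fix i assume i: "i \<in> {..<n}" and "g i b (0 - e i) \<noteq> 0"
    then have "0 \<le> (0 - e i) i" using Loc_nonneg[of "g i" "B j" "{}" b "0 - e i" i] g[of i] by simp
    then show False by (simp add: e_def emb_def)
  qed
  finally show ?thesis .
qed

lemma bounded_basis:
  assumes "s < j" shows "B j = {}"
proof (rule ccontr)
  interpret P: presentation n "B j" "dg j" "F j" "\<kappa> j" by (rule pres)
  assume "B j \<noteq> {}"
  then obtain b where b: "b \<in> B j" by blast
  define f :: "('f, 'k) laurent" where "f = (\<lambda>b' \<alpha>. if b' = b \<and> \<alpha> = 0 then 1 else 0)"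
  have f: "f \<in> A j" using b by (auto simp: f_def Loc_def)
  have "carrier (F j) = {\<zero>\<^bsub>F j\<^esub>}" using res assms by (simp add: minimal_free_resolution_def)
  then have "\<kappa> j f = \<kappa> j 0" using f kappa_image[of j] P.pi_zero by auto
  then have "f = 0" using kappa_eq_iff[OF f Loc_zero] by blast
  then have "f b 0 = 0" by simp
  then show False by (simp add: f_def)
qed

sublocale laurent_resolution n B dg dc s
  by (intro laurent_resolution.intro laurent_map_dc dc_exact dc_minimal bounded_basis)

text \<open>The kernel of \<open>aug\<close> is the image of \<open>d 0\<close>, so M is presented
  with the relations \<open>D 0\<close>.\<close>

lemma local_cohomology_M:
  "gr (local_cohomology n M q) r \<noteq> {\<zero>\<^bsub>local_cohomology n M q\<^esub>} \<longleftrightarrow> nz 0 q r"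
proof -
  interpret P: presentation n "B 0" "dg 0" "F 0" "\<kappa> 0" by (rule pres)
  have aug: "graded_hom n (F 0) M aug" "aug ` carrier (F 0) = carrier M"
    and ker: "a_kernel (F 0) M aug = d 0 ` carrier (F (Suc 0))"
    using res by (simp_all add: minimal_free_resolution_def)
  interpret Q: presentation n "B 0" "dg 0" M "\<lambda>f. aug (\<kappa> 0 f)"
    by (rule P.presentation_hom[OF graded_F M aug])
  have "aug (\<kappa> 0 f) = \<zero>\<^bsub>M\<^esub> \<longleftrightarrow> f \<in> dc 0 ` A (Suc 0)" if f: "f \<in> A 0" for f
  proof -
    have "aug (\<kappa> 0 f) = \<zero>\<^bsub>M\<^esub> \<longleftrightarrow> \<kappa> 0 f \<in> a_kernel (F 0) M aug"
      using f kappa_image[of 0] by (auto simp: a_kernel_def')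
    then show ?thesis by (simp add: ker kappa_in_image_iff[OF f])
  qed
  then have "Q.D = D 0" using dc_closed[of _ 0] by (auto simp: Q.D_def D_def)
  then show ?thesis using Q.local_cohomology_nonzero_iff by simp
qed

lemma local_cohomology_Syz:
  "gr (local_cohomology n (Syz F d j) q) r \<noteq> {\<zero>\<^bsub>local_cohomology n (Syz F d j) q\<^esub>} \<longleftrightarrow> nz j q r"
proof -
  let ?H = "d j ` carrier (F (Suc j))"
  interpret P: presentation n "B j" "dg j" "F j" "\<kappa> j" by (rule pres)
  note H = graded_hom_image_subgroup[OF graded_F graded_F hom_d[of j]]
  interpret Q: presentation n "B j" "dg j" "Syz F d j" "\<lambda>f. ?H +>\<^bsub>F j\<^esub> \<kappa> j f"
    unfolding Syz_def by (rule P.presentation_quotient(1)[OF graded_F H])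
  have "?H +>\<^bsub>F j\<^esub> \<kappa> j f = \<zero>\<^bsub>Syz F d j\<^esub> \<longleftrightarrow> f \<in> dc j ` A (Suc j)" if f: "f \<in> A j" for f
  proof -
    have "\<kappa> j f \<in> carrier (F j)" using f kappa_image by blast
    from P.presentation_quotient(2)[OF graded_F H this] show ?thesis
      unfolding Syz_def by (simp add: kappa_in_image_iff[OF f])
  qed
  then have "Q.D = D j" using dc_closed[of _ j] by (auto simp: Q.D_def D_def)
  then show ?thesis using Q.local_cohomology_nonzero_iff by simp
qed

end

text \<open>A finite constant can be moved to the other side in \<open>ereal\<close>. This covers
  the empty supremum, with value minus infinity, which arises from vanishing cohomology.\<close>

lemma Sup_plus_le_iff: "Sup S + ereal c \<le> X \<longleftrightarrow> (\<forall>x\<in>S. x + ereal c \<le> X)"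
proof -
  have "x + ereal c \<le> X \<longleftrightarrow> x \<le> X - ereal c" for x
    by (subst ereal_le_minus) auto
  then show ?thesis by (simp add: Sup_le_iff)
qed

theorem corollary5p2:
  fixes n t s :: nat
    and M :: "(('k::field) mpol, 'm) gmodule"
    and F :: "nat \<Rightarrow> ('k mpol, 'f) gmodule"
    and d :: "nat \<Rightarrow> 'f \<Rightarrow> 'f"
    and aug :: "'f \<Rightarrow> 'm"
  assumes "graded_module n M"
    and "fin_generated n M"
    and "minimal_free_resolution n M s F d aug"
    and "t \<le> n"
  shows "reg_upto n t M = reg n (Syz F d (n - t)) - ereal (real n) + ereal (real t) \<and>
    a_star_upto n t M = a_star n (Syz F d (n - t))"
proof -
  interpret laurent_vectors n .
  have "\<forall>j. \<exists>(B :: 'f set) dg \<kappa>. presentation n B dg (F j) \<kappa> \<and> inj_on \<kappa> (Loc B {})"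
  proof
    fix j
    have "graded_free n (F j)" using assms(3) by (simp add: minimal_free_resolution_def)
    then show "\<exists>(B :: 'f set) dg \<kappa>. presentation n B dg (F j) \<kappa> \<and> inj_on \<kappa> (Loc B {})"
      by (rule graded_free_coordinates)
  qed
  then obtain B :: "nat \<Rightarrow> 'f set" and dg \<kappa>
    where "\<And>j. presentation n (B j) (dg j) (F j) (\<kappa> j)" "\<And>j. inj_on (\<kappa> j) (Loc (B j) {})"
    by metis
  then interpret resolution_coordinates n M F d aug s B dg \<kappa>
    using assms(1,3) by (intro resolution_coordinates.intro)
  let ?S = "Syz F d (n - t)"
  have aM: "a_inv n M q = Sup {ereal (real_of_int r) | r. nz 0 q r}" for q
    by (simp add: a_inv_def local_cohomology_M)
  have aS: "a_inv n ?S q = Sup {ereal (real_of_int r) | r. nz (n - t) q r}" for q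
    by (simp add: a_inv_def local_cohomology_Syz)
  have regM: "ereal (real_of_int r + real q) \<le> reg_upto n t M" and starM: "ereal (real_of_int r) \<le> a_star_upto n t M"
    if nz: "nz 0 q r" and q: "q \<le> t" for q r
  proof -
    have "ereal (real_of_int r) \<le> a_inv n M q" unfolding aM using nz by (intro Sup_upper) blast
    then show "ereal (real_of_int r) \<le> a_star_upto n t M"
      unfolding a_star_upto_def using q by (intro SUP_upper2[of q]) auto
    have "ereal (real_of_int r + real q) \<le> a_inv n M q + ereal (real q)"
      using add_right_mono[OF \<open>ereal (real_of_int r) \<le> a_inv n M q\<close>, of "ereal (real q)"] by simp
    then show "ereal (real_of_int r + real q) \<le> reg_upto n t M"
      unfolding reg_upto_def using q by (intro SUP_upper2[of q]) auto
  qed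
  have regS: "ereal (real_of_int r + real q) \<le> reg n ?S" and starS: "ereal (real_of_int r) \<le> a_star n ?S"
    if nz: "nz (n - t) q r" for q r
  proof -
    have "ereal (real_of_int r) \<le> a_inv n ?S q" unfolding aS using nz by (intro Sup_upper) blast
    then show "ereal (real_of_int r) \<le> a_star n ?S"
      unfolding a_star_def by (intro SUP_upper2[of q]) auto
    have "ereal (real_of_int r + real q) \<le> a_inv n ?S q + ereal (real q)"
      using add_right_mono[OF \<open>ereal (real_of_int r) \<le> a_inv n ?S q\<close>, of "ereal (real q)"] by simp
    then show "ereal (real_of_int r + real q) \<le> reg n ?S"
      unfolding reg_def by (intro SUP_upper2[of q]) auto
  qed
  have "reg_upto n t M \<le> reg n ?S - ereal (real n) + ereal (real t)"
    unfolding reg_upto_def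
  proof (intro SUP_least)
    fix q assume q: "q \<in> {0..t}"
    have "ereal (real_of_int r) + ereal (real q) \<le> reg n ?S - ereal (real n) + ereal (real t)" if "nz 0 q r" for r
    proof -
      \<comment> \<open>The class keeps its degree and gains n - t in the index, which is the shift
        in the claim.\<close>
      have "ereal (real_of_int r + real (q + (n - t))) \<le> reg n ?S"
        using q assms(4) that by (intro regS nz_to_syzygy) auto
      then show ?thesis using assms(4) by (cases "reg n ?S") (auto simp: of_nat_diff)
    qed
    then show "a_inv n M q + ereal (real q) \<le> reg n ?S - ereal (real n) + ereal (real t)"
      unfolding aM Sup_plus_le_iff by blast
  qed
  moreover have "reg n ?S - ereal (real n) + ereal (real t) \<le> reg_upto n t M"
  proof -
    \<comment> \<open>The finite shift is moved to the right, so that the supremum stands alone and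
      can be bounded class by class.\<close>
    have "reg n ?S \<le> reg_upto n t M + ereal (real n - real t)"
      unfolding reg_def
    proof (intro SUP_least)
      fix q
      have "ereal (real_of_int r) + ereal (real q) \<le> reg_upto n t M + ereal (real n - real t)"
        if nzr: "nz (n - t) q r" for r
      proof -
        obtain q' r' where q': "q' \<le> t" "r + int q - int n + int t \<le> r' + int q'" "nz 0 q' r'"
          using nz_from_syzygy[OF nzr assms(4)] by blast
        have "real_of_int (r + int q - int n + int t) \<le> real_of_int (r' + int q')"
          using q'(2) by (simp only: of_int_le_iff)
        then have "real_of_int r + real q \<le> real_of_int r' + real q' + (real n - real t)" by simp
        moreover have "ereal (real_of_int r' + real q') \<le> reg_upto n t M"
          using q' by (intro regM)
        ultimately show ?thesis by (cases "reg_upto n t M") auto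
      qed
      then show "a_inv n ?S q + ereal (real q) \<le> reg_upto n t M + ereal (real n - real t)"
        unfolding aS Sup_plus_le_iff by blast
    qed
    then show ?thesis by (cases "reg n ?S"; cases "reg_upto n t M") auto
  qed
  moreover have "a_star_upto n t M \<le> a_star n ?S"
    unfolding a_star_upto_def aM
    by (intro SUP_least Sup_least) (use assms(4) in \<open>auto intro: starS nz_to_syzygy\<close>)
  moreover have "a_star n ?S \<le> a_star_upto n t M"
    unfolding a_star_def aS
  proof (intro SUP_least Sup_least)
    fix q x assume "x \<in> {ereal (real_of_int r) | r. nz (n - t) q r}"
    then obtain r where r: "x = ereal (real_of_int r)" "nz (n - t) q r" by blast
    obtain q' r' where q': "q' \<le> t" "r \<le> r'" "nz 0 q' r'"
      using nz_from_syzygy[OF r(2) assms(4)] by blast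
    have "x \<le> ereal (real_of_int r')" using q'(2) r(1) by simp
    also have "\<dots> \<le> a_star_upto n t M" using q' by (intro starM)
    finally show "x \<le> a_star_upto n t M" .
  qed
  ultimately show ?thesis by (auto intro: antisym)
qed

end
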